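(* There exist absolute constants $C_0,C_1>0$ and $c>1$ such that the following holds in the setting of the context. Let $B>1$, let $d_\theta\ge2$, let $\theta^\star\in\mathbb R^{d_\theta}$ satisfy $\max_{\alpha\in\mathcal E_s}|\eta_\alpha(\theta^\star)|\le\log B$, let the responses be distributed according to $\mathbb P_{\theta^\star}^{(N)}$, and let $\mathbf W\succ\mathbf 0$. Let $r_{\mathrm{eff}}=\mathrm{tr}(\nabla^2\ell(\theta^\star)^{-1})/\|\nabla^2\ell(\theta^\star)^{-1}\|$. If $$N\ge C_0\max\Big\{B^3\mu_Qd_\theta^{3/2}\log^3d,\ B^4\mu_Qd_\theta\log d,\ \frac{B\mu_Qd_\theta\log d_\theta}{r_{\mathrm{eff}}},\ \frac{B\mu_Qd_\theta^2}{r_{\mathrm{eff}}\log d_\theta}\Big\},$$ then the maximum likelihood estimator $\hat\theta$ (the unique minimizer of $\ell$ over $\mathbb R^{d_\theta}$ when it exists; the event below is understood to include its existence) satisfies $$\mathbb P_{\theta^\star}^{(N)}\Big\{\|\hat\theta-\theta^\star\|_2^2\le C_1\frac{\mathrm{tr}(\nabla^2\ell(\theta^\star)^{-1})\log d_\theta}{N}\Big\}\ge1-2d^{-c}-d_\theta^{-c}.$$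
   Context: Model (Bradley–Terry–Luce with linear-in-parameter utility). Fix an integer $d\ge2$, feature vectors $\phi(\mathbf x_1),\dots,\phi(\mathbf x_d)\in\mathbb R^p$, the matrix $\mathfrak A\in\mathbb R^{d\times p}$ with rows $\phi(\mathbf x_i)^\top$, a scale $\sigma>0$, and a consistent linear system $\mathbf A\mathbf w=\mathbf b$ with $\mathbf A\in\mathbb R^{l\times p}$, $\mathbf b\in\mathbb R^l$. Let $r_A=\mathrm{rank}(\mathbf A)$, $d_\theta=p-r_A$, let $\mathbf V\in\mathbb R^{p\times d_\theta}$ have orthonormal columns spanning $\mathrm{Null}(\mathbf A)$, and $\mathbf w_o=\mathbf A^\dagger\mathbf b$. Feasible parameters are $\mathbf w=\mathbf w_o+\mathbf V\theta$, $\theta\in\mathbb R^{d_\theta}$. Design: a nonempty set of queries $\mathcal E_s\subseteq\{(i,j):1\le i<j\le d\}$ and integers $n_\alpha\ge1$ ($\alpha\in\mathcal E_s$); $N=\sum_{\alpha\in\mathcal E_s}n_\alpha$. For $\alpha=(i,j)$: $\mathbf a_\alpha=\mathfrak A^\top(\mathbf e_i-\mathbf e_j)$, $\mathbf q_\alpha=\mathbf V^\top\mathbf a_\alpha$, $\eta_\alpha(\theta)=(\mathbf w_o^\top\mathbf a_\alpha+\mathbf q_\alpha^\top\theta)/\sigma$. Responses: $Y^{(N)}=(Y_\alpha^{(t)})_{\alpha\in\mathcal E_s,t\in[n_\alpha]}\in\{0,1\}^N$. Under $\mathbb P_\theta^{(N)}$ the coordinates are independent and $Y_\alpha^{(t)}$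 is Bernoulli with success probability $1/(1+e^{-\eta_\alpha(\theta)})$. Negative log-likelihood: with $\Psi(\eta)=\log(1+e^\eta)$ and $Y_\alpha=\sum_{t=1}^{n_\alpha}Y_\alpha^{(t)}$, $\ \ell(\theta)=\frac1N\sum_{\alpha\in\mathcal E_s}\big[-Y_\alpha\eta_\alpha(\theta)+n_\alpha\Psi(\eta_\alpha(\theta))\big]$; its Hessian $\nabla^2\ell(\theta)=\frac1{N\sigma^2}\sum_{\alpha}n_\alpha\Psi''(\eta_\alpha(\theta))\mathbf q_\alpha\mathbf q_\alpha^\top$ is deterministic. Design matrix: $\mathbf W=\frac1N\sum_{\alpha\in\mathcal E_s}n_\alpha\mathbf q_\alpha\mathbf q_\alpha^\top$. Coherence level: $\mu_Q=\max_{\alpha\in\mathcal E_s}\frac1{d_\theta}\mathbf q_\alpha^\top\mathbf W^{-1}\mathbf q_\alpha$. $\|\cdot\|$ is the spectral norm of a matrix. "Absolute constant" means a number independent of all quantities in the problem ($d,p,N,B,\sigma$, the design, $\theta^\star$). *)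

theory Defs
  imports
    "HOL-Probability.Probability"
    "Jordan_Normal_Form.Gauss_Jordan_Elimination"
    "Jordan_Normal_Form.Matrix_Kernel"
    "Jordan_Normal_Form.DL_Rank"
begin

text \<open>Since the constants in the theorem must not depend on any dimension, the dimensions are
  ordinary natural numbers, and vectors and matrices are those of \<^theory>\<open>Jordan_Normal_Form.Matrix\<close>.\<close>

unbundle no inner_syntax and no vec_syntax

section \<open>Matrices\<close>

definition l2norm :: "real vec \<Rightarrow> real" where
  "l2norm x = sqrt (x \<bullet> x)"

definition spectral_norm :: "real mat \<Rightarrow> real" where
  "spectral_norm M = Sup {l2norm (M *\<^sub>v x) | x. x \<in> carrier_vec (dim_col M) \<and> l2norm x \<le> 1}"

definition mat_trace :: "real mat \<Rightarrow> real" where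
  "mat_trace M = (\<Sum>i<dim_row M. M $$ (i, i))"

definition pos_def :: "real mat \<Rightarrow> bool" where
  "pos_def M \<longleftrightarrow> square_mat M \<and> transpose_mat M = M \<and>
     (\<forall>x \<in> carrier_vec (dim_row M). x \<noteq> 0\<^sub>v (dim_row M) \<longrightarrow> 0 < x \<bullet> (M *\<^sub>v x))"

text \<open>Only meaningful for invertible matrices.\<close>

definition mat_inv :: "real mat \<Rightarrow> real mat" where
  "mat_inv M = the (mat_inverse M)"

text \<open>The four Penrose equations, which characterise the pseudoinverse uniquely.\<close>

definition moore_penrose :: "real mat \<Rightarrow> real mat \<Rightarrow> bool" where
  "moore_penrose A X \<longleftrightarrow> X \<in> carrier_mat (dim_col A) (dim_row A) \<and>
     A * X * A = A \<and> X * A * X = X \<and>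
     transpose_mat (A * X) = A * X \<and> transpose_mat (X * A) = X * A"

definition pinv :: "real mat \<Rightarrow> real mat" where
  "pinv A = (THE X. moore_penrose A X)"

section \<open>The Bradley--Terry--Luce model with linear utility\<close>

text \<open>Row \<open>i\<close> of \<open>feat_mat\<close> is the feature vector of item \<open>i\<close>. Items are numbered from \<open>0\<close>, as matrix rows
  are. Only the values of \<open>reps\<close> on \<open>queries\<close> matter.\<close>

record btl =
  n_items :: nat                      (* d *)
  n_feat :: nat                       (* p *)
  n_constr :: nat                     (* l *)
  feat_mat :: "real mat"
  util_scale :: real                       (* sigma *)
  constr_mat :: "real mat"            (* A *)
  constr_rhs :: "real vec"            (* b *)
  null_basis :: "real mat"            (* V *)
  queries :: "(nat \<times> nat) set"        (* E_s *)
  reps :: "nat \<times> nat \<Rightarrow> nat"          (* n_alpha *)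

definition d_theta :: "btl \<Rightarrow> nat" where
  "d_theta P = n_feat P - vec_space.rank (n_constr P) (constr_mat P)"

definition btl_setting :: "btl \<Rightarrow> bool" where
  "btl_setting P \<longleftrightarrow>
     2 \<le> n_items P \<and>
     feat_mat P \<in> carrier_mat (n_items P) (n_feat P) \<and>
     0 < util_scale P \<and>
     constr_mat P \<in> carrier_mat (n_constr P) (n_feat P) \<and>
     constr_rhs P \<in> carrier_vec (n_constr P) \<and>
     (\<exists>w \<in> carrier_vec (n_feat P). constr_mat P *\<^sub>v w = constr_rhs P) \<and>
     null_basis P \<in> carrier_mat (n_feat P) (d_theta P) \<and>
     transpose_mat (null_basis P) * null_basis P = 1\<^sub>m (d_theta P) \<and>
     vec_space.col_space (n_feat P) (null_basis P) = mat_kernel (constr_mat P) \<and>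
     queries P \<noteq> {} \<and>
     queries P \<subseteq> {(i, j). i < j \<and> j < n_items P} \<and>
     (\<forall>\<alpha> \<in> queries P. 1 \<le> reps P \<alpha>)"

definition n_total :: "btl \<Rightarrow> nat" where
  "n_total P = (\<Sum>\<alpha>\<in>queries P. reps P \<alpha>)"

definition w_o :: "btl \<Rightarrow> real vec" where
  "w_o P = pinv (constr_mat P) *\<^sub>v constr_rhs P"

definition a_vec :: "btl \<Rightarrow> nat \<times> nat \<Rightarrow> real vec" where
  "a_vec P \<alpha> = transpose_mat (feat_mat P) *\<^sub>v
     (unit_vec (n_items P) (fst \<alpha>) - unit_vec (n_items P) (snd \<alpha>))"

definition q_vec :: "btl \<Rightarrow> nat \<times> nat \<Rightarrow> real vec" where
  "q_vec P \<alpha> = transpose_mat (null_basis P) *\<^sub>v a_vec P \<alpha>"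

definition eta :: "btl \<Rightarrow> nat \<times> nat \<Rightarrow> real vec \<Rightarrow> real" where
  "eta P \<alpha> \<theta> = (w_o P \<bullet> a_vec P \<alpha> + q_vec P \<alpha> \<bullet> \<theta>) / util_scale P"

text \<open>A response array assigns to \<open>(\<alpha>, t)\<close> the \<open>t\<close>-th answer to query \<open>\<alpha>\<close>, with \<open>True\<close> for \<open>1\<close>; it is
  constantly \<open>False\<close> outside the index set.\<close>

type_synonym responses = "(nat \<times> nat) \<times> nat \<Rightarrow> bool"

definition response_dist :: "btl \<Rightarrow> real vec \<Rightarrow> responses pmf" where
  "response_dist P \<theta> = Pi_pmf (SIGMA \<alpha> : queries P. {1..reps P \<alpha>}) False
     (\<lambda>(\<alpha>, t). bernoulli_pmf (1 / (1 + exp (- eta P \<alpha> \<theta>))))"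

definition psi :: "real \<Rightarrow> real" where
  "psi x = ln (1 + exp x)"

definition y_sum :: "btl \<Rightarrow> responses \<Rightarrow> nat \<times> nat \<Rightarrow> real" where
  "y_sum P Y \<alpha> = (\<Sum>t = 1..reps P \<alpha>. of_bool (Y (\<alpha>, t)))"

definition neg_log_lik :: "btl \<Rightarrow> responses \<Rightarrow> real vec \<Rightarrow> real" where
  "neg_log_lik P Y \<theta> = 1 / real (n_total P) *
     (\<Sum>\<alpha>\<in>queries P. - y_sum P Y \<alpha> * eta P \<alpha> \<theta> + real (reps P \<alpha>) * psi (eta P \<alpha> \<theta>))"

definition is_mle :: "btl \<Rightarrow> responses \<Rightarrow> real vec \<Rightarrow> bool" where
  "is_mle P Y \<theta> \<longleftrightarrow> \<theta> \<in> carrier_vec (d_theta P) \<and>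
     (\<forall>\<theta>' \<in> carrier_vec (d_theta P). \<theta>' \<noteq> \<theta> \<longrightarrow> neg_log_lik P Y \<theta> < neg_log_lik P Y \<theta>')"

text \<open>The Hessian of the negative log-likelihood, which does not depend on the responses;
  \<open>neg_log_lik_hessian\<close> below shows that its entries are the second partial derivatives.\<close>

definition hess :: "btl \<Rightarrow> real vec \<Rightarrow> real mat" where
  "hess P \<theta> = mat (d_theta P) (d_theta P) (\<lambda>(k, m).
     1 / (real (n_total P) * (util_scale P)\<^sup>2) *
     (\<Sum>\<alpha>\<in>queries P. real (reps P \<alpha>) * deriv (deriv psi) (eta P \<alpha> \<theta>) *
        (q_vec P \<alpha> $ k * q_vec P \<alpha> $ m)))"

definition design_mat :: "btl \<Rightarrow> real mat" where
  "design_mat P = mat (d_theta P) (d_theta P) (\<lambda>(k, m).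
     1 / real (n_total P) *
     (\<Sum>\<alpha>\<in>queries P. real (reps P \<alpha>) * (q_vec P \<alpha> $ k * q_vec P \<alpha> $ m)))"

definition mu_Q :: "btl \<Rightarrow> real" where
  "mu_Q P = Max ((\<lambda>\<alpha>. 1 / real (d_theta P) *
     (q_vec P \<alpha> \<bullet> (mat_inv (design_mat P) *\<^sub>v q_vec P \<alpha>))) ` queries P)"

definition r_eff :: "btl \<Rightarrow> real vec \<Rightarrow> real" where
  "r_eff P \<theta> = mat_trace (mat_inv (hess P \<theta>)) / spectral_norm (mat_inv (hess P \<theta>))"

lemma psi_deriv: "(psi has_real_derivative exp x / (1 + exp x)) (at x)"
proof -
  have "1 + exp x > 0" by (simp add: add_pos_pos)
  then show ?thesis
    unfolding psi_def by (auto intro!: derivative_eq_intros)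
qed

lemma deriv_psi: "deriv psi = (\<lambda>x. exp x / (1 + exp x))"
  using psi_deriv DERIV_imp_deriv by blast

lemma deriv_psi_deriv: "(deriv psi has_real_derivative deriv (deriv psi) x) (at x)"
proof -
  have "1 + exp x \<noteq> 0" using exp_gt_zero[of x] by linarith
  then have "((\<lambda>x. exp x / (1 + exp x)) has_real_derivative
      (exp x * (1 + exp x) - exp x * exp x) / ((1 + exp x) * (1 + exp x))) (at x)"
    by (auto intro!: derivative_eq_intros)
  then show ?thesis
    unfolding deriv_psi using DERIV_imp_deriv by metis
qed

lemma q_vec_carrier:
  assumes "btl_setting P"
  shows "q_vec P \<alpha> \<in> carrier_vec (d_theta P)"
  using assms unfolding btl_setting_def q_vec_def by (intro mult_mat_vec_carrier[of _ _ "n_feat P"]) (auto simp: a_vec_def)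

lemma eta_shift:
  assumes "btl_setting P" "\<theta> \<in> carrier_vec (d_theta P)" "k < d_theta P"
  shows "eta P \<alpha> (\<theta> + s \<cdot>\<^sub>v unit_vec (d_theta P) k) = eta P \<alpha> \<theta> + s * (q_vec P \<alpha> $ k / util_scale P)"
proof -
  note q = q_vec_carrier[OF assms(1), of \<alpha>]
  have "q_vec P \<alpha> \<bullet> (\<theta> + s \<cdot>\<^sub>v unit_vec (d_theta P) k) =
      q_vec P \<alpha> \<bullet> \<theta> + s * (q_vec P \<alpha> $ k)"
    using q assms(2,3) by (simp add: scalar_prod_add_distrib[of _ "d_theta P"])
  then show ?thesis
    unfolding eta_def by (simp add: add_divide_distrib)
qed

lemma neg_log_lik_hessian:
  assumes "btl_setting P" "\<theta> \<in> carrier_vec (d_theta P)" "k < d_theta P" "m < d_theta P"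
  defines "e \<equiv> unit_vec (d_theta P)"
  shows "(\<lambda>t. neg_log_lik P Y (\<theta> + s \<cdot>\<^sub>v e k + t \<cdot>\<^sub>v e m)) differentiable (at 0)"
    and "((\<lambda>s. deriv (\<lambda>t. neg_log_lik P Y (\<theta> + s \<cdot>\<^sub>v e k + t \<cdot>\<^sub>v e m)) 0)
       has_real_derivative hess P \<theta> $$ (k, m)) (at 0)"
proof -
  let ?u = "\<lambda>\<alpha>. q_vec P \<alpha> $ k / util_scale P" and ?v = "\<lambda>\<alpha>. q_vec P \<alpha> $ m / util_scale P"
  let ?g = "\<lambda>s. 1 / real (n_total P) *
     (\<Sum>\<alpha>\<in>queries P. - y_sum P Y \<alpha> * ?v \<alpha> + real (reps P \<alpha>) * (deriv psi (eta P \<alpha> \<theta> + s * ?u \<alpha>) * ?v \<alpha>))"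
  have eta: "eta P \<alpha> (\<theta> + s \<cdot>\<^sub>v e k + t \<cdot>\<^sub>v e m) = eta P \<alpha> \<theta> + s * ?u \<alpha> + t * ?v \<alpha>" for s t \<alpha>
    using assms(2) eta_shift[OF assms(1) _ assms(4), of "\<theta> + s \<cdot>\<^sub>v e k"] eta_shift[OF assms(1,2,3)]
    unfolding e_def by simp
  have p: "((\<lambda>t. y * (x + t * v) + n * psi (x + t * v)) has_real_derivative
      y * v + n * (deriv psi x * v)) (at 0)" for x v y n
  proof -
    have i: "((\<lambda>t. x + t * v) has_real_derivative v) (at 0)"
      by (auto intro!: derivative_eq_intros)
    have "((\<lambda>t. psi (x + t * v)) has_real_derivative deriv psi x * v) (at 0)"
      using DERIV_chain2[OF _ i, of psi "deriv psi x"] psi_deriv[of x] by (simp add: deriv_psi)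
    with i show ?thesis
      by (intro DERIV_add DERIV_cmult)
  qed
  have p2: "((\<lambda>s. c + n * (deriv psi (x + s * u) * v)) has_real_derivative
      n * (deriv (deriv psi) x * u * v)) (at 0)" for c n x u v
  proof -
    have i: "((\<lambda>t. x + t * u) has_real_derivative u) (at 0)"
      by (auto intro!: derivative_eq_intros)
    have "((\<lambda>t. deriv psi (x + t * u)) has_real_derivative deriv (deriv psi) x * u) (at 0)"
      using DERIV_chain2[OF _ i, of "deriv psi" "deriv (deriv psi) x"] deriv_psi_deriv[of x] by simp
    from DERIV_add[OF DERIV_const DERIV_cmult[OF DERIV_cmult_right[OF this]]]
    show ?thesis by simp
  qed
  have 1: "((\<lambda>t. neg_log_lik P Y (\<theta> + s \<cdot>\<^sub>v e k + t \<cdot>\<^sub>v e m)) has_real_derivative ?g s) (at 0)" for s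
    unfolding neg_log_lik_def eta by (intro DERIV_cmult DERIV_sum p)
  show "(\<lambda>t. neg_log_lik P Y (\<theta> + s \<cdot>\<^sub>v e k + t \<cdot>\<^sub>v e m)) differentiable (at 0)"
    using 1 real_differentiable_def by blast
  have eq: "deriv (\<lambda>t. neg_log_lik P Y (\<theta> + s \<cdot>\<^sub>v e k + t \<cdot>\<^sub>v e m)) 0 = ?g s" for s
    using 1 DERIV_imp_deriv by blast
  have g: "(?g has_real_derivative 1 / real (n_total P) *
     (\<Sum>\<alpha>\<in>queries P. real (reps P \<alpha>) * (deriv (deriv psi) (eta P \<alpha> \<theta>) * ?u \<alpha> * ?v \<alpha>))) (at 0)"
    by (intro DERIV_cmult DERIV_sum p2)
  have "1 / real (n_total P) *
     (\<Sum>\<alpha>\<in>queries P. real (reps P \<alpha>) * (deriv (deriv psi) (eta P \<alpha> \<theta>) * ?u \<alpha> * ?v \<alpha>)) =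
     hess P \<theta> $$ (k, m)"
    using assms(3,4) unfolding hess_def
    by (simp add: sum_distrib_left power2_eq_square algebra_simps)
  with g show "((\<lambda>s. deriv (\<lambda>t. neg_log_lik P Y (\<theta> + s \<cdot>\<^sub>v e k + t \<cdot>\<^sub>v e m)) 0)
       has_real_derivative hess P \<theta> $$ (k, m)) (at 0)"
    unfolding eq by simp
qed

end

theory Submission
  imports Defs
begin

text \<open>Let \<open>H\<close> be the Hessian at the true parameter, \<open>G = H\<^sup>-\<^sup>1\<close>, and \<open>a\<^sub>\<alpha> = q\<^sub>\<alpha> / \<sigma>\<close>. The Newton step
  \<open>D = -G \<nabla>\<ell>(\<theta>*)\<close> is a sum of independent terms, and Bernstein's inequality controls each coordinate of
  \<open>D\<close> and each linear form \<open>a\<^sub>\<alpha> \<bullet> D\<close> in terms of its own variance. Since the third derivative of \<open>\<Psi>\<close> is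
  bounded by the second, the gradient of \<open>\<ell>\<close> points outwards on the boundary of a small \<open>H\<close>-ball around
  \<open>D\<close>, so the minimiser exists there and differs from \<open>D\<close> by a second-order term in \<open>(a\<^sub>\<alpha> \<bullet> D)\<^sup>2\<close> plus a
  smaller remainder. The mean of the second-order term is bounded through the norm of \<open>G\<close>; its
  fluctuation is a quadratic chaos, whose sixth moment is small enough for a tail of order
  \<open>d\<^sub>\<theta>\<close> to the power \<open>-3/2\<close>.\<close>

section \<open>Sums of independent bounded noise\<close>

text \<open>Uniform control of the forms \<open>a \<alpha> \<bullet> D\<close> needs a union bound
  over up to d^2 queries. Applied to the whole second-order term, it leaves a factor log^2 d that
  the last sample-size condition cannot absorb. The mean of that term carries no logarithm, and that
  condition pays for it, with T = 4 B mu_Q d_theta bounding the leverages. Only the remainder is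
  left to the uniform bound: it gains a further factor of order T sqrt(d_theta) log d / N, so log^3
  d in the first condition suffices. The fluctuation has squared norm of order T tr(G) / N^2.
  Relative to the target tr(G) log d_theta / N this is of order at most d_theta^(-1/2). Markov's
  inequality with fourth moments would reach only the exponent 1; sixth moments reach 3/2, which is
  the c of the theorem.\<close>

lemma expectation_Pi_pmf_insert_bool:
  fixes D :: "'i \<Rightarrow> bool pmf" and f :: "('i \<Rightarrow> bool) \<Rightarrow> real"
  assumes "finite J" "i \<notin> J"
  shows "measure_pmf.expectation (Pi_pmf (insert i J) d D) f =
    measure_pmf.expectation (Pi_pmf J d D)
      (\<lambda>Y. measure_pmf.expectation (D i) (\<lambda>y. f (Y(i := y))))"
proof -
  have fin: "finite (set_pmf (Pi_pmf J d D))"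
    using assms by (auto simp: set_Pi_pmf)
  note [simp] = integrable_measure_pmf_finite[OF fin]
  have one: "measure_pmf.expectation (D i) g = pmf (D i) True * g True + pmf (D i) False * g False"
    for g :: "bool \<Rightarrow> real"
    by (subst integral_measure_pmf_real[of UNIV]) (auto simp: UNIV_bool mult.commute)
  have "measure_pmf.expectation (Pi_pmf (insert i J) d D) f =
      (\<Sum>y\<in>UNIV. pmf (D i) y * measure_pmf.expectation (Pi_pmf J d D) (\<lambda>Y. f (Y(i := y))))"
    unfolding Pi_pmf_insert'[OF assms] using fin
    by (subst pmf_expectation_bind[of UNIV])
      (auto simp: map_pmf_def[symmetric])
  also have "\<dots> = measure_pmf.expectation (Pi_pmf J d D)
      (\<lambda>Y. measure_pmf.expectation (D i) (\<lambda>y. f (Y(i := y))))"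
    unfolding one by (simp add: UNIV_bool)
  finally show ?thesis .
qed

lemma finite_set_Pi_pmf_bool:
  fixes D :: "'i \<Rightarrow> bool pmf"
  assumes "finite J"
  shows "finite (set_pmf (Pi_pmf J d D))"
  using assms by (auto simp: set_Pi_pmf)

lemma integrable_Pi_pmf_bool [simp]:
  fixes D :: "'i \<Rightarrow> bool pmf" and f :: "('i \<Rightarrow> bool) \<Rightarrow> real"
  assumes "finite J"
  shows "integrable (measure_pmf (Pi_pmf J d D)) f"
  by (rule integrable_measure_pmf_finite[OF finite_set_Pi_pmf_bool[OF assms]])

lemma integrable_bool_pmf [simp]: "integrable (measure_pmf (p :: bool pmf)) (f :: bool \<Rightarrow> real)"
  by (rule integrable_measure_pmf_finite) simp

section \<open>Exponential moments and Bernstein tails\<close>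

lemma exp_le_quadratic:
  fixes z :: real
  assumes "\<bar>z\<bar> \<le> 1"
  shows "exp z \<le> 1 + z + z\<^sup>2"
proof (cases "0 \<le> z")
  case True
  then show ?thesis using exp_bound[of z] assms by simp
next
  case False
  define y where "y = - z"
  have y: "0 \<le> y" "y \<le> 1" using False assms by (auto simp: y_def)
  \<comment> \<open>The product is 1 + y^3, so for negative arguments the bound reduces to exp y
    \<ge> 1 + y.\<close>
  have "1 \<le> (1 - y + y\<^sup>2) * (1 + y)" using y by (simp add: algebra_simps power2_eq_square)
  also have "\<dots> \<le> (1 - y + y\<^sup>2) * exp y"
    using y exp_ge_add_one_self[of y] by (intro mult_left_mono) (auto simp: add_nonneg_nonneg)
  finally have "exp (- y) \<le> 1 - y + y\<^sup>2" by (simp add: exp_minus field_simps)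
  then show ?thesis by (simp add: y_def)
qed

text \<open>\<open>u\<close> only bounds the variance because the locale is used twice with the same
  \<open>u\<close>: for Bernoulli residuals, and for their centred squares, whose variance is
  smaller.\<close>

locale bool_noise =
  fixes D :: "'i \<Rightarrow> bool pmf" and e :: "'i \<Rightarrow> bool \<Rightarrow> real" and u :: "'i \<Rightarrow> real"
  assumes e_mean: "measure_pmf.expectation (D i) (e i) = 0"
    and e_bound: "\<bar>e i y\<bar> \<le> 1"
    and e_var: "measure_pmf.expectation (D i) (\<lambda>y. (e i y)\<^sup>2) \<le> u i"
begin

lemma u_nonneg: "0 \<le> u i"
  using e_var[of i] by (rule order_trans[rotated]) (intro Bochner_Integration.integral_nonneg, auto)

lemma mgf_bound:
  assumes J: "finite J" and s: "\<And>i. i \<in> J \<Longrightarrow> \<bar>s i\<bar> \<le> 1"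
  shows "measure_pmf.expectation (Pi_pmf J d D) (\<lambda>Y. exp (\<Sum>i\<in>J. s i * e i (Y i)))
    \<le> exp (\<Sum>i\<in>J. u i * (s i)\<^sup>2)"
proof -
  have "measure_pmf.expectation (D i) (\<lambda>y. exp (s i * e i y)) \<le> exp (u i * (s i)\<^sup>2)"
    if "i \<in> J" for i
  proof -
    have "\<bar>s i * e i y\<bar> \<le> 1" for y
      using mult_mono[OF s[OF that] e_bound[of i y]] by (simp add: abs_mult)
    then have "exp (s i * e i y) \<le> 1 + s i * e i y + (s i)\<^sup>2 * (e i y)\<^sup>2" for y
      using exp_le_quadratic[of "s i * e i y"] by (simp add: power_mult_distrib)
    then have "measure_pmf.expectation (D i) (\<lambda>y. exp (s i * e i y)) \<le>
        measure_pmf.expectation (D i) (\<lambda>y. 1 + s i * e i y + (s i)\<^sup>2 * (e i y)\<^sup>2)"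
      by (intro integral_mono) auto
    also have "\<dots> = 1 + (s i)\<^sup>2 * measure_pmf.expectation (D i) (\<lambda>y. (e i y)\<^sup>2)"
      by (simp add: e_mean)
    also have "\<dots> \<le> 1 + u i * (s i)\<^sup>2"
      using mult_left_mono[OF e_var[of i], of "(s i)\<^sup>2"] by (simp add: mult.commute)
    also have "\<dots> \<le> exp (u i * (s i)\<^sup>2)" by (rule exp_ge_add_one_self)
    finally show ?thesis .
  qed
  then have "(\<Prod>i\<in>J. measure_pmf.expectation (D i) (\<lambda>y. exp (s i * e i y))) \<le>
      (\<Prod>i\<in>J. exp (u i * (s i)\<^sup>2))"
    by (intro prod_mono conjI Bochner_Integration.integral_nonneg) auto
  moreover have "measure_pmf.expectation (Pi_pmf J d D) (\<lambda>Y. exp (\<Sum>i\<in>J. s i * e i (Y i))) =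
      (\<Prod>i\<in>J. measure_pmf.expectation (D i) (\<lambda>y. exp (s i * e i y)))"
    unfolding exp_sum[OF J] by (intro expectation_prod_Pi_pmf J) auto
  ultimately show ?thesis by (simp add: exp_sum[OF J])
qed

text \<open>Chernoff with \<open>\<tau> = sqrt (t / V)\<close>: the exponential moment costs at most
  exp t and the threshold gains exp(-2 t). The condition on \<open>x\<close> says exactly that this
  \<open>\<tau>\<close> keeps all exponents in [-1, 1], so no linear Bernstein term appears.\<close>

lemma linear_upper_tail:
  assumes J: "finite J" and t: "0 < t" and V: "0 < V" and x: "\<And>i. i \<in> J \<Longrightarrow> (x i)\<^sup>2 * t \<le> V"
    and var: "(\<Sum>i\<in>J. u i * (x i)\<^sup>2) \<le> V"
  shows "measure_pmf.prob (Pi_pmf J d D) {Y. 2 * sqrt (t * V) < (\<Sum>i\<in>J. x i * e i (Y i))}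
    \<le> exp (- t)"
proof -
  let ?M = "Pi_pmf J d D"
  define \<tau> where "\<tau> = sqrt (t / V)"
  have \<tau>: "0 < \<tau>" "\<tau>\<^sup>2 = t / V" using t V by (auto simp: \<tau>_def)
  have s: "\<bar>\<tau> * x i\<bar> \<le> 1" if "i \<in> J" for i
  proof -
    have "(\<tau> * x i)\<^sup>2 \<le> 1" using x[OF that] V by (simp add: power_mult_distrib \<tau> field_simps)
    then show ?thesis by (simp add: abs_square_le_1)
  qed
  have sq: "\<tau> * sqrt (t * V) = t"
    using t V by (simp add: \<tau>_def real_sqrt_mult[symmetric])
  have "measure_pmf.prob ?M {Y. 2 * sqrt (t * V) < (\<Sum>i\<in>J. x i * e i (Y i))} =
      measure_pmf.expectation ?M (indicator {Y. 2 * sqrt (t * V) < (\<Sum>i\<in>J. x i * e i (Y i))})"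
    by simp
  also have "\<dots> \<le> measure_pmf.expectation ?M
      (\<lambda>Y. exp (- 2 * t) * exp (\<Sum>i\<in>J. \<tau> * x i * e i (Y i)))"
  proof (intro integral_mono integrable_Pi_pmf_bool J)
    fix Y
    have "\<tau> * (2 * sqrt (t * V)) \<le> \<tau> * (\<Sum>i\<in>J. x i * e i (Y i))"
      if "2 * sqrt (t * V) < (\<Sum>i\<in>J. x i * e i (Y i))"
      using that \<tau>(1) by (intro mult_left_mono) auto
    then show "indicator {Y. 2 * sqrt (t * V) < (\<Sum>i\<in>J. x i * e i (Y i))} Y \<le>
        exp (- 2 * t) * exp (\<Sum>i\<in>J. \<tau> * x i * e i (Y i))"
      using sq by (auto simp: indicator_def exp_add[symmetric] sum_distrib_left algebra_simps)
  qed
  also have "\<dots> \<le> exp (- 2 * t) * exp (\<Sum>i\<in>J. u i * (\<tau> * x i)\<^sup>2)"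
    using mgf_bound[OF J s, where d = d] by simp
  also have "(\<Sum>i\<in>J. u i * (\<tau> * x i)\<^sup>2) = (t / V) * (\<Sum>i\<in>J. u i * (x i)\<^sup>2)"
    by (simp add: power_mult_distrib \<tau> sum_distrib_left mult_ac)
  also have "exp (- 2 * t) * exp (t / V * (\<Sum>i\<in>J. u i * (x i)\<^sup>2)) \<le> exp (- 2 * t) * exp t"
  proof -
    have "t / V * (\<Sum>i\<in>J. u i * (x i)\<^sup>2) \<le> t / V * V"
      using var t V by (intro mult_left_mono) auto
    then show ?thesis using V by simp
  qed
  also have "\<dots> = exp (- t)" by (simp add: exp_add[symmetric])
  finally show ?thesis .
qed

lemma bool_noise_uminus: "bool_noise D (\<lambda>i y. - e i y) u"
  by unfold_locales (use e_mean e_bound e_var in auto)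

lemma linear_tail:
  assumes J: "finite J" and t: "0 < t" and V: "0 \<le> V" and x: "\<And>i. i \<in> J \<Longrightarrow> (x i)\<^sup>2 * t \<le> V"
    and var: "(\<Sum>i\<in>J. u i * (x i)\<^sup>2) \<le> V"
  shows "measure_pmf.prob (Pi_pmf J d D) {Y. 4 * t * V < (\<Sum>i\<in>J. x i * e i (Y i))\<^sup>2}
    \<le> 2 * exp (- t)"
\<comment> \<open>For \<open>V = 0\<close> the range condition forces every coefficient to vanish,
  and the event is empty.\<close>
proof (cases "V = 0")
  case True
  have "x i = 0" if "i \<in> J" for i
    using x[OF that] True t by (simp add: mult_le_0_iff)
  then show ?thesis using True by simp
next
  case False
  interpret neg: bool_noise D "\<lambda>i y. - e i y" u by (rule bool_noise_uminus)
  have "{Y. 4 * t * V < (\<Sum>i\<in>J. x i * e i (Y i))\<^sup>2} \<subseteq>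
      {Y. 2 * sqrt (t * V) < (\<Sum>i\<in>J. x i * e i (Y i))} \<union>
      {Y. 2 * sqrt (t * V) < (\<Sum>i\<in>J. x i * - e i (Y i))}"
  proof (safe, goal_cases)
    case (1 Y)
    have "(2 * sqrt (t * V))\<^sup>2 < \<bar>\<Sum>i\<in>J. x i * e i (Y i)\<bar>\<^sup>2"
      using 1(1) t V by (simp add: power_mult_distrib)
    then have "2 * sqrt (t * V) < \<bar>\<Sum>i\<in>J. x i * e i (Y i)\<bar>"
      by (rule power_less_imp_less_base) simp
    then show ?case using 1(2) by (simp add: sum_negf abs_if split: if_splits)
  qed
  then have "measure_pmf.prob (Pi_pmf J d D) {Y. 4 * t * V < (\<Sum>i\<in>J. x i * e i (Y i))\<^sup>2} \<le>
      measure_pmf.prob (Pi_pmf J d D) ({Y. 2 * sqrt (t * V) < (\<Sum>i\<in>J. x i * e i (Y i))} \<union>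
      {Y. 2 * sqrt (t * V) < (\<Sum>i\<in>J. x i * - e i (Y i))})"
    by (intro measure_pmf.finite_measure_mono) auto
  also have "\<dots> \<le> exp (- t) + exp (- t)"
    using False V by (intro order_trans[OF measure_Un_le] add_mono
        linear_upper_tail neg.linear_upper_tail assms) auto
  finally show ?thesis by simp
qed

section \<open>Sixth moments of linear forms and quadratic chaoses\<close>

text \<open>The term linear in \<open>z\<close> is kept exactly, since it averages to zero; every
  other term carries \<open>z^2\<close>, which averages to a variance. Pairing odd powers with their
  neighbours leaves 25 parts of q^4 x^2 and 28 of q^2 x^4, and the latter give 14 more of q^4 x^2,
  hence 39.\<close>

lemma sixth_power_pointwise:
  fixes q x z :: real
  assumes "\<bar>z\<bar> \<le> 1"
  shows "(q + z * x) ^ 6 \<le> q ^ 6 + 6 * q ^ 5 * x * z + z\<^sup>2 * (39 * (q ^ 4 * x\<^sup>2) + 39 * x ^ 6)"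
proof -
  have b: "z ^ k * r \<le> \<bar>r\<bar>" for k r
  proof -
    have "z ^ k * r \<le> \<bar>z\<bar> ^ k * \<bar>r\<bar>" by (metis abs_ge_self abs_mult power_abs)
    also have "\<dots> \<le> 1 * \<bar>r\<bar>" using assms by (intro mult_right_mono power_le_one) auto
    finally show ?thesis by simp
  qed
  have 1: "2 * \<bar>q ^ 3 * x ^ 3\<bar> \<le> q ^ 4 * x\<^sup>2 + q\<^sup>2 * x ^ 4"
    using sum_squares_bound[of "\<bar>q\<^sup>2 * x\<bar>" "\<bar>q * x\<^sup>2\<bar>"]
    by (simp add: abs_mult power_mult_distrib power_abs eval_nat_numeral mult_ac)
  have 2: "2 * (q\<^sup>2 * x ^ 4) \<le> q ^ 4 * x\<^sup>2 + x ^ 6"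
    using sum_squares_bound[of "q\<^sup>2 * x" "x ^ 3"]
    by (simp add: power_mult_distrib eval_nat_numeral mult_ac)
  have 3: "2 * \<bar>q * x ^ 5\<bar> \<le> q\<^sup>2 * x ^ 4 + x ^ 6"
    using sum_squares_bound[of "\<bar>q * x\<^sup>2\<bar>" "\<bar>x ^ 3\<bar>"]
    by (simp add: abs_mult power_mult_distrib power_abs eval_nat_numeral mult_ac)
  have pos: "0 \<le> q ^ 4 * x\<^sup>2" "0 \<le> q\<^sup>2 * x ^ 4" "0 \<le> x ^ 6" by simp_all
  have "15 * (q ^ 4 * x\<^sup>2) + 20 * (z ^ 1 * (q ^ 3 * x ^ 3)) + 15 * (z\<^sup>2 * (q\<^sup>2 * x ^ 4))
      + 6 * (z ^ 3 * (q * x ^ 5)) + z ^ 4 * x ^ 6 \<le> 39 * (q ^ 4 * x\<^sup>2) + 39 * x ^ 6"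
    using b[of 1 "q ^ 3 * x ^ 3"] b[of 2 "q\<^sup>2 * x ^ 4"] b[of 3 "q * x ^ 5"] b[of 4 "x ^ 6"] 1 2 3 pos
    by (simp only: abs_of_nonneg)
  then have "z\<^sup>2 * (15 * (q ^ 4 * x\<^sup>2) + 20 * (z ^ 1 * (q ^ 3 * x ^ 3)) + 15 * (z\<^sup>2 * (q\<^sup>2 * x ^ 4))
      + 6 * (z ^ 3 * (q * x ^ 5)) + z ^ 4 * x ^ 6) \<le> z\<^sup>2 * (39 * (q ^ 4 * x\<^sup>2) + 39 * x ^ 6)"
    by (intro mult_left_mono) auto
  moreover have "(q + z * x) ^ 6 = q ^ 6 + 6 * q ^ 5 * x * z + z\<^sup>2 * (15 * (q ^ 4 * x\<^sup>2)
      + 20 * (z ^ 1 * (q ^ 3 * x ^ 3)) + 15 * (z\<^sup>2 * (q\<^sup>2 * x ^ 4))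
      + 6 * (z ^ 3 * (q * x ^ 5)) + z ^ 4 * x ^ 6)"
    by (simp add: eval_nat_numeral algebra_simps)
  ultimately show ?thesis by simp
qed

text \<open>The free weight \<open>\<theta>\<close> allows the coefficient of \<open>q ^ 6\<close>
  to be made small, so that it does not compound along an induction over the coordinates.\<close>

lemma weighted_young:
  fixes q x \<theta> :: real
  assumes "0 < \<theta>"
  shows "3 * (q ^ 4 * x\<^sup>2) \<le> 2 * \<theta> * q ^ 6 + x ^ 6 / \<theta>\<^sup>2"
proof -
  define y where "y = x\<^sup>2 / \<theta>"
  have x2: "x\<^sup>2 = \<theta> * y" using assms by (simp add: y_def)
  have y0: "0 \<le> y" using assms by (simp add: y_def)
  have "0 \<le> (q\<^sup>2 - y)\<^sup>2 * (2 * q\<^sup>2 + y)" using y0 by (intro mult_nonneg_nonneg) auto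
  then have "3 * (q ^ 4 * y) \<le> 2 * q ^ 6 + y ^ 3"
    by (simp add: eval_nat_numeral algebra_simps)
  then have "\<theta> * (3 * (q ^ 4 * y)) \<le> \<theta> * (2 * q ^ 6 + y ^ 3)"
    using assms by (intro mult_left_mono) auto
  moreover have "x ^ 6 = \<theta> ^ 3 * y ^ 3"
  proof -
    have "x ^ 6 = (x\<^sup>2) ^ 3" by simp
    then show ?thesis by (simp only: x2 power_mult_distrib)
  qed
  then have "x ^ 6 / \<theta>\<^sup>2 = \<theta> * y ^ 3"
    using assms by (simp add: power3_eq_cube power2_eq_square)
  ultimately show ?thesis
    unfolding x2 by (simp add: algebra_simps)
qed

text \<open>Inductive step with invariant E Q^6 \<le> 10^4 C S^3, where the scale \<open>S\<close>
  grows by \<open>u i * \<xi>\<close>. The factor \<open>x\<close> may be random as long as it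
  ignores coordinate \<open>i\<close>; this covers linear forms (constant \<open>x\<close>) and
  chaoses (\<open>x\<close> a linear form in the earlier coordinates).\<close>

lemma sixth_moment_step:
  fixes Q x :: "('i \<Rightarrow> bool) \<Rightarrow> real"
  assumes J: "finite J" "i \<notin> J"
    and Q: "\<And>Y y. Q (Y(i := y)) = Q Y" and x: "\<And>Y y. x (Y(i := y)) = x Y"
    and \<xi>: "0 < \<xi>" "\<xi> \<le> S" and C: "0 \<le> C"
    and xm: "measure_pmf.expectation (Pi_pmf J d D) (\<lambda>Y. x Y ^ 6) \<le> C * \<xi> ^ 3"
    and Qm: "measure_pmf.expectation (Pi_pmf J d D) (\<lambda>Y. Q Y ^ 6) \<le> 10 ^ 4 * C * S ^ 3"
  shows "measure_pmf.expectation (Pi_pmf (insert i J) d D) (\<lambda>Y. (Q Y + e i (Y i) * x Y) ^ 6)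
    \<le> 10 ^ 4 * C * (S + u i * \<xi>) ^ 3"
proof -
  let ?E = "measure_pmf.expectation (Pi_pmf J d D)"
  note int = integrable_Pi_pmf_bool[OF J(1), where d = d and D = D]
  have S: "0 < S" using \<xi> by simp
  \<comment> \<open>With a weight of order \<open>\<xi> / S\<close>, the contributions of
    \<open>Q ^ 6\<close> and \<open>x ^ 6\<close> both become multiples of
    \<open>C * S^2 * \<xi>\<close>, the first-order growth of the cube.\<close>
  define \<theta> where "\<theta> = \<xi> / (40 * S)"
  have \<theta>: "0 < \<theta>" using \<xi> S by (simp add: \<theta>_def)
  define A B where "A = ?E (\<lambda>Y. Q Y ^ 6)" and "B = ?E (\<lambda>Y. x Y ^ 6)"
  have "measure_pmf.expectation (Pi_pmf (insert i J) d D) (\<lambda>Y. (Q Y + e i (Y i) * x Y) ^ 6)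
      = ?E (\<lambda>Y. measure_pmf.expectation (D i) (\<lambda>y. (Q Y + e i y * x Y) ^ 6))"
    by (subst expectation_Pi_pmf_insert_bool[OF J]) (simp add: Q x)
  also have "\<dots> \<le> ?E (\<lambda>Y. Q Y ^ 6 + u i * (26 * \<theta> * Q Y ^ 6 + (13 / \<theta>\<^sup>2 + 39) * x Y ^ 6))"
  proof (intro integral_mono int)
    fix Y
    have "measure_pmf.expectation (D i) (\<lambda>y. (Q Y + e i y * x Y) ^ 6) \<le>
        measure_pmf.expectation (D i) (\<lambda>y. Q Y ^ 6 + 6 * Q Y ^ 5 * x Y * e i y +
          (e i y)\<^sup>2 * (39 * (Q Y ^ 4 * (x Y)\<^sup>2) + 39 * x Y ^ 6))"
      by (intro integral_mono integrable_bool_pmf sixth_power_pointwise e_bound)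
    also have "\<dots> = Q Y ^ 6 + measure_pmf.expectation (D i) (\<lambda>y. (e i y)\<^sup>2) *
        (39 * (Q Y ^ 4 * (x Y)\<^sup>2) + 39 * x Y ^ 6)"
      by (simp add: e_mean)
    also have "\<dots> \<le> Q Y ^ 6 + u i * (39 * (Q Y ^ 4 * (x Y)\<^sup>2) + 39 * x Y ^ 6)"
      by (intro add_left_mono mult_right_mono e_var) auto
    also have "\<dots> \<le> Q Y ^ 6 + u i * (26 * \<theta> * Q Y ^ 6 + (13 / \<theta>\<^sup>2 + 39) * x Y ^ 6)"
      using weighted_young[OF \<theta>, of "Q Y" "x Y"]
      by (intro add_left_mono mult_left_mono u_nonneg) (simp add: algebra_simps)
    finally show "measure_pmf.expectation (D i) (\<lambda>y. (Q Y + e i y * x Y) ^ 6) \<le>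
        Q Y ^ 6 + u i * (26 * \<theta> * Q Y ^ 6 + (13 / \<theta>\<^sup>2 + 39) * x Y ^ 6)" .
  qed
  also have "\<dots> = A + u i * (26 * \<theta> * A + (13 / \<theta>\<^sup>2 + 39) * B)"
    unfolding A_def B_def by (simp add: int)
  also have "\<dots> \<le> 10 ^ 4 * C * S ^ 3 + u i * (26 * \<theta> * (10 ^ 4 * C * S ^ 3) + (13 / \<theta>\<^sup>2 + 39) * (C * \<xi> ^ 3))"
    using xm Qm \<theta> by (intro add_mono mult_left_mono u_nonneg) (auto simp: A_def B_def)
  \<comment> \<open>In units of \<open>C * S^2 * \<xi>\<close> the three terms are 6500, 20800 and
    at most 39, within the 30000 available.\<close>
  also have "\<dots> \<le> 10 ^ 4 * C * S ^ 3 + u i * (3 * (10 ^ 4 * C) * (S\<^sup>2 * \<xi>))"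
  proof (intro add_left_mono mult_left_mono u_nonneg)
    define Z where "Z = C * (S\<^sup>2 * \<xi>)"
    have a: "26 * \<theta> * (10 ^ 4 * C * S ^ 3) = 6500 * Z"
      using S by (simp add: \<theta>_def Z_def power3_eq_cube power2_eq_square field_simps)
    have b: "13 / \<theta>\<^sup>2 * (C * \<xi> ^ 3) = 20800 * Z"
      using S \<xi> by (simp add: \<theta>_def Z_def power3_eq_cube power2_eq_square field_simps)
    have "\<xi>\<^sup>2 * \<xi> \<le> S\<^sup>2 * \<xi>" using \<xi> by (intro mult_right_mono power_mono) auto
    then have c: "39 * (C * \<xi> ^ 3) \<le> 39 * Z"
      using C mult_left_mono[of "\<xi>\<^sup>2 * \<xi>" "S\<^sup>2 * \<xi>" "39 * C"]
      by (simp add: Z_def power3_eq_cube power2_eq_square mult_ac)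
    have "0 \<le> Z" using C S \<xi> by (simp add: Z_def)
    moreover have "3 * (10 ^ 4 * C) * (S\<^sup>2 * \<xi>) = 30000 * Z" by (simp add: Z_def)
    ultimately show "26 * \<theta> * (10 ^ 4 * C * S ^ 3) + (13 / \<theta>\<^sup>2 + 39) * (C * \<xi> ^ 3) \<le>
        3 * (10 ^ 4 * C) * (S\<^sup>2 * \<xi>)"
      using c unfolding distrib_right a b by linarith
  qed
  also have "\<dots> \<le> 10 ^ 4 * C * (S + u i * \<xi>) ^ 3"
  proof -
    have "0 \<le> u i * \<xi>" using u_nonneg \<xi> by simp
    moreover have "(S + z) ^ 3 = S ^ 3 + 3 * (S\<^sup>2 * z) + (3 * S * z\<^sup>2 + z ^ 3)" for z
      by (simp add: power3_eq_cube power2_eq_square algebra_simps)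
    ultimately have "S ^ 3 + 3 * (S\<^sup>2 * (u i * \<xi>)) \<le> (S + u i * \<xi>) ^ 3"
      using S by simp
    then have "10 ^ 4 * C * (S ^ 3 + 3 * (S\<^sup>2 * (u i * \<xi>))) \<le> 10 ^ 4 * C * (S + u i * \<xi>) ^ 3"
      using C by (intro mult_left_mono) auto
    then show ?thesis by (simp add: algebra_simps)
  qed
  finally show ?thesis .
qed

text \<open>The offset \<open>X\<close> starts the running scale above every single
  \<open>\<xi> i\<close>, as the inductive step requires; there \<open>C = 1\<close>.\<close>

lemma sixth_moment_linear:
  assumes J: "finite J" and X: "0 < X" and x: "\<And>i. i \<in> J \<Longrightarrow> (x i)\<^sup>2 \<le> \<xi> i"
    and \<xi>: "\<And>i. i \<in> J \<Longrightarrow> 0 < \<xi> i" "\<And>i. i \<in> J \<Longrightarrow> \<xi> i \<le> X"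
  shows "measure_pmf.expectation (Pi_pmf J d D) (\<lambda>Y. (\<Sum>i\<in>J. x i * e i (Y i)) ^ 6)
    \<le> 10 ^ 4 * (X + (\<Sum>i\<in>J. u i * \<xi> i)) ^ 3"
  using J x \<xi>
proof (induction J)
  case empty
  then show ?case using X by simp
next
  case (insert i J)
  have "x i ^ 6 = ((x i)\<^sup>2) ^ 3" by simp
  also have "\<dots> \<le> \<xi> i ^ 3" using insert.prems(1)[of i] by (intro power_mono) auto
  finally have x6: "x i ^ 6 \<le> \<xi> i ^ 3" .
  have "(\<Sum>j\<in>J. x j * e j ((Y(i := y)) j)) = (\<Sum>j\<in>J. x j * e j (Y j))" for Y y
    using insert.hyps by (intro sum.cong) auto
  moreover have "0 \<le> (\<Sum>j\<in>J. u j * \<xi> j)"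
    using insert.prems by (intro sum_nonneg mult_nonneg_nonneg u_nonneg) (auto intro: less_imp_le)
  ultimately have "measure_pmf.expectation (Pi_pmf (insert i J) d D)
      (\<lambda>Y. ((\<Sum>j\<in>J. x j * e j (Y j)) + e i (Y i) * x i) ^ 6)
    \<le> 10 ^ 4 * 1 * ((X + (\<Sum>j\<in>J. u j * \<xi> j)) + u i * \<xi> i) ^ 3"
    using insert x6 by (intro sixth_moment_step) (auto intro: add_increasing2)
  then show ?case using insert.hyps by (simp add: add_ac mult_ac)
qed

text \<open>By symmetry a new coordinate \<open>i\<close> contributes \<open>e i\<close> times twice
  the linear form of row \<open>i\<close> in the earlier coordinates. The linear case bounds the
  sixth moment of that factor by 10^10 \<xi>^3, so the step applies with
  \<open>C = 10 ^ 10\<close>.\<close>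

lemma sixth_moment_chaos:
  fixes A :: "'i \<Rightarrow> 'i \<Rightarrow> real"
  assumes J: "finite J" and X: "0 < X"
    and sym: "\<And>i j. A i j = A j i"
    and A: "\<And>i j. i \<in> J \<Longrightarrow> j \<in> J \<Longrightarrow> (A i j)\<^sup>2 \<le> \<xi> i"
    and A2: "\<And>i. i \<in> J \<Longrightarrow> (\<Sum>j\<in>J. u j * (A i j)\<^sup>2) \<le> \<xi> i"
    and \<xi>: "\<And>i. i \<in> J \<Longrightarrow> 0 < \<xi> i" "\<And>i. i \<in> J \<Longrightarrow> \<xi> i \<le> X"
  shows "measure_pmf.expectation (Pi_pmf J d D)
      (\<lambda>Y. (\<Sum>i\<in>J. \<Sum>j\<in>J - {i}. A i j * e i (Y i) * e j (Y j)) ^ 6)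
    \<le> 10 ^ 14 * (X + (\<Sum>i\<in>J. u i * \<xi> i)) ^ 3"
  using J A A2 \<xi>
proof (induction J)
  case empty
  then show ?case using X by simp
next
  case (insert i J)
  let ?Q = "\<lambda>Y. \<Sum>k\<in>J. \<Sum>j\<in>J - {k}. A k j * e k (Y k) * e j (Y j)"
  let ?x = "\<lambda>Y. \<Sum>j\<in>J. 2 * A i j * e j (Y j)"
  have mono: "(\<Sum>j\<in>J. u j * (A k j)\<^sup>2) \<le> \<xi> k" if "k \<in> insert i J" for k
  proof -
    have "(\<Sum>j\<in>J. u j * (A k j)\<^sup>2) \<le> (\<Sum>j\<in>insert i J. u j * (A k j)\<^sup>2)"
      using insert.hyps by (simp add: u_nonneg)
    then show ?thesis using insert.prems(2)[OF that] by linarith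
  qed
  have IH: "measure_pmf.expectation (Pi_pmf J d D) (\<lambda>Y. ?Q Y ^ 6)
      \<le> 10 ^ 14 * (X + (\<Sum>i\<in>J. u i * \<xi> i)) ^ 3"
    using insert.prems mono by (intro insert.IH) auto
  have split: "(\<Sum>k\<in>insert i J. \<Sum>j\<in>insert i J - {k}. A k j * e k (Y k) * e j (Y j)) =
      ?Q Y + e i (Y i) * ?x Y" for Y
  proof -
    have "(\<Sum>j\<in>insert i J - {k}. A k j * e k (Y k) * e j (Y j)) =
        A k i * e k (Y k) * e i (Y i) + (\<Sum>j\<in>J - {k}. A k j * e k (Y k) * e j (Y j))"
      if "k \<in> J" for k
    proof -
      have "insert i J - {k} = insert i (J - {k})" using that insert.hyps by auto
      then show ?thesis using insert.hyps by simp
    qed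
    then have "(\<Sum>k\<in>J. \<Sum>j\<in>insert i J - {k}. A k j * e k (Y k) * e j (Y j)) =
        (\<Sum>k\<in>J. A k i * e k (Y k) * e i (Y i)) + ?Q Y"
      by (simp add: sum.distrib)
    also have "(\<Sum>k\<in>J. A k i * e k (Y k) * e i (Y i)) = e i (Y i) * (\<Sum>j\<in>J. A i j * e j (Y j))"
      unfolding sum_distrib_left by (intro sum.cong refl) (simp add: sym[of i])
    finally have 1: "(\<Sum>k\<in>J. \<Sum>j\<in>insert i J - {k}. A k j * e k (Y k) * e j (Y j)) =
        e i (Y i) * (\<Sum>j\<in>J. A i j * e j (Y j)) + ?Q Y" .
    have "insert i J - {i} = J" using insert.hyps by auto
    then have 2: "(\<Sum>j\<in>insert i J - {i}. A i j * e i (Y i) * e j (Y j)) =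
        e i (Y i) * (\<Sum>j\<in>J. A i j * e j (Y j))"
      by (simp add: sum_distrib_left mult_ac)
    have 3: "?x Y = 2 * (\<Sum>j\<in>J. A i j * e j (Y j))" by (simp add: sum_distrib_left mult_ac)
    show ?thesis
      unfolding sum.insert[OF insert.hyps] 1 2 3 by (simp add: algebra_simps)
  qed
  have x6: "measure_pmf.expectation (Pi_pmf J d D) (\<lambda>Y. ?x Y ^ 6) \<le> 10 ^ 10 * \<xi> i ^ 3"
  proof -
    define U where "U = (\<Sum>j\<in>J. u j)"
    have U: "0 \<le> U" by (simp add: U_def sum_nonneg u_nonneg)
    \<comment> \<open>The linear case needs strictly positive bounds although entries of
      \<open>A\<close> may vanish. The padding adds at most \<open>\<xi> i\<close> to each bound
      and, after weighting, at most \<open>\<xi> i\<close> in total.\<close>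
    define h where "h j = (A i j)\<^sup>2 + \<xi> i / (1 + U)" for j
    have \<xi>i: "0 < \<xi> i" using insert.prems(3) by simp
    have frac: "0 < \<xi> i / (1 + U)" "\<xi> i / (1 + U) \<le> \<xi> i" "U * (\<xi> i / (1 + U)) \<le> \<xi> i"
      using U \<xi>i by (auto simp: field_simps)
    have h: "0 < h j" "(A i j)\<^sup>2 \<le> h j" for j
      using frac(1) by (auto simp: h_def intro: add_nonneg_pos)
    have h2: "h j \<le> 2 * \<xi> i" if "j \<in> J" for j
      using frac(2) insert.prems(1)[of i j] that by (simp add: h_def)
    have "measure_pmf.expectation (Pi_pmf J d D) (\<lambda>Y. (\<Sum>j\<in>J. A i j * e j (Y j)) ^ 6) \<le>
        10 ^ 4 * (2 * \<xi> i + (\<Sum>j\<in>J. u j * h j)) ^ 3"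
      using insert.hyps(1) \<xi>i h h2 by (intro sixth_moment_linear) auto
    also have "\<dots> \<le> 10 ^ 4 * (4 * \<xi> i) ^ 3"
    proof (intro mult_left_mono power_mono)
      have "(\<Sum>j\<in>J. u j * h j) = (\<Sum>j\<in>J. u j * (A i j)\<^sup>2) + U * (\<xi> i / (1 + U))"
        by (simp add: h_def U_def distrib_left sum.distrib sum_distrib_right sum_divide_distrib)
      then show "2 * \<xi> i + (\<Sum>j\<in>J. u j * h j) \<le> 4 * \<xi> i"
        using mono[of i] frac(3) by simp
      show "0 \<le> 2 * \<xi> i + (\<Sum>j\<in>J. u j * h j)"
        using \<xi>i h(1) by (intro add_nonneg_nonneg sum_nonneg mult_nonneg_nonneg u_nonneg) (auto intro: less_imp_le)
    qed auto
    finally have *: "measure_pmf.expectation (Pi_pmf J d D) (\<lambda>Y. (\<Sum>j\<in>J. A i j * e j (Y j)) ^ 6) \<le>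
        10 ^ 4 * (4 * \<xi> i) ^ 3" .
    have "?x Y ^ 6 = 64 * (\<Sum>j\<in>J. A i j * e j (Y j)) ^ 6" for Y
    proof -
      have "?x Y = 2 * (\<Sum>j\<in>J. A i j * e j (Y j))" by (simp add: sum_distrib_left mult_ac)
      then show ?thesis by (simp add: power_mult_distrib)
    qed
    then have "measure_pmf.expectation (Pi_pmf J d D) (\<lambda>Y. ?x Y ^ 6) =
        64 * measure_pmf.expectation (Pi_pmf J d D) (\<lambda>Y. (\<Sum>j\<in>J. A i j * e j (Y j)) ^ 6)"
      by simp
    also have "\<dots> \<le> 64 * (10 ^ 4 * (4 * \<xi> i) ^ 3)" using * by simp
    also have "\<dots> = 40960000 * \<xi> i ^ 3" by (simp add: power_mult_distrib)
    also have "\<dots> \<le> 10 ^ 10 * \<xi> i ^ 3"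
      using insert.prems(3)[of i] by (intro mult_right_mono) auto
    finally show ?thesis .
  qed
  have "0 \<le> (\<Sum>j\<in>J. u j * \<xi> j)"
    using insert.prems by (intro sum_nonneg mult_nonneg_nonneg u_nonneg) (auto intro: less_imp_le)
  moreover have "?Q (Y(i := y)) = ?Q Y" "?x (Y(i := y)) = ?x Y" for Y y
    by (intro sum.cong refl; use insert.hyps in auto)+
  ultimately have "measure_pmf.expectation (Pi_pmf (insert i J) d D)
      (\<lambda>Y. (?Q Y + e i (Y i) * ?x Y) ^ 6)
    \<le> 10 ^ 4 * 10 ^ 10 * ((X + (\<Sum>j\<in>J. u j * \<xi> j)) + u i * \<xi> i) ^ 3"
    using insert.hyps insert.prems(3,4)[of i] x6 IH
    by (intro sixth_moment_step) (auto intro: add_increasing2)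
  then show ?case unfolding split using insert.hyps by (simp add: add_ac)
qed

end

section \<open>The logistic function and Gram matrices\<close>

text \<open>The derivatives of \<open>psi\<close> up to order four are written as polynomials in the
  sigmoid, so that the third and fourth are seen to be dominated by the second from 0 <
  \<open>dpsi\<close> < 1 alone.\<close>

definition dpsi :: "real \<Rightarrow> real" where "dpsi x = exp x / (1 + exp x)"

definition d2psi :: "real \<Rightarrow> real" where "d2psi x = dpsi x * (1 - dpsi x)"

definition d3psi :: "real \<Rightarrow> real" where "d3psi x = d2psi x * (1 - 2 * dpsi x)"

definition d4psi :: "real \<Rightarrow> real" where "d4psi x = d2psi x * (1 - 6 * d2psi x)"

lemma dpsi_gt_0: "0 < dpsi x" and dpsi_less_1: "dpsi x < 1"
  unfolding dpsi_def by (auto simp: divide_less_eq add_pos_pos)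

lemma one_minus_dpsi: "1 - dpsi x = 1 / (1 + exp x)"
proof -
  have "1 + exp x \<noteq> 0" using exp_gt_zero[of x] by linarith
  then show ?thesis by (simp add: dpsi_def field_simps)
qed

lemma dpsi_eq_logistic: "dpsi x = 1 / (1 + exp (- x))"
proof -
  have "1 + exp x \<noteq> 0" "1 + exp (- x) \<noteq> 0" using exp_gt_zero[of x] exp_gt_zero[of "- x"] by linarith+
  then show ?thesis by (simp add: dpsi_def field_simps exp_minus)
qed

lemma d2psi_gt_0: "0 < d2psi x"
  unfolding d2psi_def using dpsi_gt_0 dpsi_less_1 by simp

lemma d2psi_le: "d2psi x \<le> 1 / 4"
  unfolding d2psi_def using zero_le_power2[of "dpsi x - 1 / 2"]
  by (simp add: power2_eq_square algebra_simps)

lemma abs_d3psi_le: "\<bar>d3psi x\<bar> \<le> d2psi x"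
proof -
  have "d2psi x * \<bar>1 - 2 * dpsi x\<bar> \<le> d2psi x * 1"
    using d2psi_gt_0[of x] dpsi_gt_0[of x] dpsi_less_1[of x] by (intro mult_left_mono) auto
  then show ?thesis using d2psi_gt_0[of x] by (simp add: d3psi_def abs_mult)
qed

lemma abs_d4psi_le: "\<bar>d4psi x\<bar> \<le> d2psi x"
proof -
  have "d2psi x * \<bar>1 - 6 * d2psi x\<bar> \<le> d2psi x * 1"
    using d2psi_gt_0[of x] d2psi_le[of x] by (intro mult_left_mono) auto
  then show ?thesis using d2psi_gt_0[of x] by (simp add: d4psi_def abs_mult)
qed

lemma has_real_derivative_psi: "(psi has_real_derivative dpsi x) (at x)"
  unfolding dpsi_def by (rule psi_deriv)

lemma has_real_derivative_dpsi: "(dpsi has_real_derivative d2psi x) (at x)"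
proof -
  have "1 + exp x \<noteq> 0" using exp_gt_zero[of x] by linarith
  then have "((\<lambda>x. exp x / (1 + exp x)) has_real_derivative
      (exp x * (1 + exp x) - exp x * exp x) / ((1 + exp x) * (1 + exp x))) (at x)"
    by (auto intro!: derivative_eq_intros)
  moreover have "(exp x * (1 + exp x) - exp x * exp x) / ((1 + exp x) * (1 + exp x)) = d2psi x"
    by (simp add: d2psi_def one_minus_dpsi) (simp add: dpsi_def algebra_simps)
  ultimately show ?thesis by (simp add: dpsi_def[abs_def])
qed

lemma has_real_derivative_d2psi: "(d2psi has_real_derivative d3psi x) (at x)"
  unfolding d2psi_def[abs_def] d3psi_def
  by (rule derivative_eq_intros has_real_derivative_dpsi refl)+ (simp add: d2psi_def algebra_simps)

lemma has_real_derivative_d3psi: "(d3psi has_real_derivative d4psi x) (at x)"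
  unfolding d3psi_def[abs_def] d4psi_def
  by (rule derivative_eq_intros has_real_derivative_dpsi has_real_derivative_d2psi refl)+
    (simp add: d3psi_def d2psi_def algebra_simps)

lemma deriv_deriv_psi_eq: "deriv (deriv psi) x = d2psi x"
proof -
  have "deriv psi = dpsi" using has_real_derivative_psi DERIV_imp_deriv by blast
  then show ?thesis using has_real_derivative_dpsi DERIV_imp_deriv by metis
qed

lemma d2psi_eq: "d2psi x = 1 / ((1 + exp (- x)) * (1 + exp x))"
  unfolding d2psi_def one_minus_dpsi by (simp add: dpsi_eq_logistic)

text \<open>The reciprocal of \<open>d2psi\<close> is a product of two factors 1 + exp, each of
  which changes by at most a factor exp 1 \<le> 3 under a unit shift.\<close>

lemma d2psi_add_le:
  assumes "\<bar>h\<bar> \<le> 1"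
  shows "d2psi (x + h) \<le> 9 * d2psi x"
proof -
  have e: "1 + exp y \<le> 3 * (1 + exp (y + k))" if "\<bar>k\<bar> \<le> 1" for y k :: real
  proof -
    have "exp y = exp (y + k) * exp (- k)" by (simp add: exp_add[symmetric])
    also have "\<dots> \<le> exp (y + k) * 3"
    proof (intro mult_left_mono)
      have "exp (- k) \<le> exp 1" using that by simp
      then show "exp (- k) \<le> 3" using exp_le by linarith
    qed simp
    finally show ?thesis by simp
  qed
  have "(1 + exp (- x)) * (1 + exp x) \<le> (3 * (1 + exp (- x + - h))) * (3 * (1 + exp (x + h)))"
    using assms by (intro mult_mono e) (auto simp: add_nonneg_nonneg)
  also have "\<dots> = 9 * ((1 + exp (- x + - h)) * (1 + exp (x + h)))"
  proof -
    have "(3 * p) * (3 * r) = 9 * (p * r)" for p r :: real by simp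
    then show ?thesis .
  qed
  finally have *: "(1 + exp (- x)) * (1 + exp x) \<le> 9 * ((1 + exp (- (x + h))) * (1 + exp (x + h)))"
    by simp
  have "0 < (1 + exp (- x)) * (1 + exp x)" "0 < (1 + exp (- (x + h))) * (1 + exp (x + h))"
    by (simp_all add: add_pos_pos)
  then show ?thesis using * unfolding d2psi_eq by (simp add: field_simps)
qed

text \<open>The reciprocal of \<open>d2psi x\<close> is 2 + exp |x| + exp (-|x|), at most 3 + B.
  This is how \<open>B\<close> enters the leverage bound.\<close>

lemma d2psi_ge:
  assumes "1 < B" "\<bar>x\<bar> \<le> ln B"
  shows "1 / (4 * B) \<le> d2psi x"
proof -
  have "exp \<bar>x\<bar> \<le> exp (ln B)" using assms(2) by simp
  then have e: "exp \<bar>x\<bar> \<le> B" using assms(1) by simp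
  have "(1 + exp (- x)) * (1 + exp x) = 2 + exp \<bar>x\<bar> + exp (- \<bar>x\<bar>)"
    by (cases "0 \<le> x") (simp_all add: algebra_simps exp_add[symmetric])
  also have "\<dots> \<le> 2 + B + 1"
  proof -
    have "exp (- \<bar>x\<bar>) \<le> 1" by simp
    then show ?thesis using e by linarith
  qed
  also have "\<dots> \<le> 4 * B" using assms by simp
  finally have "(1 + exp (- x)) * (1 + exp x) \<le> 4 * B" .
  moreover have "0 < (1 + exp (- x)) * (1 + exp x)" by (simp add: add_pos_pos)
  ultimately show ?thesis unfolding d2psi_eq by (intro divide_left_mono) auto
qed

text \<open>The Lagrange remainder lives at an intermediate point within distance 1, so domination
  by the second derivative and \<open>d2psi_add_le\<close> bring it back to \<open>x\<close> at the
  cost of 9. The next order gives 9 / 6 = 3 / 2 in the same way.\<close>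

lemma dpsi_taylor2:
  assumes "\<bar>h\<bar> \<le> 1"
  shows "\<bar>dpsi (x + h) - dpsi x - d2psi x * h\<bar> \<le> 9 / 2 * d2psi x * h\<^sup>2"
proof (cases "h = 0")
  case False
  define diff where "diff m = (case m of 0 \<Rightarrow> dpsi | Suc 0 \<Rightarrow> d2psi | _ \<Rightarrow> d3psi)" for m :: nat
  have "\<exists>t. (if x + h < x then x + h < t \<and> t < x else x < t \<and> t < x + h) \<and>
      dpsi (x + h) = (\<Sum>m<2. diff m x / fact m * (x + h - x) ^ m) + diff 2 t / fact 2 * (x + h - x) ^ 2"
    using False
    by (intro Taylor[where a = "x - \<bar>h\<bar>" and b = "x + \<bar>h\<bar>"])
      (auto simp: diff_def less_Suc_eq numeral_2_eq_2 intro: has_real_derivative_dpsi has_real_derivative_d2psi)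
  then obtain t where t: "if x + h < x then x + h < t \<and> t < x else x < t \<and> t < x + h"
    and eq: "dpsi (x + h) = dpsi x + d2psi x * h + d3psi t / 2 * h\<^sup>2"
    by (auto simp: diff_def numeral_2_eq_2)
  have "\<bar>t - x\<bar> \<le> 1" using t assms by (auto split: if_splits)
  then have "\<bar>d3psi t\<bar> \<le> 9 * d2psi x"
    using d2psi_add_le[of "t - x" x] abs_d3psi_le[of t] by simp
  then have "\<bar>d3psi t\<bar> * (h\<^sup>2 / 2) \<le> 9 * d2psi x * (h\<^sup>2 / 2)" by (intro mult_right_mono) auto
  then show ?thesis by (simp add: eq abs_mult)
qed simp

lemma dpsi_taylor3:
  assumes "\<bar>h\<bar> \<le> 1"
  shows "\<bar>dpsi (x + h) - dpsi x - d2psi x * h - d3psi x / 2 * h\<^sup>2\<bar> \<le> 3 / 2 * d2psi x * \<bar>h\<bar> ^ 3"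
proof (cases "h = 0")
  case False
  define diff where "diff m = (case m of 0 \<Rightarrow> dpsi | Suc 0 \<Rightarrow> d2psi | Suc (Suc 0) \<Rightarrow> d3psi | _ \<Rightarrow> d4psi)" for m :: nat
  have "\<exists>t. (if x + h < x then x + h < t \<and> t < x else x < t \<and> t < x + h) \<and>
      dpsi (x + h) = (\<Sum>m<3. diff m x / fact m * (x + h - x) ^ m) + diff 3 t / fact 3 * (x + h - x) ^ 3"
    using False
    by (intro Taylor[where a = "x - \<bar>h\<bar>" and b = "x + \<bar>h\<bar>"])
      (auto simp: diff_def less_Suc_eq numeral_3_eq_3
        intro: has_real_derivative_dpsi has_real_derivative_d2psi has_real_derivative_d3psi)
  then obtain t where t: "if x + h < x then x + h < t \<and> t < x else x < t \<and> t < x + h"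
    and eq: "dpsi (x + h) = dpsi x + d2psi x * h + d3psi x / 2 * h\<^sup>2 + d4psi t / 6 * h ^ 3"
    by (auto simp: diff_def numeral_3_eq_3 fact_numeral power2_eq_square)
  have "\<bar>t - x\<bar> \<le> 1" using t assms by (auto split: if_splits)
  then have "\<bar>d4psi t\<bar> \<le> 9 * d2psi x"
    using d2psi_add_le[of "t - x" x] abs_d4psi_le[of t] by simp
  then have "\<bar>d4psi t\<bar> * (\<bar>h\<bar> ^ 3 / 6) \<le> 9 * d2psi x * (\<bar>h\<bar> ^ 3 / 6)" by (intro mult_right_mono) auto
  then show ?thesis by (simp add: eq abs_mult power_abs)
qed simp

lemma psi_strictly_above_tangent:
  assumes "x \<noteq> y"
  shows "psi x + dpsi x * (y - x) < psi y"
proof -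
  have mono: "dpsi s < dpsi t" if "s < t" for s t
    by (rule DERIV_pos_imp_increasing[OF that])
      (intro exI conjI allI impI, rule has_real_derivative_dpsi, rule d2psi_gt_0)
  show ?thesis
  proof (cases "x < y")
    case True
    obtain z where z: "x < z" "z < y" "psi y - psi x = (y - x) * dpsi z"
      using MVT2[OF True, of psi dpsi] has_real_derivative_psi by auto
    have "(y - x) * dpsi x < (y - x) * dpsi z"
      using mono[OF z(1)] True by (intro mult_strict_left_mono) auto
    then show ?thesis using z(3) by (simp only: mult.commute[of _ "y - x"])
  next
    case False
    then have "y < x" using assms by simp
    then obtain z where z: "y < z" "z < x" "psi x - psi y = (x - y) * dpsi z"
      using MVT2[OF \<open>y < x\<close>, of psi dpsi] has_real_derivative_psi by auto
    have "(x - y) * dpsi z < (x - y) * dpsi x"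
      using mono[OF z(2)] \<open>y < x\<close> by (intro mult_strict_left_mono) auto
    then show ?thesis using z(3) by (simp add: algebra_simps)
  qed
qed

section \<open>Gram matrices and their reproducing kernel\<close>

text \<open>Vectors are functions on all naturals of which only the coordinates below
  \<open>n\<close> count. This removes carrier conditions and makes the product topology
  available.\<close>

definition dot :: "nat \<Rightarrow> (nat \<Rightarrow> real) \<Rightarrow> (nat \<Rightarrow> real) \<Rightarrow> real" where
  "dot n x y = (\<Sum>k<n. x k * y k)"

definition gmul :: "nat \<Rightarrow> (nat \<Rightarrow> nat \<Rightarrow> real) \<Rightarrow> (nat \<Rightarrow> real) \<Rightarrow> nat \<Rightarrow> real" where
  "gmul n G x k = (\<Sum>j<n. G k j * x j)"

lemma dot_commute: "dot n x y = dot n y x"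
  by (simp add: dot_def mult.commute)

lemma dot_add_right: "dot n x (\<lambda>k. y k + z k) = dot n x y + dot n x z"
  and dot_diff_right: "dot n x (\<lambda>k. y k - z k) = dot n x y - dot n x z"
  and dot_scale_right: "dot n x (\<lambda>k. c * y k) = c * dot n x y"
  by (simp_all add: dot_def algebra_simps sum.distrib sum_subtractf sum_distrib_left)

lemma dot_sum_right: "dot n x (\<lambda>k. \<Sum>i\<in>A. f i k) = (\<Sum>i\<in>A. dot n x (f i))"
  unfolding dot_def sum_distrib_left by (rule sum.swap)

lemma weighted_cauchy_schwarz:
  fixes w f g :: "'a \<Rightarrow> real"
  assumes "\<And>i. i \<in> A \<Longrightarrow> 0 \<le> w i"
  shows "(\<Sum>i\<in>A. w i * f i * g i)\<^sup>2 \<le> (\<Sum>i\<in>A. w i * (f i)\<^sup>2) * (\<Sum>i\<in>A. w i * (g i)\<^sup>2)"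
proof -
  have "(\<Sum>i\<in>A. w i * f i * g i) = (\<Sum>i\<in>A. (sqrt (w i) * f i) * (sqrt (w i) * g i))"
    using assms by (intro sum.cong refl) (simp add: mult_ac)
  also have "\<dots>\<^sup>2 \<le> (\<Sum>i\<in>A. (sqrt (w i) * f i)\<^sup>2) * (\<Sum>i\<in>A. (sqrt (w i) * g i)\<^sup>2)"
    by (rule Cauchy_Schwarz_ineq_sum)
  also have "\<dots> = (\<Sum>i\<in>A. w i * (f i)\<^sup>2) * (\<Sum>i\<in>A. w i * (g i)\<^sup>2)"
    using assms by (auto simp: power_mult_distrib intro!: arg_cong2[of _ _ _ _ "(*)"] sum.cong)
  finally show ?thesis .
qed

text \<open>The Gram matrix \<open>H = \<Sum>\<alpha>. w \<alpha> a \<alpha> (a \<alpha>)\<^sup>T\<close> enters only through its inverse \<open>G\<close>: the assumption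
  \<open>repro\<close> says \<open>x = G H x\<close>.\<close>

locale gram =
  fixes n :: nat and I :: "'a set" and w :: "'a \<Rightarrow> real" and a :: "'a \<Rightarrow> nat \<Rightarrow> real"
    and G :: "nat \<Rightarrow> nat \<Rightarrow> real"
  assumes fin: "finite I" and w_nonneg: "\<alpha> \<in> I \<Longrightarrow> 0 \<le> w \<alpha>"
    and G_sym: "i < n \<Longrightarrow> j < n \<Longrightarrow> G i j = G j i"
    and repro: "i < n \<Longrightarrow> x i = (\<Sum>\<alpha>\<in>I. w \<alpha> * dot n (a \<alpha>) x * gmul n G (a \<alpha>) i)"
begin

definition b :: "'a \<Rightarrow> nat \<Rightarrow> real" where "b \<alpha> = gmul n G (a \<alpha>)"

text \<open>\<open>K \<alpha> \<beta>\<close> is a_\<alpha>^T G a_\<beta>. Scaled on both sides by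
  the square roots of the weights it is the hat matrix, an orthogonal projection:
  \<open>K_repro\<close> is its idempotence, and \<open>w \<alpha> * K \<alpha> \<alpha>\<close> are
  the leverages.\<close>

definition K :: "'a \<Rightarrow> 'a \<Rightarrow> real" where "K \<alpha> \<beta> = dot n (a \<alpha>) (b \<beta>)"

lemma dot_gmul: "dot n x (gmul n G y) = dot n (gmul n G x) y"
proof -
  have "dot n x (gmul n G y) = (\<Sum>k<n. \<Sum>j<n. x k * G k j * y j)"
    by (simp add: dot_def gmul_def sum_distrib_left mult_ac)
  also have "\<dots> = (\<Sum>j<n. \<Sum>k<n. x k * G k j * y j)" by (rule sum.swap)
  also have "\<dots> = (\<Sum>j<n. \<Sum>k<n. G j k * x k * y j)"
    by (intro sum.cong refl) (simp add: G_sym)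
  also have "\<dots> = dot n (gmul n G x) y"
    by (simp add: dot_def gmul_def sum_distrib_right)
  finally show ?thesis .
qed

lemma K_sym: "K \<alpha> \<beta> = K \<beta> \<alpha>"
  unfolding K_def b_def using dot_gmul[of "a \<alpha>" "a \<beta>"] by (simp add: dot_commute)

lemma dot_repro: "dot n y x = (\<Sum>\<alpha>\<in>I. w \<alpha> * dot n (a \<alpha>) x * dot n y (b \<alpha>))"
proof -
  have "dot n y x = dot n y (\<lambda>k. \<Sum>\<alpha>\<in>I. w \<alpha> * dot n (a \<alpha>) x * b \<alpha> k)"
    unfolding dot_def[of n y] b_def by (intro sum.cong refl) (simp add: repro[of _ x, symmetric])
  then show ?thesis by (simp add: dot_sum_right dot_scale_right)
qed

lemma K_repro: "K \<alpha> \<beta> = (\<Sum>\<gamma>\<in>I. w \<gamma> * K \<alpha> \<gamma> * K \<beta> \<gamma>)"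
proof -
  have "K \<alpha> \<beta> = (\<Sum>\<gamma>\<in>I. w \<gamma> * K \<gamma> \<beta> * K \<alpha> \<gamma>)"
    using dot_repro[of "a \<alpha>" "b \<beta>"] by (simp only: K_def)
  also have "\<dots> = (\<Sum>\<gamma>\<in>I. w \<gamma> * K \<alpha> \<gamma> * K \<beta> \<gamma>)"
  proof (intro sum.cong refl)
    fix \<gamma>
    show "w \<gamma> * K \<gamma> \<beta> * K \<alpha> \<gamma> = w \<gamma> * K \<alpha> \<gamma> * K \<beta> \<gamma>"
      using K_sym[of \<gamma> \<beta>] by simp
  qed
  finally show ?thesis .
qed

lemma K_diag: "K \<alpha> \<alpha> = (\<Sum>\<gamma>\<in>I. w \<gamma> * (K \<alpha> \<gamma>)\<^sup>2)"
  using K_repro[of \<alpha> \<alpha>] by (simp add: power2_eq_square mult_ac)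

lemma K_nonneg: "0 \<le> K \<alpha> \<alpha>"
  unfolding K_diag by (intro sum_nonneg mult_nonneg_nonneg w_nonneg) auto

lemma K_cauchy_schwarz: "(K \<alpha> \<beta>)\<^sup>2 \<le> K \<alpha> \<alpha> * K \<beta> \<beta>"
  unfolding K_repro[of \<alpha> \<beta>] K_diag by (rule weighted_cauchy_schwarz) (rule w_nonneg)

lemma dot_a_gmul: "dot n (a \<alpha>) (\<lambda>j. G k j) = b \<alpha> k"
  by (simp add: dot_def b_def gmul_def mult.commute)

lemma G_diag: "k < n \<Longrightarrow> G k k = (\<Sum>\<alpha>\<in>I. w \<alpha> * (b \<alpha> k)\<^sup>2)"
  using repro[of k "\<lambda>j. G k j"] unfolding dot_a_gmul b_def[symmetric]
  by (simp add: power2_eq_square mult_ac)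

text \<open>The trace of the hat matrix is its rank: \<open>repro\<close> at the \<open>k\<close>-th
  unit vector, read in coordinate \<open>k\<close>, contributes 1 for each \<open>k\<close>.\<close>

lemma sum_K_diag: "(\<Sum>\<alpha>\<in>I. w \<alpha> * K \<alpha> \<alpha>) = n"
proof -
  have 1: "1 = (\<Sum>\<alpha>\<in>I. w \<alpha> * (a \<alpha> k * b \<alpha> k))" if "k < n" for k
    using repro[OF that, of "\<lambda>j. if j = k then 1 else 0"] that
    by (simp add: dot_def b_def if_distrib sum.delta mult_ac cong: if_cong)
  have "(\<Sum>\<alpha>\<in>I. w \<alpha> * K \<alpha> \<alpha>) = (\<Sum>k<n. \<Sum>\<alpha>\<in>I. w \<alpha> * (a \<alpha> k * b \<alpha> k))"
    unfolding K_def dot_def sum_distrib_left by (rule sum.swap)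
  also have "\<dots> = (\<Sum>k<n. 1)" using 1 by (intro sum.cong) auto
  finally show ?thesis by simp
qed

text \<open>A projection is a contraction, and |v| \<le> w makes passing from \<open>w\<close> to
  \<open>v\<close> another one. By idempotence the left side of the first claim equals the quadratic
  form of the second; Cauchy-Schwarz then gives Q^2 \<le> Y Q.\<close>

lemma quadratic_form_le:
  assumes v: "\<And>\<alpha>. \<alpha> \<in> I \<Longrightarrow> \<bar>v \<alpha>\<bar> \<le> w \<alpha>"
  shows "(\<Sum>\<beta>\<in>I. w \<beta> * (\<Sum>\<alpha>\<in>I. v \<alpha> * y \<alpha> * K \<alpha> \<beta>)\<^sup>2) \<le> (\<Sum>\<alpha>\<in>I. w \<alpha> * (y \<alpha>)\<^sup>2)"
    and "(\<Sum>\<alpha>\<in>I. v \<alpha> * y \<alpha> * (\<Sum>\<beta>\<in>I. v \<beta> * y \<beta> * K \<beta> \<alpha>)) \<le> (\<Sum>\<alpha>\<in>I. w \<alpha> * (y \<alpha>)\<^sup>2)"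
proof -
  define Z where "Z \<beta> = (\<Sum>\<alpha>\<in>I. v \<alpha> * y \<alpha> * K \<alpha> \<beta>)" for \<beta>
  define Q where "Q = (\<Sum>\<beta>\<in>I. w \<beta> * (Z \<beta>)\<^sup>2)"
  define Y where "Y = (\<Sum>\<alpha>\<in>I. w \<alpha> * (y \<alpha>)\<^sup>2)"
  have Q0: "0 \<le> Q" unfolding Q_def by (intro sum_nonneg mult_nonneg_nonneg w_nonneg) auto
  have Z_eq: "Z \<alpha> = (\<Sum>\<beta>\<in>I. w \<beta> * K \<alpha> \<beta> * Z \<beta>)" for \<alpha>
  proof -
    have "Z \<alpha> = (\<Sum>\<gamma>\<in>I. v \<gamma> * y \<gamma> * (\<Sum>\<beta>\<in>I. w \<beta> * K \<gamma> \<beta> * K \<alpha> \<beta>))"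
      unfolding Z_def by (intro sum.cong refl arg_cong2[of _ _ _ _ "(*)"] K_repro)
    also have "\<dots> = (\<Sum>\<beta>\<in>I. \<Sum>\<gamma>\<in>I. v \<gamma> * y \<gamma> * (w \<beta> * K \<gamma> \<beta> * K \<alpha> \<beta>))"
      unfolding sum_distrib_left by (rule sum.swap)
    finally show ?thesis by (simp add: Z_def sum_distrib_left mult_ac)
  qed
  have Q_eq: "Q = (\<Sum>\<alpha>\<in>I. v \<alpha> * y \<alpha> * Z \<alpha>)"
  proof -
    have "(\<Sum>\<alpha>\<in>I. v \<alpha> * y \<alpha> * Z \<alpha>) = (\<Sum>\<alpha>\<in>I. v \<alpha> * y \<alpha> * (\<Sum>\<beta>\<in>I. w \<beta> * K \<alpha> \<beta> * Z \<beta>))"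
      by (intro sum.cong refl arg_cong2[of _ _ _ _ "(*)"] Z_eq)
    also have "\<dots> = (\<Sum>\<beta>\<in>I. \<Sum>\<alpha>\<in>I. v \<alpha> * y \<alpha> * (w \<beta> * K \<alpha> \<beta> * Z \<beta>))"
      unfolding sum_distrib_left by (rule sum.swap)
    also have "\<dots> = (\<Sum>\<beta>\<in>I. w \<beta> * Z \<beta> * Z \<beta>)"
      by (intro sum.cong refl) (simp add: Z_def sum_distrib_left sum_distrib_right mult_ac)
    finally show ?thesis by (simp add: Q_def power2_eq_square mult_ac)
  qed
  have "Q \<le> (\<Sum>\<alpha>\<in>I. w \<alpha> * \<bar>y \<alpha>\<bar> * \<bar>Z \<alpha>\<bar>)"
    unfolding Q_eq
  proof (intro sum_mono)
    fix \<alpha> assume "\<alpha> \<in> I"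
    then have "\<bar>v \<alpha>\<bar> * (\<bar>y \<alpha>\<bar> * \<bar>Z \<alpha>\<bar>) \<le> w \<alpha> * (\<bar>y \<alpha>\<bar> * \<bar>Z \<alpha>\<bar>)"
      by (intro mult_right_mono v) auto
    moreover have "v \<alpha> * y \<alpha> * Z \<alpha> \<le> \<bar>v \<alpha>\<bar> * (\<bar>y \<alpha>\<bar> * \<bar>Z \<alpha>\<bar>)"
      by (metis abs_ge_self abs_mult mult.assoc)
    ultimately show "v \<alpha> * y \<alpha> * Z \<alpha> \<le> w \<alpha> * \<bar>y \<alpha>\<bar> * \<bar>Z \<alpha>\<bar>" by (simp add: mult_ac)
  qed
  then have "Q\<^sup>2 \<le> (\<Sum>\<alpha>\<in>I. w \<alpha> * \<bar>y \<alpha>\<bar> * \<bar>Z \<alpha>\<bar>)\<^sup>2" using Q0 by (intro power_mono) auto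
  also have "\<dots> \<le> (\<Sum>\<alpha>\<in>I. w \<alpha> * \<bar>y \<alpha>\<bar>\<^sup>2) * (\<Sum>\<alpha>\<in>I. w \<alpha> * \<bar>Z \<alpha>\<bar>\<^sup>2)"
    by (rule weighted_cauchy_schwarz) (rule w_nonneg)
  finally have "Q\<^sup>2 \<le> Y * Q" by (simp add: Q_def Y_def)
  moreover have "0 \<le> Y" unfolding Y_def by (intro sum_nonneg mult_nonneg_nonneg w_nonneg) auto
  ultimately have "Q \<le> Y"
    using Q0 by (cases "Q = 0") (auto simp: power2_eq_square)
  then show "(\<Sum>\<beta>\<in>I. w \<beta> * (\<Sum>\<alpha>\<in>I. v \<alpha> * y \<alpha> * K \<alpha> \<beta>)\<^sup>2) \<le> (\<Sum>\<alpha>\<in>I. w \<alpha> * (y \<alpha>)\<^sup>2)"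
    and "(\<Sum>\<alpha>\<in>I. v \<alpha> * y \<alpha> * (\<Sum>\<beta>\<in>I. v \<beta> * y \<beta> * K \<beta> \<alpha>)) \<le> (\<Sum>\<alpha>\<in>I. w \<alpha> * (y \<alpha>)\<^sup>2)"
    using Q_eq unfolding Q_def Y_def Z_def by simp_all
qed

text \<open>This passes from weighted norms over the queries to the Euclidean norm: the combination
  is \<open>G x\<close> for x = sum of \<open>v \<alpha> * y \<alpha> * a \<alpha>\<close>, and x^T
  G x is the quadratic form just bounded. The price is one factor \<open>s\<close>, the spectral
  norm of \<open>G\<close> in the application.\<close>

lemma combination_norm_le:
  assumes s: "\<And>x. (\<Sum>k<n. (gmul n G x k)\<^sup>2) \<le> s * dot n x (gmul n G x)" and s0: "0 \<le> s"
    and v: "\<And>\<alpha>. \<alpha> \<in> I \<Longrightarrow> \<bar>v \<alpha>\<bar> \<le> w \<alpha>"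
  shows "(\<Sum>k<n. (\<Sum>\<alpha>\<in>I. v \<alpha> * y \<alpha> * b \<alpha> k)\<^sup>2) \<le> s * (\<Sum>\<alpha>\<in>I. w \<alpha> * (y \<alpha>)\<^sup>2)"
proof -
  define x where "x k = (\<Sum>\<alpha>\<in>I. v \<alpha> * y \<alpha> * a \<alpha> k)" for k
  have g: "gmul n G x k = (\<Sum>\<alpha>\<in>I. v \<alpha> * y \<alpha> * b \<alpha> k)" for k
  proof -
    have "gmul n G x k = (\<Sum>j<n. \<Sum>\<alpha>\<in>I. v \<alpha> * y \<alpha> * (G k j * a \<alpha> j))"
      by (simp add: gmul_def x_def sum_distrib_left mult_ac)
    also have "\<dots> = (\<Sum>\<alpha>\<in>I. \<Sum>j<n. v \<alpha> * y \<alpha> * (G k j * a \<alpha> j))" by (rule sum.swap)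
    finally show ?thesis by (simp add: b_def gmul_def sum_distrib_left)
  qed
  have "dot n x (gmul n G x) = (\<Sum>\<beta>\<in>I. v \<beta> * y \<beta> * dot n x (b \<beta>))"
    unfolding g[abs_def] by (simp add: dot_sum_right dot_scale_right)
  also have "\<dots> = (\<Sum>\<beta>\<in>I. v \<beta> * y \<beta> * (\<Sum>\<alpha>\<in>I. v \<alpha> * y \<alpha> * K \<alpha> \<beta>))"
  proof (intro sum.cong refl)
    fix \<beta>
    have "dot n x (b \<beta>) = (\<Sum>\<alpha>\<in>I. v \<alpha> * y \<alpha> * K \<alpha> \<beta>)"
    proof -
      have "dot n x (b \<beta>) = dot n (b \<beta>) (\<lambda>k. \<Sum>\<alpha>\<in>I. v \<alpha> * y \<alpha> * a \<alpha> k)"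
        unfolding x_def[abs_def] by (rule dot_commute)
      also have "\<dots> = (\<Sum>\<alpha>\<in>I. v \<alpha> * y \<alpha> * dot n (b \<beta>) (a \<alpha>))"
        by (simp add: dot_sum_right dot_scale_right)
      finally show ?thesis by (simp only: K_def dot_commute[of n "b \<beta>"])
    qed
    then show "v \<beta> * y \<beta> * dot n x (b \<beta>) = v \<beta> * y \<beta> * (\<Sum>\<alpha>\<in>I. v \<alpha> * y \<alpha> * K \<alpha> \<beta>)" by simp
  qed
  also have "\<dots> \<le> (\<Sum>\<alpha>\<in>I. w \<alpha> * (y \<alpha>)\<^sup>2)" by (rule quadratic_form_le(2)[OF v])
  finally have "s * dot n x (gmul n G x) \<le> s * (\<Sum>\<alpha>\<in>I. w \<alpha> * (y \<alpha>)\<^sup>2)"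
    using s0 by (intro mult_left_mono)
  then show ?thesis using s[of x] unfolding g by linarith
qed

text \<open>Cauchy-Schwarz for the reproducing kernel: \<open>K \<alpha> \<alpha>\<close> is the
  squared norm of the evaluation at \<open>\<alpha>\<close>.\<close>

lemma dot_a_sq_le: "(dot n (a \<alpha>) x)\<^sup>2 \<le> K \<alpha> \<alpha> * (\<Sum>\<beta>\<in>I. w \<beta> * (dot n (a \<beta>) x)\<^sup>2)"
proof -
  have "dot n (a \<alpha>) x = (\<Sum>\<beta>\<in>I. w \<beta> * K \<alpha> \<beta> * dot n (a \<beta>) x)"
    unfolding K_def by (subst dot_repro) (simp add: mult_ac)
  then show ?thesis
    using weighted_cauchy_schwarz[of I w "K \<alpha>" "\<lambda>\<beta>. dot n (a \<beta>) x"] w_nonneg by (simp add: K_diag)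
qed

lemma coordinate_sq_le:
  assumes "k < n"
  shows "(x k)\<^sup>2 \<le> G k k * (\<Sum>\<beta>\<in>I. w \<beta> * (dot n (a \<beta>) x)\<^sup>2)"
proof -
  have "x k = (\<Sum>\<beta>\<in>I. w \<beta> * b \<beta> k * dot n (a \<beta>) x)"
    unfolding b_def by (subst repro[OF assms]) (simp add: mult_ac)
  then show ?thesis
    using weighted_cauchy_schwarz[of I w "\<lambda>\<beta>. b \<beta> k" "\<lambda>\<beta>. dot n (a \<beta>) x"] w_nonneg
    by (simp add: G_diag[OF assms])
qed

end

section \<open>Localisation and expansion of the minimiser\<close>

lemma quartic_sum_le: "(x + y) ^ 4 \<le> 8 * (x ^ 4 + y ^ 4 :: real)"
proof -
  have "(x + y)\<^sup>2 \<le> 2 * (x\<^sup>2 + y\<^sup>2)"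
    using zero_le_power2[of "x - y"] by (simp add: power2_eq_square algebra_simps)
  then have "((x + y)\<^sup>2)\<^sup>2 \<le> (2 * (x\<^sup>2 + y\<^sup>2))\<^sup>2" by (intro power_mono) auto
  also have "\<dots> \<le> 8 * (x ^ 4 + y ^ 4)"
    using zero_le_power2[of "x\<^sup>2 - y\<^sup>2"] by (simp add: power2_eq_square power4_eq_xxxx algebra_simps)
  finally show ?thesis by simp
qed

lemma sixth_power_sum_le: "(x + y) ^ 6 \<le> 32 * (x ^ 6 + y ^ 6 :: real)"
proof -
  have "(x + y)\<^sup>2 \<le> 2 * (x\<^sup>2 + y\<^sup>2)"
    using zero_le_power2[of "x - y"] by (simp add: power2_eq_square algebra_simps)
  then have "((x + y)\<^sup>2) ^ 3 \<le> (2 * (x\<^sup>2 + y\<^sup>2)) ^ 3" by (intro power_mono) auto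
  also have "\<dots> = 8 * (x\<^sup>2 + y\<^sup>2) ^ 3" by (simp only: power_mult_distrib) simp
  also have "(x\<^sup>2 + y\<^sup>2) ^ 3 \<le> 4 * ((x\<^sup>2) ^ 3 + (y\<^sup>2) ^ 3)"
  proof -
    have "0 \<le> 3 * ((x\<^sup>2 + y\<^sup>2) * (x\<^sup>2 - y\<^sup>2)\<^sup>2)" by (intro mult_nonneg_nonneg) auto
    also have "\<dots> = 4 * ((x\<^sup>2) ^ 3 + (y\<^sup>2) ^ 3) - (x\<^sup>2 + y\<^sup>2) ^ 3"
      by (simp add: power2_eq_square power3_eq_cube algebra_simps)
    finally show ?thesis by simp
  qed
  finally show ?thesis by simp
qed

text \<open>Here \<open>l\<close> stands for the form at the Newton step and \<open>r\<close> for
  the correction. The mixed term is kept separate because \<open>l\<close> is bounded uniformly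
  while \<open>r\<close> is small in energy. The 144 is 9/2, from the squared cubic term, times 32
  from splitting d^6.\<close>

lemma second_order_error_le:
  fixes l r :: real
  defines "d \<equiv> l + r"
  assumes z: "\<bar>z\<bar> \<le> \<bar>d\<^sup>2 - l\<^sup>2\<bar> / 2 + 3 / 2 * \<bar>d\<bar> ^ 3"
  shows "z\<^sup>2 \<le> r ^ 4 + 4 * (l\<^sup>2 * r\<^sup>2) + 144 * (l ^ 6 + r ^ 6)"
proof -
  have "z\<^sup>2 \<le> (\<bar>d\<^sup>2 - l\<^sup>2\<bar> / 2 + 3 / 2 * \<bar>d\<bar> ^ 3)\<^sup>2" using z by (simp add: abs_le_square_iff[symmetric])
  also have "\<dots> \<le> 2 * (\<bar>d\<^sup>2 - l\<^sup>2\<bar> / 2)\<^sup>2 + 2 * (3 / 2 * \<bar>d\<bar> ^ 3)\<^sup>2"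
    using sum_squares_bound[of "\<bar>d\<^sup>2 - l\<^sup>2\<bar> / 2" "3 / 2 * \<bar>d\<bar> ^ 3"] by (simp add: power2_sum)
  also have "\<dots> = (d\<^sup>2 - l\<^sup>2)\<^sup>2 / 2 + 9 / 2 * d ^ 6"
    by (simp add: power_divide power_mult_distrib power_abs flip: power_mult)
  also have "(d\<^sup>2 - l\<^sup>2)\<^sup>2 \<le> 2 * r ^ 4 + 8 * (l\<^sup>2 * r\<^sup>2)"
  proof -
    have "(d\<^sup>2 - l\<^sup>2) = r\<^sup>2 + 2 * l * r" by (simp add: d_def power2_eq_square algebra_simps)
    then have "(d\<^sup>2 - l\<^sup>2)\<^sup>2 = 2 * r ^ 4 + 8 * (l\<^sup>2 * r\<^sup>2) - (r\<^sup>2 - 2 * l * r)\<^sup>2"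
      by (simp add: power2_eq_square power4_eq_xxxx algebra_simps)
    then show ?thesis by simp
  qed
  also have "d ^ 6 \<le> 32 * (l ^ 6 + r ^ 6)"
    unfolding d_def by (rule sixth_power_sum_le)
  finally show ?thesis by (simp add: add_divide_distrib)
qed

locale logistic_gram = gram n I w a G
  for n :: nat and I :: "'a set" and w :: "'a \<Rightarrow> real" and a :: "'a \<Rightarrow> nat \<Rightarrow> real"
    and G :: "nat \<Rightarrow> nat \<Rightarrow> real" +
  fixes m \<eta> :: "'a \<Rightarrow> real" and T :: real
  assumes m_pos: "\<alpha> \<in> I \<Longrightarrow> 0 < m \<alpha>"
    and w_eq: "\<alpha> \<in> I \<Longrightarrow> w \<alpha> = m \<alpha> * d2psi (\<eta> \<alpha>)"
    and K_le: "\<alpha> \<in> I \<Longrightarrow> K \<alpha> \<alpha> \<le> T" and T_pos: "0 < T" and n_pos: "0 < n"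
begin

text \<open>This is x^T H x for the Gram matrix H whose inverse is \<open>G\<close>.\<close>

definition energy :: "(nat \<Rightarrow> real) \<Rightarrow> real" where
  "energy x = (\<Sum>\<alpha>\<in>I. w \<alpha> * (dot n (a \<alpha>) x)\<^sup>2)"

text \<open>Up to an additive constant, \<open>obj D\<close> is the negative log-likelihood of the shift from the true
  parameter, with the responses encoded by the Newton step \<open>D = -G \<nabla>\<ell>\<close>.\<close>

definition obj :: "(nat \<Rightarrow> real) \<Rightarrow> (nat \<Rightarrow> real) \<Rightarrow> real" where
  "obj D x = (\<Sum>\<alpha>\<in>I. m \<alpha> * psi (\<eta> \<alpha> + dot n (a \<alpha>) x) -
     (m \<alpha> * dpsi (\<eta> \<alpha>) + w \<alpha> * dot n (a \<alpha>) D) * dot n (a \<alpha>) x)"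

definition obj_deriv :: "(nat \<Rightarrow> real) \<Rightarrow> (nat \<Rightarrow> real) \<Rightarrow> (nat \<Rightarrow> real) \<Rightarrow> real" where
  "obj_deriv D x h = (\<Sum>\<alpha>\<in>I. (m \<alpha> * (dpsi (\<eta> \<alpha> + dot n (a \<alpha>) x) - dpsi (\<eta> \<alpha>)) -
     w \<alpha> * dot n (a \<alpha>) D) * dot n (a \<alpha>) h)"

lemma energy_nonneg: "0 \<le> energy x"
  unfolding energy_def by (intro sum_nonneg mult_nonneg_nonneg w_nonneg) auto

lemma energy_scale: "energy (\<lambda>k. c * x k) = c\<^sup>2 * energy x"
  unfolding energy_def by (simp add: dot_scale_right power_mult_distrib sum_distrib_left mult_ac)

lemma obj_has_derivative:
  "((\<lambda>s. obj D (\<lambda>k. x k + s * h k)) has_real_derivative obj_deriv D x h) (at 0)"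
proof -
  have "((\<lambda>s. m \<alpha> * psi (\<eta> \<alpha> + dot n (a \<alpha>) x + s * dot n (a \<alpha>) h) -
      c * (dot n (a \<alpha>) x + s * dot n (a \<alpha>) h)) has_real_derivative
      m \<alpha> * (dpsi (\<eta> \<alpha> + dot n (a \<alpha>) x) * dot n (a \<alpha>) h) - c * dot n (a \<alpha>) h) (at 0)" for \<alpha> c
  proof -
    have i: "((\<lambda>s. u + s * v) has_real_derivative v) (at 0)" for u v :: real
      by (auto intro!: derivative_eq_intros)
    have "((\<lambda>s. psi (\<eta> \<alpha> + dot n (a \<alpha>) x + s * dot n (a \<alpha>) h)) has_real_derivative
        dpsi (\<eta> \<alpha> + dot n (a \<alpha>) x) * dot n (a \<alpha>) h) (at 0)"
      using DERIV_chain2[OF _ i, of psi "dpsi (\<eta> \<alpha> + dot n (a \<alpha>) x)"] has_real_derivative_psi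
      by simp
    with i show ?thesis by (intro DERIV_diff DERIV_cmult)
  qed
  note deriv_term = this
  have obj: "obj D (\<lambda>k. x k + s * h k) = (\<Sum>\<alpha>\<in>I. m \<alpha> * psi (\<eta> \<alpha> + dot n (a \<alpha>) x + s * dot n (a \<alpha>) h) -
      (m \<alpha> * dpsi (\<eta> \<alpha>) + w \<alpha> * dot n (a \<alpha>) D) * (dot n (a \<alpha>) x + s * dot n (a \<alpha>) h))" for s
    unfolding obj_def dot_add_right dot_scale_right by (simp only: add.assoc)
  have deriv: "obj_deriv D x h = (\<Sum>\<alpha>\<in>I. m \<alpha> * (dpsi (\<eta> \<alpha> + dot n (a \<alpha>) x) * dot n (a \<alpha>) h) -
      (m \<alpha> * dpsi (\<eta> \<alpha>) + w \<alpha> * dot n (a \<alpha>) D) * dot n (a \<alpha>) h)"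
    unfolding obj_deriv_def by (intro sum.cong refl) (simp add: algebra_simps)
  show ?thesis
    unfolding obj deriv by (intro DERIV_sum deriv_term)
qed

text \<open>Strictness needs one form \<open>a \<alpha>\<close> that separates \<open>x\<close> from
  \<open>y\<close>. If there were none, \<open>repro\<close> would rebuild the same coordinate
  \<open>k\<close> for both.\<close>

lemma obj_above_tangent:
  assumes "k < n" "x k \<noteq> y k"
  shows "obj D x + obj_deriv D x (\<lambda>k. y k - x k) < obj D y"
proof -
  let ?d = "\<lambda>\<alpha> x. dot n (a \<alpha>) x"
  have le: "m \<alpha> * psi (\<eta> \<alpha> + ?d \<alpha> x) + m \<alpha> * dpsi (\<eta> \<alpha> + ?d \<alpha> x) * (?d \<alpha> y - ?d \<alpha> x) \<le>
      m \<alpha> * psi (\<eta> \<alpha> + ?d \<alpha> y)"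
    and less: "?d \<alpha> x \<noteq> ?d \<alpha> y \<Longrightarrow>
      m \<alpha> * psi (\<eta> \<alpha> + ?d \<alpha> x) + m \<alpha> * dpsi (\<eta> \<alpha> + ?d \<alpha> x) * (?d \<alpha> y - ?d \<alpha> x) <
      m \<alpha> * psi (\<eta> \<alpha> + ?d \<alpha> y)" if "\<alpha> \<in> I" for \<alpha>
  proof -
    show "?d \<alpha> x \<noteq> ?d \<alpha> y \<Longrightarrow>
      m \<alpha> * psi (\<eta> \<alpha> + ?d \<alpha> x) + m \<alpha> * dpsi (\<eta> \<alpha> + ?d \<alpha> x) * (?d \<alpha> y - ?d \<alpha> x) <
      m \<alpha> * psi (\<eta> \<alpha> + ?d \<alpha> y)"
      using mult_strict_left_mono[OF psi_strictly_above_tangent m_pos[OF that],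
          of "\<eta> \<alpha> + ?d \<alpha> x" "\<eta> \<alpha> + ?d \<alpha> y"]
      by (simp add: algebra_simps)
    then show "m \<alpha> * psi (\<eta> \<alpha> + ?d \<alpha> x) + m \<alpha> * dpsi (\<eta> \<alpha> + ?d \<alpha> x) * (?d \<alpha> y - ?d \<alpha> x) \<le>
      m \<alpha> * psi (\<eta> \<alpha> + ?d \<alpha> y)"
      by (cases "?d \<alpha> x = ?d \<alpha> y") auto
  qed
  have "\<exists>\<alpha>\<in>I. ?d \<alpha> x \<noteq> ?d \<alpha> y"
  proof (rule ccontr)
    assume "\<not> ?thesis"
    then have "x k = y k"
      using repro[OF assms(1), of x] repro[OF assms(1), of y] by simp
    with assms show False by simp
  qed
  then obtain \<alpha> where \<alpha>: "\<alpha> \<in> I" "?d \<alpha> x \<noteq> ?d \<alpha> y" by blast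
  have "obj D x + obj_deriv D x (\<lambda>k. y k - x k) =
      (\<Sum>\<alpha>\<in>I. m \<alpha> * psi (\<eta> \<alpha> + ?d \<alpha> x) + m \<alpha> * dpsi (\<eta> \<alpha> + ?d \<alpha> x) * (?d \<alpha> y - ?d \<alpha> x) -
        (m \<alpha> * dpsi (\<eta> \<alpha>) + w \<alpha> * ?d \<alpha> D) * ?d \<alpha> y)"
    unfolding obj_def obj_deriv_def sum.distrib[symmetric] dot_diff_right
    by (intro sum.cong refl) (simp add: algebra_simps)
  also have "\<dots> < obj D y"
    unfolding obj_def
    using \<alpha> le less by (intro sum_strict_mono_ex1 fin) (auto intro!: bexI[of _ \<alpha>])
  finally show ?thesis .
qed

text \<open>Coordinates from \<open>n\<close> on are frozen at those of \<open>D\<close>, since the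
  energy does not see them. The others lie in intervals by \<open>coordinate_sq_le\<close>, so the
  ball is a closed subset of a Tychonoff-compact box.\<close>

lemma compact_energy_ball:
  "compact {x. (\<forall>k\<ge>n. x k = D k) \<and> energy (\<lambda>k. x k - D k) \<le> \<rho>}"
proof -
  define S where "S k = (if k < n then {D k - sqrt (G k k * \<rho>)..D k + sqrt (G k k * \<rho>)} else {D k})" for k
  have "compactin (product_topology (\<lambda>_. euclidean) UNIV) (PiE UNIV S)"
    by (subst compactin_PiE) (auto simp: S_def)
  then have comp: "compact (PiE UNIV S)"
    by (simp add: euclidean_product_topology)
  have cont: "continuous_on UNIV (\<lambda>x. energy (\<lambda>k. x k - D k))"
    unfolding energy_def dot_def by (intro continuous_intros) simp_all
  have "closed ({x. \<forall>k\<ge>n. x k = D k} \<inter> {x. energy (\<lambda>k. x k - D k) \<le> \<rho>})"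
  proof (rule closed_Int)
    have "closed {x. x k = D k}" for k
      by (rule closed_Collect_eq) (auto intro: continuous_intros)
    then have "closed (\<Inter>k\<in>{n..}. {x. x k = D k})" by (intro closed_INT) auto
    moreover have "(\<Inter>k\<in>{n..}. {x. x k = D k}) = {x. \<forall>k\<ge>n. x k = D k}" by auto
    ultimately show "closed {x. \<forall>k\<ge>n. x k = D k}" by simp
    show "closed {x. energy (\<lambda>k. x k - D k) \<le> \<rho>}"
      by (rule closed_Collect_le[OF cont continuous_on_const])
  qed
  moreover have "{x. (\<forall>k\<ge>n. x k = D k) \<and> energy (\<lambda>k. x k - D k) \<le> \<rho>} \<subseteq> PiE UNIV S"
  proof (clarsimp simp: PiE_UNIV_domain Pi_iff S_def)
    fix x k assume x: "energy (\<lambda>k. x k - D k) \<le> \<rho>" "k < n"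
    have "(x k - D k)\<^sup>2 \<le> G k k * energy (\<lambda>k. x k - D k)"
      unfolding energy_def using coordinate_sq_le[OF x(2), of "\<lambda>k. x k - D k"] by simp
    also have "\<dots> \<le> G k k * \<rho>"
      using x G_diag[OF x(2)] w_nonneg by (intro mult_left_mono) (auto intro!: sum_nonneg mult_nonneg_nonneg)
    finally have "\<bar>x k - D k\<bar> \<le> sqrt (G k k * \<rho>)" by (rule real_le_rsqrt[of "\<bar>x k - D k\<bar>", simplified])
    then show "D k - sqrt (G k k * \<rho>) \<le> x k \<and> x k \<le> D k + sqrt (G k k * \<rho>)" by linarith
  qed
  ultimately show ?thesis
    using closed_Int_compact[OF _ comp, of "{x. \<forall>k\<ge>n. x k = D k} \<inter> {x. energy (\<lambda>k. x k - D k) \<le> \<rho>}"]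
    unfolding Collect_conj_eq by (simp only: Int_absorb2)
qed

lemma continuous_on_obj: "continuous_on A (obj D)"
proof -
  have p: "continuous_on UNIV psi"
    using has_real_derivative_psi by (intro continuous_at_imp_continuous_on ballI DERIV_isCont)
  have c: "continuous_on A (\<lambda>x. x k)" for k :: nat and A :: "(nat \<Rightarrow> real) set"
    by (rule continuous_on_subset[OF continuous_on_product_coordinates]) simp
  show ?thesis
    unfolding obj_def[abs_def] dot_def
    by (intro continuous_intros c continuous_on_compose2[OF p]) auto
qed

text \<open>The nonlinear part of the score, divided by the second derivative at the true parameter
  so that it enters \<open>obj_deriv\<close> with the same weight \<open>w\<close> as the linear
  part.\<close>

definition remainder :: "(nat \<Rightarrow> real) \<Rightarrow> 'a \<Rightarrow> real" where
  "remainder x \<alpha> = (dpsi (\<eta> \<alpha> + dot n (a \<alpha>) x) - dpsi (\<eta> \<alpha>)) / d2psi (\<eta> \<alpha>) - dot n (a \<alpha>) x"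

lemma obj_deriv_eq:
  "obj_deriv D x h = (\<Sum>\<alpha>\<in>I. w \<alpha> * (dot n (a \<alpha>) (\<lambda>k. x k - D k) + remainder x \<alpha>) * dot n (a \<alpha>) h)"
  unfolding obj_deriv_def
proof (intro sum.cong refl)
  fix \<alpha> assume "\<alpha> \<in> I"
  have "m \<alpha> * (dpsi (\<eta> \<alpha> + dot n (a \<alpha>) x) - dpsi (\<eta> \<alpha>)) - w \<alpha> * dot n (a \<alpha>) D =
    w \<alpha> * (dot n (a \<alpha>) (\<lambda>k. x k - D k) + remainder x \<alpha>)"
    unfolding w_eq[OF \<open>\<alpha> \<in> I\<close>] remainder_def dot_diff_right
    using d2psi_gt_0[of "\<eta> \<alpha>"] by (simp add: field_simps)
  then show "(m \<alpha> * (dpsi (\<eta> \<alpha> + dot n (a \<alpha>) x) - dpsi (\<eta> \<alpha>)) - w \<alpha> * dot n (a \<alpha>) D) * dot n (a \<alpha>) h =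
    w \<alpha> * (dot n (a \<alpha>) (\<lambda>k. x k - D k) + remainder x \<alpha>) * dot n (a \<alpha>) h" by simp
qed

lemma remainder_bounds:
  assumes "\<bar>dot n (a \<alpha>) x\<bar> \<le> 1"
  shows "\<bar>remainder x \<alpha>\<bar> \<le> 9 / 2 * (dot n (a \<alpha>) x)\<^sup>2"
    and "\<bar>remainder x \<alpha> - d3psi (\<eta> \<alpha>) / d2psi (\<eta> \<alpha>) / 2 * (dot n (a \<alpha>) x)\<^sup>2\<bar>
      \<le> 3 / 2 * \<bar>dot n (a \<alpha>) x\<bar> ^ 3"
proof -
  let ?h = "dot n (a \<alpha>) x" and ?p = "d2psi (\<eta> \<alpha>)"
  have p: "0 < ?p" by (rule d2psi_gt_0)
  have "dpsi (\<eta> \<alpha> + ?h) - dpsi (\<eta> \<alpha>) - ?p * ?h = ?p * remainder x \<alpha>"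
    using p by (simp add: remainder_def field_simps)
  then have "?p * \<bar>remainder x \<alpha>\<bar> \<le> ?p * (9 / 2 * ?h\<^sup>2)"
    using dpsi_taylor2[OF assms, of "\<eta> \<alpha>"] p by (simp add: abs_mult)
  then show "\<bar>remainder x \<alpha>\<bar> \<le> 9 / 2 * ?h\<^sup>2" using p by simp
  have "dpsi (\<eta> \<alpha> + ?h) - dpsi (\<eta> \<alpha>) - ?p * ?h - d3psi (\<eta> \<alpha>) / 2 * ?h\<^sup>2 =
      ?p * (remainder x \<alpha> - d3psi (\<eta> \<alpha>) / ?p / 2 * ?h\<^sup>2)"
    using p by (simp add: remainder_def field_simps)
  then have "?p * \<bar>remainder x \<alpha> - d3psi (\<eta> \<alpha>) / ?p / 2 * ?h\<^sup>2\<bar> \<le> ?p * (3 / 2 * \<bar>?h\<bar> ^ 3)"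
    using dpsi_taylor3[OF assms, of "\<eta> \<alpha>"] p by (simp add: abs_mult)
  then show "\<bar>remainder x \<alpha> - d3psi (\<eta> \<alpha>) / ?p / 2 * ?h\<^sup>2\<bar> \<le> 3 / 2 * \<bar>?h\<bar> ^ 3" using p by simp
qed

text \<open>One factor \<open>f\<close> stays under the weighted sum; each of the others is replaced
  by its uniform bound \<open>c * T\<close>.\<close>

lemma sum_w_pow_le:
  assumes f: "\<And>\<alpha>. \<alpha> \<in> I \<Longrightarrow> 0 \<le> f \<alpha>" "\<And>\<alpha>. \<alpha> \<in> I \<Longrightarrow> f \<alpha> \<le> c * K \<alpha> \<alpha>" and c: "0 \<le> c"
  shows "(\<Sum>\<alpha>\<in>I. w \<alpha> * f \<alpha> ^ Suc j) \<le> (c * T) ^ j * (\<Sum>\<alpha>\<in>I. w \<alpha> * f \<alpha>)"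
  unfolding sum_distrib_left
proof (intro sum_mono)
  fix \<alpha> assume \<alpha>: "\<alpha> \<in> I"
  have "f \<alpha> \<le> c * T" using f(2)[OF \<alpha>] mult_left_mono[OF K_le[OF \<alpha>] c] by linarith
  then have "f \<alpha> ^ j \<le> (c * T) ^ j" using f(1)[OF \<alpha>] by (intro power_mono)
  then have "f \<alpha> ^ j * (w \<alpha> * f \<alpha>) \<le> (c * T) ^ j * (w \<alpha> * f \<alpha>)"
    using f(1)[OF \<alpha>] w_nonneg[OF \<alpha>] by (intro mult_right_mono) auto
  then show "w \<alpha> * f \<alpha> ^ Suc j \<le> (c * T) ^ j * (w \<alpha> * f \<alpha>)" by (simp add: mult_ac)
qed

lemma sum_w_newton_pow_le:
  assumes D: "\<And>\<alpha>. \<alpha> \<in> I \<Longrightarrow> (dot n (a \<alpha>) D)\<^sup>2 \<le> \<omega> * K \<alpha> \<alpha>" and \<omega>: "0 \<le> \<omega>"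
  shows "(\<Sum>\<alpha>\<in>I. w \<alpha> * ((dot n (a \<alpha>) D)\<^sup>2) ^ Suc j) \<le> (\<omega> * T) ^ j * (\<omega> * n)"
proof -
  have "(\<Sum>\<alpha>\<in>I. w \<alpha> * (dot n (a \<alpha>) D)\<^sup>2) \<le> (\<Sum>\<alpha>\<in>I. w \<alpha> * (\<omega> * K \<alpha> \<alpha>))"
    using D by (intro sum_mono mult_left_mono w_nonneg) auto
  also have "\<dots> = \<omega> * n" by (simp add: sum_K_diag[symmetric] sum_distrib_left mult_ac)
  finally have "(\<omega> * T) ^ j * (\<Sum>\<alpha>\<in>I. w \<alpha> * (dot n (a \<alpha>) D)\<^sup>2) \<le> (\<omega> * T) ^ j * (\<omega> * n)"
    using \<omega> T_pos by (intro mult_left_mono) auto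
  moreover have "(\<Sum>\<alpha>\<in>I. w \<alpha> * ((dot n (a \<alpha>) D)\<^sup>2) ^ Suc j) \<le>
      (\<omega> * T) ^ j * (\<Sum>\<alpha>\<in>I. w \<alpha> * (dot n (a \<alpha>) D)\<^sup>2)"
    using D \<omega> by (intro sum_w_pow_le) auto
  ultimately show ?thesis by linarith
qed

lemma sum_w_energy_pow_le:
  "(\<Sum>\<alpha>\<in>I. w \<alpha> * ((dot n (a \<alpha>) r)\<^sup>2) ^ Suc j) \<le> (energy r * T) ^ j * energy r"
  using sum_w_pow_le[of "\<lambda>\<alpha>. (dot n (a \<alpha>) r)\<^sup>2" "energy r" j] dot_a_sq_le[of _ r] energy_nonneg
  by (simp add: energy_def mult.commute)

section \<open>Existence of the minimiser near the Newton step\<close>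

context
  fixes D :: "nat \<Rightarrow> real" and \<omega> :: real
  assumes D: "\<And>\<alpha>. \<alpha> \<in> I \<Longrightarrow> (dot n (a \<alpha>) D)\<^sup>2 \<le> \<omega> * K \<alpha> \<alpha>" and \<omega>: "0 < \<omega>"
    and small: "(\<omega> * T)\<^sup>2 * n \<le> 1 / 360 ^ 2"
begin

text \<open>In the bound on the remainder energy, the Newton part is 162/400 of
  \<open>radius2\<close>, less than half. The smallness condition makes the other part at most half:
  360^2 = 400 * 324 gives \<open>radius2 * T\<close> \<le> 1/324, and 162/324 = 1/2.\<close>

definition radius2 :: real where "radius2 = 400 * (\<omega> * T * (\<omega> * n))"

lemma radius2_pos: "0 < radius2"
  unfolding radius2_def using \<omega> T_pos n_pos by simp

lemma radius2_T: "radius2 * T = 400 * ((\<omega> * T)\<^sup>2 * n)" "radius2 * T \<le> 1 / 324"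
proof -
  show 1: "radius2 * T = 400 * ((\<omega> * T)\<^sup>2 * n)"
    by (simp add: radius2_def power2_eq_square mult_ac)
  show "radius2 * T \<le> 1 / 324" unfolding 1 using small by simp
qed

lemma omega_T: "\<omega> * T \<le> 1 / 360"
proof -
  have "(\<omega> * T)\<^sup>2 * 1 \<le> (\<omega> * T)\<^sup>2 * n" using n_pos by (intro mult_left_mono) auto
  then have "(\<omega> * T)\<^sup>2 \<le> (1 / 360)\<^sup>2" using small by (simp add: power_divide)
  then show ?thesis by (rule power2_le_imp_le) simp
qed

lemma abs_dot_le_1:
  assumes "\<alpha> \<in> I" "energy (\<lambda>k. x k - D k) \<le> radius2"
  shows "\<bar>dot n (a \<alpha>) x\<bar> \<le> 1"
proof -
  have "(dot n (a \<alpha>) D)\<^sup>2 \<le> \<omega> * T"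
    using D[OF assms(1)] mult_left_mono[OF K_le[OF assms(1)], of \<omega>] \<omega> by linarith
  then have "(dot n (a \<alpha>) D)\<^sup>2 \<le> (1 / 2)\<^sup>2" using omega_T by (simp add: power_divide)
  then have 1: "\<bar>dot n (a \<alpha>) D\<bar> \<le> 1 / 2" by (simp add: abs_le_square_iff[symmetric])
  have "(dot n (a \<alpha>) (\<lambda>k. x k - D k))\<^sup>2 \<le> K \<alpha> \<alpha> * energy (\<lambda>k. x k - D k)"
    unfolding energy_def by (rule dot_a_sq_le)
  also have "\<dots> \<le> T * radius2"
    using assms K_le K_nonneg energy_nonneg T_pos by (intro mult_mono) auto
  finally have "(dot n (a \<alpha>) (\<lambda>k. x k - D k))\<^sup>2 \<le> (1 / 2)\<^sup>2"
    using radius2_T(2) by (simp add: power_divide mult.commute)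
  then have 2: "\<bar>dot n (a \<alpha>) (\<lambda>k. x k - D k)\<bar> \<le> 1 / 2" by (simp add: abs_le_square_iff[symmetric])
  show ?thesis using 1 2 unfolding dot_diff_right by linarith
qed

lemma remainder_sum_less:
  assumes x: "energy (\<lambda>k. x k - D k) \<le> radius2"
  shows "(\<Sum>\<alpha>\<in>I. w \<alpha> * (remainder x \<alpha>)\<^sup>2) < radius2"
proof -
  let ?r = "\<lambda>k. x k - D k"
  have "(\<Sum>\<alpha>\<in>I. w \<alpha> * (remainder x \<alpha>)\<^sup>2) \<le>
      (\<Sum>\<alpha>\<in>I. w \<alpha> * (162 * (((dot n (a \<alpha>) D)\<^sup>2) ^ Suc 1 + ((dot n (a \<alpha>) ?r)\<^sup>2) ^ Suc 1)))"
  proof (intro sum_mono mult_left_mono w_nonneg)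
    fix \<alpha> assume \<alpha>: "\<alpha> \<in> I"
    have "(remainder x \<alpha>)\<^sup>2 \<le> (9 / 2 * (dot n (a \<alpha>) x)\<^sup>2)\<^sup>2"
      using remainder_bounds(1)[OF abs_dot_le_1[OF \<alpha> x]] by (simp add: abs_le_square_iff[symmetric])
    also have "\<dots> = 81 / 4 * (dot n (a \<alpha>) D + dot n (a \<alpha>) ?r) ^ 4"
      by (simp add: dot_diff_right power_mult_distrib power_divide)
    also have "\<dots> \<le> 81 / 4 * (8 * ((dot n (a \<alpha>) D) ^ 4 + (dot n (a \<alpha>) ?r) ^ 4))"
      by (intro mult_left_mono quartic_sum_le) auto
    finally show "(remainder x \<alpha>)\<^sup>2 \<le>
        162 * (((dot n (a \<alpha>) D)\<^sup>2) ^ Suc 1 + ((dot n (a \<alpha>) ?r)\<^sup>2) ^ Suc 1)"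
      by (simp add: power2_eq_square power4_eq_xxxx mult_ac)
  qed
  also have "\<dots> = 162 * (\<Sum>\<alpha>\<in>I. w \<alpha> * ((dot n (a \<alpha>) D)\<^sup>2) ^ Suc 1) +
      162 * (\<Sum>\<alpha>\<in>I. w \<alpha> * ((dot n (a \<alpha>) ?r)\<^sup>2) ^ Suc 1)"
    by (simp only: sum_distrib_left sum.distrib[symmetric]) (simp add: algebra_simps)
  also have "\<dots> \<le> 162 * ((\<omega> * T) ^ 1 * (\<omega> * n)) + 162 * ((energy ?r * T) ^ 1 * energy ?r)"
    using \<omega> by (intro add_mono mult_left_mono sum_w_newton_pow_le sum_w_energy_pow_le D) auto
  also have "162 * ((energy ?r * T) ^ 1 * energy ?r) \<le> 162 * (radius2 * T * radius2)"
  proof -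
    have "energy ?r * T * energy ?r \<le> radius2 * T * radius2"
      using x T_pos energy_nonneg[of ?r] by (intro mult_mono) auto
    then show ?thesis by simp
  qed
  also have "162 * (radius2 * T * radius2) \<le> 1 / 2 * radius2"
    using mult_right_mono[OF radius2_T(2), of radius2] radius2_pos by simp
  also have "162 * ((\<omega> * T) ^ 1 * (\<omega> * n)) + 1 / 2 * radius2 < radius2"
    using radius2_pos by (simp add: radius2_def)
  finally show ?thesis by simp
qed

text \<open>Towards the centre the linear part of the score contributes exactly
  \<open>- radius2\<close>. By Cauchy-Schwarz the remainder contributes strictly less than
  \<open>radius2\<close> in absolute value.\<close>

lemma obj_deriv_boundary:
  assumes x: "energy (\<lambda>k. x k - D k) = radius2"
  shows "obj_deriv D x (\<lambda>k. D k - x k) < 0"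
proof -
  let ?r = "\<lambda>k. x k - D k"
  let ?S = "\<Sum>\<alpha>\<in>I. w \<alpha> * remainder x \<alpha> * dot n (a \<alpha>) ?r"
  have "?S\<^sup>2 \<le> (\<Sum>\<alpha>\<in>I. w \<alpha> * (remainder x \<alpha>)\<^sup>2) * energy ?r"
    unfolding energy_def by (rule weighted_cauchy_schwarz) (rule w_nonneg)
  also have "\<dots> < radius2 * radius2"
    unfolding x using radius2_pos remainder_sum_less[of x] x by (intro mult_strict_right_mono) auto
  finally have "?S\<^sup>2 < radius2\<^sup>2" by (simp add: power2_eq_square)
  then have "\<bar>?S\<bar> < radius2" 
    using radius2_pos power2_less_imp_less[of "\<bar>?S\<bar>" radius2] by simp
  moreover have "obj_deriv D x (\<lambda>k. D k - x k) = - energy ?r - ?S"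
  proof -
    have "dot n (a \<alpha>) (\<lambda>k. D k - x k) = - dot n (a \<alpha>) ?r" for \<alpha> by (simp add: dot_diff_right)
    then show ?thesis
      unfolding obj_deriv_eq energy_def
      by (simp add: sum_negf sum_subtractf[symmetric] sum.distrib[symmetric] power2_eq_square algebra_simps)
  qed
  ultimately show ?thesis using x by linarith
qed

text \<open>Compactness yields a minimiser over the closed ball. It cannot lie on the boundary,
  where moving inwards decreases the objective, so it is a local minimum in every relevant
  direction.\<close>

lemma stationary_point: "\<exists>x. energy (\<lambda>k. x k - D k) < radius2 \<and> (\<forall>h. obj_deriv D x h = 0)"
proof -
  define C where "C = {x. (\<forall>k\<ge>n. x k = D k) \<and> energy (\<lambda>k. x k - D k) \<le> radius2}"
  have "D \<in> C" using radius2_pos by (simp add: C_def energy_def dot_def)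
  moreover have "compact C" unfolding C_def by (rule compact_energy_ball)
  ultimately obtain x where x: "x \<in> C" and min: "\<And>y. y \<in> C \<Longrightarrow> obj D x \<le> obj D y"
    using continuous_attains_inf[OF _ _ continuous_on_obj, of C D] by blast
  have inner: "energy (\<lambda>k. x k - D k) < radius2"
  proof (rule ccontr)
    assume "\<not> ?thesis"
    then have eq: "energy (\<lambda>k. x k - D k) = radius2" using x by (simp add: C_def)
    let ?f = "\<lambda>s. obj D (\<lambda>k. x k + s * (D k - x k))"
    obtain d where d: "0 < d" "\<And>s. 0 < s \<Longrightarrow> s < d \<Longrightarrow> ?f (0 + s) < ?f 0"
      using DERIV_neg_dec_right[OF obj_has_derivative obj_deriv_boundary[OF eq]] by blast
    \<comment> \<open>The cap at 1 makes the move towards \<open>D\<close> a contraction by 1 - s,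
      which stays in the ball.\<close>
    define s where "s = min (d / 2) 1"
    have s: "0 < s" "s < d" "s \<le> 1" using d by (auto simp: s_def)
    have "energy (\<lambda>k. (1 - s) * (x k - D k)) \<le> 1 * radius2"
      unfolding energy_scale eq using s radius2_pos by (intro mult_right_mono power_le_one) auto
    moreover have "(\<lambda>k. x k + s * (D k - x k) - D k) = (\<lambda>k. (1 - s) * (x k - D k))"
      by (simp add: fun_eq_iff algebra_simps)
    ultimately have "(\<lambda>k. x k + s * (D k - x k)) \<in> C" using x by (simp add: C_def)
    then have "?f 0 \<le> ?f s" using min by simp
    with d(2)[OF s(1,2)] show False by simp
  qed
  have "obj_deriv D x h = 0" for h
  proof -
    \<comment> \<open>The ball fixes the coordinates from \<open>n\<close> on, so the direction is
      cut off there; \<open>obj_deriv\<close> does not notice.\<close>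
    define h' where "h' k = (if k < n then h k else 0)" for k
    have "continuous_on UNIV (\<lambda>s::real. energy (\<lambda>k. x k + s * h' k - D k))"
      unfolding energy_def dot_def by (intro continuous_intros)
    then have "open {s::real. energy (\<lambda>k. x k + s * h' k - D k) < radius2}"
      by (intro open_Collect_less continuous_on_const)
    moreover have "0 \<in> {s::real. energy (\<lambda>k. x k + s * h' k - D k) < radius2}" using inner by simp
    ultimately obtain d where "0 < d" "ball 0 d \<subseteq> {s::real. energy (\<lambda>k. x k + s * h' k - D k) < radius2}"
      by (rule openE)
    then have d: "0 < d" "\<And>s. \<bar>s\<bar> < d \<Longrightarrow> energy (\<lambda>k. x k + s * h' k - D k) < radius2"
      by (auto simp: subset_iff dist_real_def)
    have "\<forall>s. \<bar>0 - s\<bar> < d \<longrightarrow> obj D (\<lambda>k. x k + 0 * h' k) \<le> obj D (\<lambda>k. x k + s * h' k)"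
    proof (intro allI impI)
      fix s assume "\<bar>0 - s\<bar> < d"
      then have "(\<lambda>k. x k + s * h' k) \<in> C"
        using d(2)[of s] x by (simp add: C_def h'_def)
      then show "obj D (\<lambda>k. x k + 0 * h' k) \<le> obj D (\<lambda>k. x k + s * h' k)" using min by simp
    qed
    from DERIV_local_min[OF obj_has_derivative d(1) this] have "obj_deriv D x h' = 0" .
    moreover have "dot n (a \<alpha>) h' = dot n (a \<alpha>) h" for \<alpha> by (simp add: dot_def h'_def)
    ultimately show ?thesis by (simp add: obj_deriv_def)
  qed
  with inner show ?thesis by blast
qed

text \<open>Stationarity tested against the rows of \<open>G\<close> gives a fixed-point equation
  for \<open>x\<close>. Its remainder is replaced by the quadratic Taylor term evaluated at
  \<open>D\<close>, and \<open>z\<close> collects the error. The last factor of the bound on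
  \<open>z\<close> is the gain over the energy of the quadratic term itself.\<close>

theorem strict_minimizer_expansion:
  "\<exists>x z. (\<forall>y k. k < n \<longrightarrow> x k \<noteq> y k \<longrightarrow> obj D x < obj D y) \<and>
    (\<forall>k<n. x k = D k - (\<Sum>\<alpha>\<in>I. m \<alpha> * d3psi (\<eta> \<alpha>) * (dot n (a \<alpha>) D)\<^sup>2 * b \<alpha> k) / 2
      - (\<Sum>\<alpha>\<in>I. w \<alpha> * z \<alpha> * b \<alpha> k)) \<and>
    (\<Sum>\<alpha>\<in>I. w \<alpha> * (z \<alpha>)\<^sup>2) \<le>
      \<omega> * T * (\<omega> * n) * (232000 * ((\<omega> * T)\<^sup>2 * n) + 1744 * (\<omega> * T))"
proof -
  obtain x where x: "energy (\<lambda>k. x k - D k) < radius2" "\<And>h. obj_deriv D x h = 0"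
    using stationary_point by blast
  let ?r = "\<lambda>k. x k - D k"
  define z where "z \<alpha> = remainder x \<alpha> - d3psi (\<eta> \<alpha>) / d2psi (\<eta> \<alpha>) / 2 * (dot n (a \<alpha>) D)\<^sup>2" for \<alpha>
  have "obj D x < obj D y" if "k < n" "x k \<noteq> y k" for y k
    using obj_above_tangent[of k x y D, OF that] x(2) by simp
  moreover have "x k = D k - (\<Sum>\<alpha>\<in>I. m \<alpha> * d3psi (\<eta> \<alpha>) * (dot n (a \<alpha>) D)\<^sup>2 * b \<alpha> k) / 2
      - (\<Sum>\<alpha>\<in>I. w \<alpha> * z \<alpha> * b \<alpha> k)" if k: "k < n" for k
  proof -
    have "x k - D k = (\<Sum>\<alpha>\<in>I. w \<alpha> * dot n (a \<alpha>) ?r * b \<alpha> k)"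
      using repro[OF k, of ?r] by (simp add: b_def)
    \<comment> \<open>Testing in the direction of row \<open>k\<close> of \<open>G\<close> turns
      each form \<open>a \<alpha>\<close> into \<open>b \<alpha> k\<close>.\<close>
    also have "\<dots> = - (\<Sum>\<alpha>\<in>I. w \<alpha> * remainder x \<alpha> * b \<alpha> k)"
      using x(2)[of "\<lambda>j. G k j"] unfolding obj_deriv_eq dot_a_gmul
      by (simp add: sum.distrib algebra_simps)
    also have "(\<Sum>\<alpha>\<in>I. w \<alpha> * remainder x \<alpha> * b \<alpha> k) =
        (\<Sum>\<alpha>\<in>I. m \<alpha> * d3psi (\<eta> \<alpha>) * (dot n (a \<alpha>) D)\<^sup>2 * b \<alpha> k) / 2 + (\<Sum>\<alpha>\<in>I. w \<alpha> * z \<alpha> * b \<alpha> k)"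
      unfolding sum_divide_distrib sum.distrib[symmetric]
    proof (intro sum.cong refl)
      fix \<alpha> assume "\<alpha> \<in> I"
      show "w \<alpha> * remainder x \<alpha> * b \<alpha> k =
          m \<alpha> * d3psi (\<eta> \<alpha>) * (dot n (a \<alpha>) D)\<^sup>2 * b \<alpha> k / 2 + w \<alpha> * z \<alpha> * b \<alpha> k"
        using d2psi_gt_0[of "\<eta> \<alpha>"] by (simp add: z_def w_eq[OF \<open>\<alpha> \<in> I\<close>] field_simps)
    qed
    finally show ?thesis by simp
  qed
  moreover have "(\<Sum>\<alpha>\<in>I. w \<alpha> * (z \<alpha>)\<^sup>2) \<le>
      \<omega> * T * (\<omega> * n) * (232000 * ((\<omega> * T)\<^sup>2 * n) + 1744 * (\<omega> * T))"
  proof -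
    let ?l = "\<lambda>\<alpha>. (dot n (a \<alpha>) D)\<^sup>2" and ?q = "\<lambda>\<alpha>. (dot n (a \<alpha>) ?r)\<^sup>2"
    define E where "E = energy ?r"
    define \<theta> where "\<theta> = \<omega> * T"
    define R where "R = \<omega> * T * (\<omega> * n)"
    have E: "0 \<le> E" "E \<le> 400 * R" "E * T \<le> 400 * (\<theta>\<^sup>2 * n)" "E * T \<le> 1 / 324"
    proof -
      show "0 \<le> E" "E \<le> 400 * R" using x(1) energy_nonneg by (auto simp: E_def radius2_def R_def)
      have "E * T \<le> radius2 * T" using x(1) T_pos by (intro mult_right_mono) (auto simp: E_def)
      then show "E * T \<le> 400 * (\<theta>\<^sup>2 * n)" "E * T \<le> 1 / 324" using radius2_T by (auto simp: \<theta>_def)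
    qed
    have \<theta>: "0 < \<theta>" using \<omega> T_pos by (simp add: \<theta>_def)
    have R: "0 \<le> R" using \<omega> T_pos by (simp add: R_def)
    have "(z \<alpha>)\<^sup>2 \<le> ?q \<alpha> ^ Suc 1 + 4 * (?l \<alpha> * ?q \<alpha>) + 144 * (?l \<alpha> ^ Suc 2 + ?q \<alpha> ^ Suc 2)"
      if \<alpha>: "\<alpha> \<in> I" for \<alpha>
    proof -
      let ?d = "dot n (a \<alpha>) D + dot n (a \<alpha>) ?r"
      have d: "dot n (a \<alpha>) x = ?d" by (simp add: dot_diff_right)
      have "\<bar>z \<alpha>\<bar> \<le> \<bar>remainder x \<alpha> - d3psi (\<eta> \<alpha>) / d2psi (\<eta> \<alpha>) / 2 * ?d\<^sup>2\<bar> +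
          \<bar>d3psi (\<eta> \<alpha>) / d2psi (\<eta> \<alpha>) / 2 * (?d\<^sup>2 - ?l \<alpha>)\<bar>"
      proof -
        have tri: "\<bar>u - q\<bar> \<le> \<bar>u - p\<bar> + \<bar>p - q\<bar>" for u p q :: real by linarith
        show ?thesis unfolding z_def right_diff_distrib by (rule tri)
      qed
      also have "\<dots> \<le> 3 / 2 * \<bar>?d\<bar> ^ 3 + \<bar>?d\<^sup>2 - ?l \<alpha>\<bar> / 2"
      proof (rule add_mono)
        show "\<bar>remainder x \<alpha> - d3psi (\<eta> \<alpha>) / d2psi (\<eta> \<alpha>) / 2 * ?d\<^sup>2\<bar> \<le> 3 / 2 * \<bar>?d\<bar> ^ 3"
          using remainder_bounds(2)[OF abs_dot_le_1[OF \<alpha>, of x]] x(1) unfolding d by simp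
        have "\<bar>d3psi (\<eta> \<alpha>) / d2psi (\<eta> \<alpha>)\<bar> \<le> 1"
          using abs_d3psi_le[of "\<eta> \<alpha>"] d2psi_gt_0[of "\<eta> \<alpha>"] by simp
        then have "\<bar>d3psi (\<eta> \<alpha>) / d2psi (\<eta> \<alpha>)\<bar> * (\<bar>?d\<^sup>2 - ?l \<alpha>\<bar> / 2) \<le> 1 * (\<bar>?d\<^sup>2 - ?l \<alpha>\<bar> / 2)"
          by (intro mult_right_mono) auto
        then show "\<bar>d3psi (\<eta> \<alpha>) / d2psi (\<eta> \<alpha>) / 2 * (?d\<^sup>2 - ?l \<alpha>)\<bar> \<le> \<bar>?d\<^sup>2 - ?l \<alpha>\<bar> / 2"
          by (simp add: abs_mult)
      qed
      finally have "\<bar>z \<alpha>\<bar> \<le> \<bar>?d\<^sup>2 - ?l \<alpha>\<bar> / 2 + 3 / 2 * \<bar>?d\<bar> ^ 3" by simp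
      from second_order_error_le[OF this] show ?thesis
        by (simp flip: power_mult power_Suc)
    qed
    then have "(\<Sum>\<alpha>\<in>I. w \<alpha> * (z \<alpha>)\<^sup>2) \<le>
        (\<Sum>\<alpha>\<in>I. w \<alpha> * (?q \<alpha> ^ Suc 1 + 4 * (?l \<alpha> * ?q \<alpha>) + 144 * (?l \<alpha> ^ Suc 2 + ?q \<alpha> ^ Suc 2)))"
      by (intro sum_mono mult_left_mono w_nonneg)
    also have "\<dots> = (\<Sum>\<alpha>\<in>I. w \<alpha> * ?q \<alpha> ^ Suc 1) + 4 * (\<Sum>\<alpha>\<in>I. w \<alpha> * (?l \<alpha> * ?q \<alpha>)) +
        144 * ((\<Sum>\<alpha>\<in>I. w \<alpha> * ?l \<alpha> ^ Suc 2) + (\<Sum>\<alpha>\<in>I. w \<alpha> * ?q \<alpha> ^ Suc 2))"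
      by (simp only: distrib_left sum.distrib sum_distrib_left mult.left_commute)
    also have "\<dots> \<le> (E * T) ^ 1 * E + 4 * (\<theta> * E) + 144 * (\<theta> ^ 2 * (\<omega> * n) + (E * T) ^ 2 * E)"
    proof (intro add_mono mult_left_mono)
      show "(\<Sum>\<alpha>\<in>I. w \<alpha> * (?l \<alpha> * ?q \<alpha>)) \<le> \<theta> * E"
        unfolding E_def energy_def sum_distrib_left
      proof (intro sum_mono)
        fix \<alpha> assume \<alpha>: "\<alpha> \<in> I"
        have "?l \<alpha> \<le> \<theta>"
          using D[OF \<alpha>] mult_left_mono[OF K_le[OF \<alpha>], of \<omega>] \<omega> unfolding \<theta>_def by linarith
        then have "?l \<alpha> * (w \<alpha> * ?q \<alpha>) \<le> \<theta> * (w \<alpha> * ?q \<alpha>)"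
          using w_nonneg[OF \<alpha>] by (intro mult_right_mono) auto
        then show "w \<alpha> * (?l \<alpha> * ?q \<alpha>) \<le> \<theta> * (w \<alpha> * ?q \<alpha>)" by (simp add: mult_ac)
      qed
      show "(\<Sum>\<alpha>\<in>I. w \<alpha> * ?l \<alpha> ^ Suc 2) \<le> \<theta> ^ 2 * (\<omega> * n)"
        unfolding \<theta>_def using D \<omega> by (intro sum_w_newton_pow_le) auto
    qed (simp_all only: E_def sum_w_energy_pow_le zero_le_numeral)
    also have "(E * T) ^ 1 * E \<le> 400 * (\<theta>\<^sup>2 * n) * (400 * R)"
      unfolding power_one_right by (rule mult_mono[OF E(3,2)]) (use E(1) in auto)
    also have "4 * (\<theta> * E) \<le> 4 * (\<theta> * (400 * R))"
      using E \<theta> by (intro mult_left_mono) auto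
    also have "(E * T) ^ 2 * E \<le> (400 * (\<theta>\<^sup>2 * n) * (1 / 324)) * (400 * R)"
      unfolding power2_eq_square[of "E * T"]
      by (rule mult_mono[OF mult_mono[OF E(3,4)] E(2)]) (use E(1) T_pos in auto)
    also have "\<theta>\<^sup>2 * (\<omega> * n) = \<theta> * R" by (simp add: \<theta>_def R_def power2_eq_square)
    \<comment> \<open>1744 = 4 * 400 + 144, and 232000 rounds up 400^2 + 144 * 400^2 / 324.\<close>
    also have "400 * (\<theta>\<^sup>2 * n) * (400 * R) + 4 * (\<theta> * (400 * R)) +
        144 * (\<theta> * R + 400 * (\<theta>\<^sup>2 * n) * (1 / 324) * (400 * R)) \<le>
        R * (232000 * (\<theta>\<^sup>2 * n) + 1744 * \<theta>)"
      using R by (simp add: algebra_simps)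
    finally show ?thesis by (simp add: R_def \<theta>_def)
  qed
  ultimately show ?thesis by blast
qed

end

end

section \<open>Stochastic bounds\<close>

text \<open>Jensen's inequality for the cube, from its tangent at the weighted mean
  \<open>c\<close>: the gap is (z - c)^2 (z + 2 c).\<close>

lemma cube_weighted_mean_le:
  fixes h z :: "'a \<Rightarrow> real"
  assumes fin: "finite A" and h: "\<And>k. k \<in> A \<Longrightarrow> 0 < h k" and z: "\<And>k. k \<in> A \<Longrightarrow> 0 \<le> z k"
  shows "(\<Sum>k\<in>A. h k * z k) ^ 3 \<le> (\<Sum>k\<in>A. h k)\<^sup>2 * (\<Sum>k\<in>A. h k * z k ^ 3)"
proof (cases "A = {}")
  case False
  define \<Phi> where "\<Phi> = (\<Sum>k\<in>A. h k)"
  have \<Phi>: "0 < \<Phi>" unfolding \<Phi>_def using False fin h by (intro sum_pos) auto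
  define c where "c = (\<Sum>k\<in>A. h k * z k) / \<Phi>"
  have c: "0 \<le> c" unfolding c_def using \<Phi> h z by (intro divide_nonneg_pos sum_nonneg) (auto simp: less_imp_le)
  have s: "(\<Sum>k\<in>A. h k * z k) = \<Phi> * c" using \<Phi> by (simp add: c_def)
  have "3 * c\<^sup>2 * (\<Phi> * c) - 2 * c ^ 3 * \<Phi> = (\<Sum>k\<in>A. h k * (3 * c\<^sup>2 * z k - 2 * c ^ 3))"
    unfolding s[symmetric] by (simp add: \<Phi>_def sum_distrib_left sum_distrib_right sum_subtractf algebra_simps)
  also have "\<dots> \<le> (\<Sum>k\<in>A. h k * z k ^ 3)"
  proof (intro sum_mono mult_left_mono)
    fix k assume "k \<in> A"
    have "0 \<le> (z k - c)\<^sup>2 * (z k + 2 * c)" using z[OF \<open>k \<in> A\<close>] c by simp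
    also have "\<dots> = z k ^ 3 - (3 * c\<^sup>2 * z k - 2 * c ^ 3)"
      by (simp add: power2_eq_square power3_eq_cube algebra_simps)
    finally show "3 * c\<^sup>2 * z k - 2 * c ^ 3 \<le> z k ^ 3" by simp
    show "0 \<le> h k" using h[OF \<open>k \<in> A\<close>] by simp
  qed
  finally have "\<Phi> * c ^ 3 \<le> (\<Sum>k\<in>A. h k * z k ^ 3)"
    by (simp add: power2_eq_square power3_eq_cube algebra_simps)
  then have "\<Phi>\<^sup>2 * (\<Phi> * c ^ 3) \<le> \<Phi>\<^sup>2 * (\<Sum>k\<in>A. h k * z k ^ 3)" by (intro mult_left_mono) auto
  then show ?thesis unfolding s \<Phi>_def[symmetric]
    by (simp add: power2_eq_square power3_eq_cube mult_ac)
qed simp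

lemma square_sum4_le: "(p + q + r + t)\<^sup>2 \<le> 4 * (p\<^sup>2 + q\<^sup>2 + r\<^sup>2 + t\<^sup>2 :: real)"
proof -
  have "0 \<le> (p - q)\<^sup>2 + (p - r)\<^sup>2 + (p - t)\<^sup>2 + (q - r)\<^sup>2 + (q - t)\<^sup>2 + (r - t)\<^sup>2" by simp
  then show ?thesis by (simp add: power2_eq_square algebra_simps)
qed

text \<open>The centred square has variance p (1 - p) (1 - 2 p)^2, which p (1 - p) still bounds. It
  is needed for the diagonal terms of the quadratic chaos.\<close>

lemma bernoulli_noise:
  fixes p :: "'i \<Rightarrow> real"
  assumes "\<And>i. 0 \<le> p i" "\<And>i. p i \<le> 1"
  shows "bool_noise (\<lambda>i. bernoulli_pmf (p i)) (\<lambda>i y. of_bool y - p i) (\<lambda>i. p i * (1 - p i))"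
    and "bool_noise (\<lambda>i. bernoulli_pmf (p i)) (\<lambda>i y. (of_bool y - p i)\<^sup>2 - p i * (1 - p i)) (\<lambda>i. p i * (1 - p i))"
proof -
  have E: "measure_pmf.expectation (bernoulli_pmf (p i)) f = p i * f True + (1 - p i) * f False"
    for i and f :: "bool \<Rightarrow> real"
    using assms by (subst integral_bernoulli_pmf) auto
  have sq: "p i * p i \<le> p i" for i using assms[of i] by (simp add: mult_left_le)
  have v: "0 \<le> p i * (1 - p i)" "p i * (1 - p i) \<le> 1" for i
    using assms[of i] by (auto intro: mult_le_one)
  show "bool_noise (\<lambda>i. bernoulli_pmf (p i)) (\<lambda>i y. of_bool y - p i) (\<lambda>i. p i * (1 - p i))"
  proof unfold_locales
    show "\<bar>of_bool y - p i\<bar> \<le> 1" for i y using assms[of i] by (cases y) auto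
  qed (auto simp: E power2_eq_square algebra_simps)
  show "bool_noise (\<lambda>i. bernoulli_pmf (p i)) (\<lambda>i y. (of_bool y - p i)\<^sup>2 - p i * (1 - p i)) (\<lambda>i. p i * (1 - p i))"
  proof unfold_locales
    fix i y
    show "measure_pmf.expectation (bernoulli_pmf (p i)) (\<lambda>y. (of_bool y - p i)\<^sup>2 - p i * (1 - p i)) = 0"
      unfolding E by (simp add: power2_eq_square algebra_simps)
    have "0 \<le> (of_bool y - p i)\<^sup>2" "(of_bool y - p i)\<^sup>2 \<le> 1"
      using assms[of i] by (auto simp: abs_square_le_1 abs_if)
    then show "\<bar>(of_bool y - p i)\<^sup>2 - p i * (1 - p i)\<bar> \<le> 1" using v[of i] by linarith
    have "p i * (1 - p i) * (1 - 2 * p i)\<^sup>2 \<le> p i * (1 - p i) * 1"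
      using assms[of i] by (intro mult_left_mono v) (auto simp: abs_square_le_1 abs_if)
    moreover have "measure_pmf.expectation (bernoulli_pmf (p i)) (\<lambda>y. ((of_bool y - p i)\<^sup>2 - p i * (1 - p i))\<^sup>2)
        = p i * (1 - p i) * (1 - 2 * p i)\<^sup>2"
      unfolding E by (simp add: power2_eq_square algebra_simps)
    ultimately show "measure_pmf.expectation (bernoulli_pmf (p i)) (\<lambda>y. ((of_bool y - p i)\<^sup>2 - p i * (1 - p i))\<^sup>2)
        \<le> p i * (1 - p i)" by simp
  qed
qed

locale logistic_design = logistic_gram n I w a G m \<eta> T
  for n :: nat and I :: "'a set" and w :: "'a \<Rightarrow> real" and a :: "'a \<Rightarrow> nat \<Rightarrow> real"
    and G :: "nat \<Rightarrow> nat \<Rightarrow> real" and m \<eta> :: "'a \<Rightarrow> real" and T :: real +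
  fixes reps :: "'a \<Rightarrow> nat" and N s :: real
  assumes N_eq: "N = (\<Sum>\<alpha>\<in>I. real (reps \<alpha>))" and N_ge_1: "1 \<le> N"
    and m_eq: "\<alpha> \<in> I \<Longrightarrow> m \<alpha> = reps \<alpha> / N"
    and T_le: "T \<le> N" and s_nonneg: "0 \<le> s"
    and spectral: "(\<Sum>k<n. (gmul n G x k)\<^sup>2) \<le> s * dot n x (gmul n G x)"
begin

definition J :: "('a \<times> nat) set" where "J = (SIGMA \<alpha>:I. {1..reps \<alpha>})"

definition D :: "'a \<times> nat \<Rightarrow> bool pmf" where "D i = bernoulli_pmf (dpsi (\<eta> (fst i)))"

definition e :: "'a \<times> nat \<Rightarrow> bool \<Rightarrow> real" where "e i y = of_bool y - dpsi (\<eta> (fst i))"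

definition u :: "'a \<times> nat \<Rightarrow> real" where "u i = d2psi (\<eta> (fst i))"

text \<open>The weight of the second-order term. It may be negative, but it is dominated by
  \<open>w\<close>, which is what the contraction estimates ask for.\<close>

definition v :: "'a \<Rightarrow> real" where "v \<alpha> = m \<alpha> * d3psi (\<eta> \<alpha>)"

definition newton :: "('a \<times> nat \<Rightarrow> bool) \<Rightarrow> nat \<Rightarrow> real" where
  "newton Y k = (\<Sum>i\<in>J. b (fst i) k / N * e i (Y i))"

definition trG :: real where "trG = (\<Sum>k<n. G k k)"

lemma finite_J: "finite J"
  unfolding J_def using fin by auto

lemma fst_J: "i \<in> J \<Longrightarrow> fst i \<in> I"
  by (auto simp: J_def)

sublocale noise: bool_noise D e u
  unfolding D_def[abs_def] e_def[abs_def] u_def[abs_def] d2psi_def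
  using bernoulli_noise(1)[of "\<lambda>i. dpsi (\<eta> (fst i))"] dpsi_gt_0 dpsi_less_1 by (simp add: less_imp_le)

sublocale sq_noise: bool_noise D "\<lambda>i y. (e i y)\<^sup>2 - u i" u
  unfolding D_def[abs_def] e_def[abs_def] u_def[abs_def] d2psi_def
  using bernoulli_noise(2)[of "\<lambda>i. dpsi (\<eta> (fst i))"] dpsi_gt_0 dpsi_less_1 by (simp add: less_imp_le)

lemma sum_J: "(\<Sum>i\<in>J. u i * f (fst i)) = N * (\<Sum>\<alpha>\<in>I. w \<alpha> * f \<alpha>)"
proof -
  have "(\<Sum>i\<in>J. u i * f (fst i)) = (\<Sum>\<alpha>\<in>I. \<Sum>t\<in>{1..reps \<alpha>}. d2psi (\<eta> \<alpha>) * f \<alpha>)"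
    unfolding J_def u_def using fin by (subst sum.Sigma) (auto simp: case_prod_beta)
  also have "\<dots> = N * (\<Sum>\<alpha>\<in>I. w \<alpha> * f \<alpha>)"
    unfolding sum_distrib_left using N_ge_1
    by (intro sum.cong refl) (simp add: w_eq m_eq)
  finally show ?thesis .
qed

lemma sum_w_le: "(\<Sum>\<alpha>\<in>I. w \<alpha>) \<le> 1"
proof -
  have "(\<Sum>\<alpha>\<in>I. w \<alpha>) \<le> (\<Sum>\<alpha>\<in>I. reps \<alpha> / N * 1)"
  proof (intro sum_mono)
    fix \<alpha> assume "\<alpha> \<in> I"
    have "d2psi (\<eta> \<alpha>) \<le> 1" using d2psi_le[of "\<eta> \<alpha>"] by linarith
    then show "w \<alpha> \<le> reps \<alpha> / N * 1"
      using N_ge_1 unfolding w_eq[OF \<open>\<alpha> \<in> I\<close>] m_eq[OF \<open>\<alpha> \<in> I\<close>]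
      by (intro mult_left_mono) auto
  qed
  also have "\<dots> = 1" using N_ge_1 by (simp add: sum_divide_distrib[symmetric] N_eq[symmetric])
  finally show ?thesis .
qed

lemma abs_v_le: "\<alpha> \<in> I \<Longrightarrow> \<bar>v \<alpha>\<bar> \<le> w \<alpha>"
  using mult_left_mono[OF abs_d3psi_le, of "m \<alpha>" "\<eta> \<alpha>"] m_pos[of \<alpha>]
  by (simp add: v_def w_eq abs_mult)

lemma b_sq_le: "k < n \<Longrightarrow> (b \<alpha> k)\<^sup>2 \<le> K \<alpha> \<alpha> * G k k"
  using dot_a_sq_le[of \<alpha> "\<lambda>j. G k j"] by (simp add: dot_a_gmul G_diag)

lemma G_pos:
  assumes "k < n"
  shows "0 < G k k"
proof -
  have "0 \<le> G k k" unfolding G_diag[OF assms] by (intro sum_nonneg mult_nonneg_nonneg w_nonneg) auto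
  moreover have "G k k \<noteq> 0"
    using coordinate_sq_le[OF assms, of "\<lambda>_. 1"] by auto
  ultimately show ?thesis by simp
qed

lemma dot_newton: "dot n (a \<alpha>) (newton Y) = (\<Sum>i\<in>J. K \<alpha> (fst i) / N * e i (Y i))"
proof -
  have "newton Y = (\<lambda>k. \<Sum>i\<in>J. (e i (Y i) / N) * b (fst i) k)"
    unfolding newton_def by (simp add: mult_ac)
  then have "dot n (a \<alpha>) (newton Y) = (\<Sum>i\<in>J. (e i (Y i) / N) * K \<alpha> (fst i))"
    by (simp only: dot_sum_right dot_scale_right K_def)
  then show ?thesis by (simp add: mult_ac)
qed

text \<open>By \<open>K_diag\<close> the variance of the form is exactly
  \<open>K \<alpha> \<alpha> / N\<close>. The range condition of the Bernstein bound follows from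
  K_\<alpha>\<beta>^2 \<le> K_\<alpha>\<alpha> T and T t \<le> N.\<close>

lemma newton_dot_tail:
  assumes \<alpha>: "\<alpha> \<in> I" and t: "0 < t" "T * t \<le> N"
  shows "measure_pmf.prob (Pi_pmf J False D)
      {Y. 4 * t / N * K \<alpha> \<alpha> < (dot n (a \<alpha>) (newton Y))\<^sup>2} \<le> 2 * exp (- t)"
proof -
  have "measure_pmf.prob (Pi_pmf J False D)
      {Y. 4 * t * (K \<alpha> \<alpha> / N) < (\<Sum>i\<in>J. K \<alpha> (fst i) / N * e i (Y i))\<^sup>2} \<le> 2 * exp (- t)"
  proof (rule noise.linear_tail[OF finite_J t(1)])
    show "0 \<le> K \<alpha> \<alpha> / N" using K_nonneg N_ge_1 by simp
    show "(K \<alpha> (fst i) / N)\<^sup>2 * t \<le> K \<alpha> \<alpha> / N" if "i \<in> J" for i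
    proof -
      have "(K \<alpha> (fst i))\<^sup>2 * t \<le> K \<alpha> \<alpha> * T * t"
        using K_cauchy_schwarz[of \<alpha> "fst i"] mult_left_mono[OF K_le[OF fst_J[OF that]] K_nonneg[of \<alpha>]] t
        by (intro mult_right_mono) auto
      also have "\<dots> \<le> K \<alpha> \<alpha> * N" using mult_left_mono[OF t(2) K_nonneg[of \<alpha>]] by (simp add: mult_ac)
      finally show ?thesis using N_ge_1 by (simp add: power_divide field_simps power2_eq_square)
    qed
    have "(\<Sum>i\<in>J. u i * (K \<alpha> (fst i) / N)\<^sup>2) = N * (\<Sum>\<beta>\<in>I. w \<beta> * (K \<alpha> \<beta> / N)\<^sup>2)"
      by (rule sum_J)
    also have "\<dots> = K \<alpha> \<alpha> / N"
      using N_ge_1 by (simp add: K_diag power_divide sum_divide_distrib[symmetric] power2_eq_square)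
    finally show "(\<Sum>i\<in>J. u i * (K \<alpha> (fst i) / N)\<^sup>2) \<le> K \<alpha> \<alpha> / N" by simp
  qed
  then show ?thesis unfolding dot_newton by simp
qed

lemma newton_coord_tail:
  assumes k: "k < n" and t: "0 < t" "T * t \<le> N"
  shows "measure_pmf.prob (Pi_pmf J False D)
      {Y. 4 * t / N * G k k < (newton Y k)\<^sup>2} \<le> 2 * exp (- t)"
proof -
  have "measure_pmf.prob (Pi_pmf J False D)
      {Y. 4 * t * (G k k / N) < (\<Sum>i\<in>J. b (fst i) k / N * e i (Y i))\<^sup>2} \<le> 2 * exp (- t)"
  proof (rule noise.linear_tail[OF finite_J t(1)])
    show "0 \<le> G k k / N" using G_pos[OF k] N_ge_1 by simp
    show "(b (fst i) k / N)\<^sup>2 * t \<le> G k k / N" if "i \<in> J" for i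
    proof -
      have "(b (fst i) k)\<^sup>2 * t \<le> G k k * T * t"
        using b_sq_le[OF k, of "fst i"] mult_left_mono[OF K_le[OF fst_J[OF that]] less_imp_le[OF G_pos[OF k]]] t
        by (intro mult_right_mono) (auto simp: mult.commute)
      also have "\<dots> \<le> G k k * N"
        using mult_left_mono[OF t(2) less_imp_le[OF G_pos[OF k]]] by (simp add: mult_ac)
      finally show ?thesis using N_ge_1 by (simp add: power_divide field_simps power2_eq_square)
    qed
    have "(\<Sum>i\<in>J. u i * (b (fst i) k / N)\<^sup>2) = N * (\<Sum>\<beta>\<in>I. w \<beta> * (b \<beta> k / N)\<^sup>2)"
      by (rule sum_J)
    also have "\<dots> = G k k / N"
      using N_ge_1 by (simp add: G_diag[OF k] power_divide sum_divide_distrib[symmetric] power2_eq_square)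
    finally show "(\<Sum>i\<in>J. u i * (b (fst i) k / N)\<^sup>2) \<le> G k k / N" by simp
  qed
  then show ?thesis unfolding newton_def by simp
qed

section \<open>The fluctuation of the second-order term as a quadratic chaos\<close>

text \<open>The coefficient of the product of two residuals, belonging to the queries
  \<open>\<beta>\<close> and \<open>\<gamma>\<close>, in coordinate \<open>k\<close> of the
  second-order term.\<close>

definition chaos_coeff :: "nat \<Rightarrow> 'a \<Rightarrow> 'a \<Rightarrow> real" where
  "chaos_coeff k \<beta> \<gamma> = (\<Sum>\<alpha>\<in>I. v \<alpha> * (b \<alpha> k * K \<alpha> \<beta>) * K \<alpha> \<gamma>) / N\<^sup>2"

text \<open>The subtracted \<open>K \<alpha> \<alpha> / N\<close> is the mean of the squared form,
  so this is the centred second-order term, without its factor 1/2.\<close>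

definition fluct :: "('a \<times> nat \<Rightarrow> bool) \<Rightarrow> nat \<Rightarrow> real" where
  "fluct Y k = (\<Sum>\<alpha>\<in>I. v \<alpha> * ((dot n (a \<alpha>) (newton Y))\<^sup>2 - K \<alpha> \<alpha> / N) * b \<alpha> k)"

text \<open>After expanding the squares, the off-diagonal pairs form a decoupled chaos. The means
  \<open>u i\<close> of the diagonal squares add up, by \<open>K_diag\<close>, to precisely the
  subtracted mean.\<close>

lemma fluct_eq:
  "fluct Y k = (\<Sum>i\<in>J. \<Sum>j\<in>J - {i}. chaos_coeff k (fst i) (fst j) * e i (Y i) * e j (Y j)) +
     (\<Sum>i\<in>J. chaos_coeff k (fst i) (fst i) * ((e i (Y i))\<^sup>2 - u i))"
proof -
  let ?c = "\<lambda>i j. chaos_coeff k (fst i) (fst j)"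
  have "(\<Sum>\<alpha>\<in>I. v \<alpha> * (dot n (a \<alpha>) (newton Y))\<^sup>2 * b \<alpha> k) =
      (\<Sum>\<alpha>\<in>I. \<Sum>i\<in>J. \<Sum>j\<in>J. v \<alpha> * (b \<alpha> k * K \<alpha> (fst i)) * K \<alpha> (fst j) / N\<^sup>2 * e i (Y i) * e j (Y j))"
    unfolding dot_newton power2_eq_square sum_product sum_distrib_left sum_distrib_right
    by (intro sum.cong refl) (simp add: field_simps)
  also have "\<dots> = (\<Sum>i\<in>J. \<Sum>\<alpha>\<in>I. \<Sum>j\<in>J. v \<alpha> * (b \<alpha> k * K \<alpha> (fst i)) * K \<alpha> (fst j) / N\<^sup>2 * e i (Y i) * e j (Y j))"
    by (rule sum.swap)
  also have "\<dots> = (\<Sum>i\<in>J. \<Sum>j\<in>J. \<Sum>\<alpha>\<in>I. v \<alpha> * (b \<alpha> k * K \<alpha> (fst i)) * K \<alpha> (fst j) / N\<^sup>2 * e i (Y i) * e j (Y j))"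
    by (intro sum.cong refl sum.swap)
  also have "\<dots> = (\<Sum>i\<in>J. \<Sum>j\<in>J. ?c i j * e i (Y i) * e j (Y j))"
    by (simp add: chaos_coeff_def sum_distrib_right sum_divide_distrib)
  also have "\<dots> = (\<Sum>i\<in>J. (\<Sum>j\<in>J - {i}. ?c i j * e i (Y i) * e j (Y j)) + ?c i i * (e i (Y i))\<^sup>2)"
    using finite_J
    by (intro sum.cong refl) (simp add: sum.remove[of J] power2_eq_square mult_ac)
  finally have 1: "(\<Sum>\<alpha>\<in>I. v \<alpha> * (dot n (a \<alpha>) (newton Y))\<^sup>2 * b \<alpha> k) =
      (\<Sum>i\<in>J. (\<Sum>j\<in>J - {i}. ?c i j * e i (Y i) * e j (Y j)) + ?c i i * (e i (Y i))\<^sup>2)" .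
  have "(\<Sum>i\<in>J. u i * ?c i i) = N * (\<Sum>\<beta>\<in>I. w \<beta> * chaos_coeff k \<beta> \<beta>)"
    by (rule sum_J)
  also have "\<dots> = (\<Sum>\<beta>\<in>I. \<Sum>\<alpha>\<in>I. w \<beta> * (v \<alpha> * b \<alpha> k * (K \<alpha> \<beta>)\<^sup>2) / N)"
    using N_ge_1 by (simp add: chaos_coeff_def sum_distrib_left sum_divide_distrib power2_eq_square field_simps)
  also have "\<dots> = (\<Sum>\<alpha>\<in>I. \<Sum>\<beta>\<in>I. w \<beta> * (v \<alpha> * b \<alpha> k * (K \<alpha> \<beta>)\<^sup>2) / N)" by (rule sum.swap)
  also have "\<dots> = (\<Sum>\<alpha>\<in>I. v \<alpha> * (K \<alpha> \<alpha> / N) * b \<alpha> k)"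
    unfolding K_diag by (simp add: sum_distrib_left sum_distrib_right sum_divide_distrib mult_ac)
  finally have 2: "(\<Sum>\<alpha>\<in>I. v \<alpha> * (K \<alpha> \<alpha> / N) * b \<alpha> k) = (\<Sum>i\<in>J. u i * ?c i i)" by simp
  have "fluct Y k = (\<Sum>\<alpha>\<in>I. v \<alpha> * (dot n (a \<alpha>) (newton Y))\<^sup>2 * b \<alpha> k) -
      (\<Sum>\<alpha>\<in>I. v \<alpha> * (K \<alpha> \<alpha> / N) * b \<alpha> k)"
    unfolding fluct_def sum_subtractf[symmetric] by (simp add: algebra_simps)
  also have "\<dots> = (\<Sum>i\<in>J. (\<Sum>j\<in>J - {i}. ?c i j * e i (Y i) * e j (Y j)) + ?c i i * (e i (Y i))\<^sup>2 - u i * ?c i i)"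
    unfolding 1 2 sum_subtractf ..
  finally show ?thesis by (simp add: sum.distrib[symmetric] algebra_simps)
qed

text \<open>Entries and weighted square sums of row \<open>i\<close> of the coefficient matrix are
  at most X / N^3: entries by Cauchy-Schwarz and K \<le> T \<le> N, row sums by
  \<open>quadratic_form_le\<close>. Summed over the noise the row bounds give T G_kk / N^2, the
  order of the variance, and each single one is no larger.\<close>

lemma fluct_sixth_moment:
  assumes k: "k < n"
  shows "measure_pmf.expectation (Pi_pmf J False D) (\<lambda>Y. fluct Y k ^ 6)
    \<le> 10 ^ 18 * (T * G k k / N\<^sup>2) ^ 3"
proof -
  let ?h = "G k k" and ?A = "\<lambda>i j. chaos_coeff k (fst i) (fst j)"
  let ?E = "measure_pmf.expectation (Pi_pmf J False D)"
  have h: "0 < ?h" by (rule G_pos[OF k])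
  have N: "0 < N" using N_ge_1 by simp
  define X where "X \<beta> = (\<Sum>\<alpha>\<in>I. w \<alpha> * (b \<alpha> k * K \<alpha> \<beta>)\<^sup>2)" for \<beta>
  \<comment> \<open>The summand \<open>T * G k k\<close> makes the row bounds positive. Since the
    weights \<open>w\<close> sum to at most 1, it adds no more than \<open>T * G k k / N^2\<close>
    to the total.\<close>
  define \<xi> where "\<xi> i = (X (fst i) + T * ?h) / N ^ 3" for i :: "'a \<times> nat"
  have X0: "0 \<le> X \<beta>" for \<beta>
    unfolding X_def by (intro sum_nonneg mult_nonneg_nonneg w_nonneg) auto
  have \<xi>0: "0 < \<xi> i" for i
    unfolding \<xi>_def using X0[of "fst i"] T_pos h N by (intro divide_pos_pos add_nonneg_pos) auto
  have X_\<xi>: "X (fst i) / N ^ 3 \<le> \<xi> i" for i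
    unfolding \<xi>_def using T_pos h N by (intro divide_right_mono) auto
  have A: "(?A i j)\<^sup>2 \<le> \<xi> i" if "i \<in> J" "j \<in> J" for i j
  proof -
    have "\<bar>\<Sum>\<alpha>\<in>I. v \<alpha> * (b \<alpha> k * K \<alpha> (fst i)) * K \<alpha> (fst j)\<bar> \<le>
        (\<Sum>\<alpha>\<in>I. w \<alpha> * \<bar>b \<alpha> k * K \<alpha> (fst i)\<bar> * \<bar>K \<alpha> (fst j)\<bar>)"
      by (intro order_trans[OF sum_abs] sum_mono)
        (auto simp: abs_mult intro!: mult_right_mono abs_v_le)
    then have "(\<Sum>\<alpha>\<in>I. v \<alpha> * (b \<alpha> k * K \<alpha> (fst i)) * K \<alpha> (fst j))\<^sup>2 \<le>
        (\<Sum>\<alpha>\<in>I. w \<alpha> * \<bar>b \<alpha> k * K \<alpha> (fst i)\<bar> * \<bar>K \<alpha> (fst j)\<bar>)\<^sup>2"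
      by (simp add: abs_le_square_iff[symmetric])
    also have "\<dots> \<le> (\<Sum>\<alpha>\<in>I. w \<alpha> * \<bar>b \<alpha> k * K \<alpha> (fst i)\<bar>\<^sup>2) * (\<Sum>\<alpha>\<in>I. w \<alpha> * \<bar>K \<alpha> (fst j)\<bar>\<^sup>2)"
      by (rule weighted_cauchy_schwarz) (rule w_nonneg)
    also have "\<dots> = X (fst i) * K (fst j) (fst j)"
    proof -
      have "(\<Sum>\<alpha>\<in>I. w \<alpha> * \<bar>K \<alpha> (fst j)\<bar>\<^sup>2) = K (fst j) (fst j)"
        unfolding K_diag[of "fst j"] by (intro sum.cong refl) (metis K_sym power2_abs)
      then show ?thesis by (simp add: X_def)
    qed
    also have "\<dots> \<le> X (fst i) * N"
      using X0 K_le[OF fst_J[OF that(2)]] T_le by (intro mult_left_mono) auto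
    finally have "(\<Sum>\<alpha>\<in>I. v \<alpha> * (b \<alpha> k * K \<alpha> (fst i)) * K \<alpha> (fst j))\<^sup>2 / N ^ 4 \<le> X (fst i) * N / N ^ 4"
      using N by (intro divide_right_mono) auto
    also have "\<dots> = X (fst i) / N ^ 3" using N by (simp add: eval_nat_numeral)
    also have "\<dots> \<le> \<xi> i" by (rule X_\<xi>)
    finally show ?thesis by (simp add: chaos_coeff_def power_divide flip: power_mult)
  qed
  have A2: "(\<Sum>j\<in>J. u j * (?A i j)\<^sup>2) \<le> \<xi> i" for i
  proof -
    have "(\<Sum>j\<in>J. u j * (?A i j)\<^sup>2) = N * (\<Sum>\<beta>\<in>I. w \<beta> * (chaos_coeff k (fst i) \<beta>)\<^sup>2)"
      by (rule sum_J)
    also have "\<dots> = (\<Sum>\<beta>\<in>I. w \<beta> * (\<Sum>\<alpha>\<in>I. v \<alpha> * (b \<alpha> k * K \<alpha> (fst i)) * K \<alpha> \<beta>)\<^sup>2) / N ^ 3"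
      using N by (simp add: chaos_coeff_def power_divide sum_divide_distrib[symmetric] eval_nat_numeral)
    also have "\<dots> \<le> X (fst i) / N ^ 3"
      unfolding X_def using N by (intro divide_right_mono quadratic_form_le abs_v_le) auto
    finally show ?thesis using X_\<xi>[of i] by linarith
  qed
  have sum_b: "(\<Sum>\<alpha>\<in>I. w \<alpha> * ((b \<alpha> k)\<^sup>2 * K \<alpha> \<alpha>)) \<le> T * ?h"
    unfolding G_diag[OF k] sum_distrib_left
  proof (intro sum_mono)
    fix \<alpha> assume "\<alpha> \<in> I"
    then have "w \<alpha> * (b \<alpha> k)\<^sup>2 * K \<alpha> \<alpha> \<le> w \<alpha> * (b \<alpha> k)\<^sup>2 * T"
      by (intro mult_left_mono K_le mult_nonneg_nonneg w_nonneg) auto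
    then show "w \<alpha> * ((b \<alpha> k)\<^sup>2 * K \<alpha> \<alpha>) \<le> T * (w \<alpha> * (b \<alpha> k)\<^sup>2)" by (simp add: mult_ac)
  qed
  have X_le: "X \<beta> \<le> N * (T * ?h)" if \<beta>: "\<beta> \<in> I" for \<beta>
  proof -
    have "X \<beta> \<le> (\<Sum>\<alpha>\<in>I. w \<alpha> * ((b \<alpha> k)\<^sup>2 * (K \<alpha> \<alpha> * N)))"
      unfolding X_def power_mult_distrib
    proof (intro sum_mono mult_left_mono w_nonneg)
      fix \<alpha>
      have "K \<alpha> \<alpha> * K \<beta> \<beta> \<le> K \<alpha> \<alpha> * N"
        using K_le[OF \<beta>] T_le by (intro mult_left_mono K_nonneg) auto
      then show "(K \<alpha> \<beta>)\<^sup>2 \<le> K \<alpha> \<alpha> * N" using K_cauchy_schwarz[of \<alpha> \<beta>] by linarith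
    qed auto
    also have "\<dots> = N * (\<Sum>\<alpha>\<in>I. w \<alpha> * ((b \<alpha> k)\<^sup>2 * K \<alpha> \<alpha>))"
      by (simp add: sum_distrib_left mult_ac)
    also have "\<dots> \<le> N * (T * ?h)" using N sum_b by (intro mult_left_mono) auto
    finally show ?thesis .
  qed
  define V where "V = T * ?h / N\<^sup>2"
  have V: "0 < V" using T_pos h N by (simp add: V_def)
  have \<xi>_le: "\<xi> i \<le> 2 * V" if "i \<in> J" for i
  proof -
    have "1 * (T * ?h) \<le> N * (T * ?h)" using N_ge_1 T_pos h by (intro mult_right_mono) auto
    then have "\<xi> i \<le> (2 * (N * (T * ?h))) / N ^ 3"
      unfolding \<xi>_def using X_le[OF fst_J[OF that]] N by (intro divide_right_mono) auto
    also have "\<dots> = 2 * V" using N by (simp add: V_def eval_nat_numeral)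
    finally show ?thesis .
  qed
  have sum_\<xi>: "(\<Sum>i\<in>J. u i * \<xi> i) \<le> 2 * V"
  proof -
    have "(\<Sum>\<beta>\<in>I. w \<beta> * X \<beta>) = (\<Sum>\<beta>\<in>I. \<Sum>\<alpha>\<in>I. w \<alpha> * (b \<alpha> k)\<^sup>2 * (w \<beta> * (K \<alpha> \<beta>)\<^sup>2))"
      by (simp add: X_def sum_distrib_left power_mult_distrib mult_ac)
    also have "\<dots> = (\<Sum>\<alpha>\<in>I. \<Sum>\<beta>\<in>I. w \<alpha> * (b \<alpha> k)\<^sup>2 * (w \<beta> * (K \<alpha> \<beta>)\<^sup>2))" by (rule sum.swap)
    also have "\<dots> = (\<Sum>\<alpha>\<in>I. w \<alpha> * ((b \<alpha> k)\<^sup>2 * K \<alpha> \<alpha>))"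
      by (simp add: sum_distrib_left[symmetric] K_diag[symmetric] mult.assoc)
    finally have 1: "(\<Sum>\<beta>\<in>I. w \<beta> * X \<beta>) \<le> T * ?h" using sum_b by simp
    have 2: "(\<Sum>\<beta>\<in>I. w \<beta>) * (T * ?h) \<le> 1 * (T * ?h)"
      using sum_w_le T_pos h by (intro mult_right_mono) auto
    have "(\<Sum>i\<in>J. u i * \<xi> i) = N * (\<Sum>\<beta>\<in>I. w \<beta> * ((X \<beta> + T * ?h) / N ^ 3))"
      unfolding \<xi>_def by (rule sum_J)
    also have "\<dots> = N * (((\<Sum>\<beta>\<in>I. w \<beta> * X \<beta>) + (\<Sum>\<beta>\<in>I. w \<beta>) * (T * ?h)) / N ^ 3)"
      by (simp add: sum_divide_distrib[symmetric] distrib_left sum.distrib sum_distrib_right)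
    also have "\<dots> = ((\<Sum>\<beta>\<in>I. w \<beta> * X \<beta>) + (\<Sum>\<beta>\<in>I. w \<beta>) * (T * ?h)) / N\<^sup>2"
      using N by (simp add: power2_eq_square power3_eq_cube)
    also have "\<dots> \<le> (2 * (T * ?h)) / N\<^sup>2" using 1 2 by (intro divide_right_mono) auto
    finally show ?thesis by (simp add: V_def)
  qed
  have sum4: "2 * V + (\<Sum>i\<in>J. u i * \<xi> i) \<le> 4 * V" "0 \<le> 2 * V + (\<Sum>i\<in>J. u i * \<xi> i)"
  proof -
    have "0 \<le> (\<Sum>i\<in>J. u i * \<xi> i)"
      using \<xi>0 by (intro sum_nonneg mult_nonneg_nonneg noise.u_nonneg) (auto intro: less_imp_le)
    then show "2 * V + (\<Sum>i\<in>J. u i * \<xi> i) \<le> 4 * V" "0 \<le> 2 * V + (\<Sum>i\<in>J. u i * \<xi> i)"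
      using sum_\<xi> V by linarith+
  qed
  have cube: "(2 * V + (\<Sum>i\<in>J. u i * \<xi> i)) ^ 3 \<le> 64 * V ^ 3"
    using power_mono[OF sum4, of 3] by (simp add: power_mult_distrib)
  have sym: "?A i j = ?A j i" for i j by (simp add: chaos_coeff_def mult_ac)
  let ?Q = "\<lambda>Y. \<Sum>i\<in>J. \<Sum>j\<in>J - {i}. ?A i j * e i (Y i) * e j (Y j)"
  let ?R = "\<lambda>Y. \<Sum>i\<in>J. ?A i i * ((e i (Y i))\<^sup>2 - u i)"
  have "?E (\<lambda>Y. ?Q Y ^ 6) \<le> 10 ^ 14 * (2 * V + (\<Sum>i\<in>J. u i * \<xi> i)) ^ 3"
    using V by (intro noise.sixth_moment_chaos finite_J sym A A2 \<xi>0 \<xi>_le) auto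
  then have Q: "?E (\<lambda>Y. ?Q Y ^ 6) \<le> 10 ^ 14 * (64 * V ^ 3)"
    by (rule order_trans) (intro mult_left_mono cube, simp)
  have "?E (\<lambda>Y. ?R Y ^ 6) \<le> 10 ^ 4 * (2 * V + (\<Sum>i\<in>J. u i * \<xi> i)) ^ 3"
    using V by (intro sq_noise.sixth_moment_linear finite_J A \<xi>0 \<xi>_le) auto
  then have R: "?E (\<lambda>Y. ?R Y ^ 6) \<le> 10 ^ 4 * (64 * V ^ 3)"
    by (rule order_trans) (intro mult_left_mono cube, simp)
  have "?E (\<lambda>Y. fluct Y k ^ 6) \<le> ?E (\<lambda>Y. 32 * (?Q Y ^ 6 + ?R Y ^ 6))"
    unfolding fluct_eq by (intro integral_mono integrable_Pi_pmf_bool finite_J sixth_power_sum_le)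
  also have "\<dots> = 32 * (?E (\<lambda>Y. ?Q Y ^ 6) + ?E (\<lambda>Y. ?R Y ^ 6))"
    by (simp add: finite_J)
  also have "\<dots> \<le> 32 * (10 ^ 14 * (64 * V ^ 3) + 10 ^ 4 * (64 * V ^ 3))"
    using Q R by (intro mult_left_mono add_mono) auto
  also have "\<dots> = (32 * 64 * (10 ^ 14 + 10 ^ 4)) * V ^ 3" by simp
  also have "\<dots> \<le> 10 ^ 18 * V ^ 3" using V by (intro mult_right_mono) auto
  finally show ?thesis by (simp add: V_def)
qed

lemma trG_pos: "0 < trG"
  unfolding trG_def using n_pos G_pos by (intro sum_pos) auto

text \<open>Markov's inequality for the cube of the squared norm. Jensen with weights
  \<open>G k k\<close> matches the size of the coordinates, so the moment bounds combine to the cube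
  of the trace without a further power of \<open>n\<close>.\<close>

lemma fluct_tail:
  assumes y: "0 < y"
  shows "measure_pmf.prob (Pi_pmf J False D) {Y. trG * y < (\<Sum>k<n. (fluct Y k)\<^sup>2)}
    \<le> 10 ^ 18 * (T / (N\<^sup>2 * y)) ^ 3"
proof -
  let ?M = "Pi_pmf J False D"
  let ?S = "\<lambda>Y. \<Sum>k<n. (fluct Y k)\<^sup>2"
  have N: "0 < N" using N_ge_1 by simp
  have p: "0 < trG * y" using trG_pos y by simp
  have cube: "?S Y ^ 3 \<le> trG\<^sup>2 * (\<Sum>k<n. fluct Y k ^ 6 / (G k k)\<^sup>2)" for Y
  proof -
    have 1: "?S Y = (\<Sum>k<n. G k k * ((fluct Y k)\<^sup>2 / G k k))"
    proof (intro sum.cong refl)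
      fix k assume "k \<in> {..<n}"
      then have "G k k \<noteq> 0" using G_pos[of k] by auto
      then show "(fluct Y k)\<^sup>2 = G k k * ((fluct Y k)\<^sup>2 / G k k)" by simp
    qed
    have 2: "(\<Sum>k<n. G k k * ((fluct Y k)\<^sup>2 / G k k)) ^ 3 \<le>
        (\<Sum>k<n. G k k)\<^sup>2 * (\<Sum>k<n. G k k * ((fluct Y k)\<^sup>2 / G k k) ^ 3)"
    proof (rule cube_weighted_mean_le)
      fix k assume "k \<in> {..<n}"
      then show "0 < G k k" using G_pos by simp
      then show "0 \<le> (fluct Y k)\<^sup>2 / G k k" by simp
    qed simp
    have 3: "(\<Sum>k<n. G k k * ((fluct Y k)\<^sup>2 / G k k) ^ 3) = (\<Sum>k<n. fluct Y k ^ 6 / (G k k)\<^sup>2)"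
    proof (intro sum.cong refl)
      fix k assume "k \<in> {..<n}"
      then have "G k k \<noteq> 0" using G_pos[of k] by auto
      moreover have "((fluct Y k)\<^sup>2) ^ 3 = fluct Y k ^ 6" by simp
      ultimately show "G k k * ((fluct Y k)\<^sup>2 / G k k) ^ 3 = fluct Y k ^ 6 / (G k k)\<^sup>2"
        unfolding power_divide by (simp add: power2_eq_square power3_eq_cube)
    qed
    show ?thesis using 2 unfolding 3 1[symmetric] trG_def[symmetric] .
  qed
  have "measure_pmf.prob ?M {Y. trG * y < ?S Y} =
      measure_pmf.expectation ?M (indicator {Y. trG * y < ?S Y})" by simp
  also have "\<dots> \<le> measure_pmf.expectation ?M
      (\<lambda>Y. (\<Sum>k<n. fluct Y k ^ 6 / (G k k)\<^sup>2) * (trG\<^sup>2 / (trG * y) ^ 3))"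
  proof (intro integral_mono integrable_Pi_pmf_bool finite_J)
    fix Y
    have "indicator {Y. trG * y < ?S Y} Y \<le> (?S Y / (trG * y)) ^ 3"
      using p by (auto simp: indicator_def sum_nonneg intro!: one_le_power)
    also have "\<dots> = ?S Y ^ 3 / (trG * y) ^ 3" by (rule power_divide)
    also have "\<dots> \<le> trG\<^sup>2 * (\<Sum>k<n. fluct Y k ^ 6 / (G k k)\<^sup>2) / (trG * y) ^ 3"
      using cube p by (intro divide_right_mono) auto
    finally show "indicator {Y. trG * y < ?S Y} Y \<le>
        (\<Sum>k<n. fluct Y k ^ 6 / (G k k)\<^sup>2) * (trG\<^sup>2 / (trG * y) ^ 3)" by (simp add: mult_ac)
  qed
  also have "\<dots> = (\<Sum>k<n. measure_pmf.expectation ?M (\<lambda>Y. fluct Y k ^ 6) / (G k k)\<^sup>2) *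
      (trG\<^sup>2 / (trG * y) ^ 3)"
    by (simp add: finite_J)
  also have "\<dots> \<le> (\<Sum>k<n. 10 ^ 18 * (T / N\<^sup>2) ^ 3 * G k k) * (trG\<^sup>2 / (trG * y) ^ 3)"
  proof (intro mult_right_mono sum_mono)
    fix k assume "k \<in> {..<n}"
    then have k: "k < n" by simp
    have "measure_pmf.expectation ?M (\<lambda>Y. fluct Y k ^ 6) / (G k k)\<^sup>2 \<le>
        10 ^ 18 * (T * G k k / N\<^sup>2) ^ 3 / (G k k)\<^sup>2"
      by (intro divide_right_mono fluct_sixth_moment k) auto
    also have "\<dots> = 10 ^ 18 * (T / N\<^sup>2) ^ 3 * G k k"
      using G_pos[OF k] by (simp add: power_divide power_mult_distrib power2_eq_square power3_eq_cube)
    finally show "measure_pmf.expectation ?M (\<lambda>Y. fluct Y k ^ 6) / (G k k)\<^sup>2 \<le>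
        10 ^ 18 * (T / N\<^sup>2) ^ 3 * G k k" .
  qed (use p in simp)
  also have "\<dots> = 10 ^ 18 * (T / N\<^sup>2) ^ 3 * (trG * trG\<^sup>2 / (trG * y) ^ 3)"
    unfolding sum_distrib_left[symmetric] trG_def by simp
  also have "trG * trG\<^sup>2 / (trG * y) ^ 3 = 1 / y ^ 3"
    using trG_pos by (simp add: power_mult_distrib power2_eq_square power3_eq_cube)
  also have "10 ^ 18 * (T / N\<^sup>2) ^ 3 * (1 / y ^ 3) = 10 ^ 18 * (T / (N\<^sup>2 * y)) ^ 3"
    by (simp add: power_divide power_mult_distrib)
  finally show ?thesis .
qed

text \<open>Three bad events with separate levels: \<open>t1\<close> for the union over queries, of
  size log d, \<open>t2\<close> for the union over coordinates, of size log d_theta, and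
  \<open>y\<close> for the fluctuation. Outside them the error splits into Newton step, fluctuation,
  mean and remainder, whose squares are added with a factor 4.\<close>

theorem minimizer_error_tail:
  fixes t1 t2 y \<theta> :: real
  assumes t1: "0 < t1" "T * t1 \<le> N" and t2: "0 < t2" "T * t2 \<le> N" and y: "0 < y"
    and small: "(4 * t1 / N * T)\<^sup>2 * n \<le> 1 / 360 ^ 2"
  defines "\<theta> \<equiv> 4 * t1 / N * T"
  shows "measure_pmf.prob (Pi_pmf J False D)
    {Y. \<not> (\<exists>x. (\<forall>z k. k < n \<longrightarrow> x k \<noteq> z k \<longrightarrow> obj (newton Y) x < obj (newton Y) z) \<and>
      (\<Sum>k<n. (x k)\<^sup>2) \<le> 4 * (4 * t2 / N * trG + trG * y / 4 + s * (T * n / N\<^sup>2) / 4 +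
        s * (\<theta> * (4 * t1 / N * n) * (232000 * (\<theta>\<^sup>2 * n) + 1744 * \<theta>))))}
    \<le> card I * (2 * exp (- t1)) + n * (2 * exp (- t2)) + 10 ^ 18 * (T / (N\<^sup>2 * y)) ^ 3"
    (is "measure_pmf.prob ?M {Y. \<not> ?good Y} \<le> _")
proof -
  let ?B1 = "\<lambda>\<alpha>. {Y. 4 * t1 / N * K \<alpha> \<alpha> < (dot n (a \<alpha>) (newton Y))\<^sup>2}"
  let ?B2 = "\<lambda>k. {Y. 4 * t2 / N * G k k < (newton Y k)\<^sup>2}"
  let ?B3 = "{Y. trG * y < (\<Sum>k<n. (fluct Y k)\<^sup>2)}"
  have N: "0 < N" using N_ge_1 by simp
  have "?good Y" if Y: "Y \<notin> (\<Union>\<alpha>\<in>I. ?B1 \<alpha>) \<union> (\<Union>k\<in>{..<n}. ?B2 k) \<union> ?B3" for Y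
  proof -
    have D1: "(dot n (a \<alpha>) (newton Y))\<^sup>2 \<le> 4 * t1 / N * K \<alpha> \<alpha>" if "\<alpha> \<in> I" for \<alpha>
      using Y that by (auto simp: not_less)
    have \<omega>: "0 < 4 * t1 / N" using t1 N by simp
    obtain x z where min: "\<And>z k. k < n \<Longrightarrow> x k \<noteq> z k \<Longrightarrow> obj (newton Y) x < obj (newton Y) z"
      and x: "\<And>k. k < n \<Longrightarrow> x k = newton Y k -
        (\<Sum>\<alpha>\<in>I. m \<alpha> * d3psi (\<eta> \<alpha>) * (dot n (a \<alpha>) (newton Y))\<^sup>2 * b \<alpha> k) / 2 - (\<Sum>\<alpha>\<in>I. w \<alpha> * z \<alpha> * b \<alpha> k)"
      and z: "(\<Sum>\<alpha>\<in>I. w \<alpha> * (z \<alpha>)\<^sup>2) \<le> 4 * t1 / N * T * (4 * t1 / N * n) *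
        (232000 * ((4 * t1 / N * T)\<^sup>2 * n) + 1744 * (4 * t1 / N * T))"
      using strict_minimizer_expansion[OF D1 \<omega> small] by blast
    let ?mean = "\<lambda>k. \<Sum>\<alpha>\<in>I. v \<alpha> * (K \<alpha> \<alpha> / N) * b \<alpha> k" and ?z = "\<lambda>k. \<Sum>\<alpha>\<in>I. w \<alpha> * z \<alpha> * b \<alpha> k"
    have x': "(x k)\<^sup>2 \<le> 4 * ((newton Y k)\<^sup>2 + (fluct Y k)\<^sup>2 / 4 + (?mean k)\<^sup>2 / 4 + (?z k)\<^sup>2)" if "k < n" for k
    proof -
      have "(\<Sum>\<alpha>\<in>I. m \<alpha> * d3psi (\<eta> \<alpha>) * (dot n (a \<alpha>) (newton Y))\<^sup>2 * b \<alpha> k) = fluct Y k + ?mean k"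
        unfolding fluct_def v_def sum.distrib[symmetric] by (intro sum.cong refl) (simp add: algebra_simps)
      then have "x k = newton Y k + - fluct Y k / 2 + - ?mean k / 2 + - ?z k"
        using x[OF that] by (simp add: field_simps)
      then show ?thesis
        using square_sum4_le[of "newton Y k" "- fluct Y k / 2" "- ?mean k / 2" "- ?z k"]
        by (simp add: power_divide)
    qed
    have 1: "(\<Sum>k<n. (newton Y k)\<^sup>2) \<le> 4 * t2 / N * trG"
      unfolding trG_def sum_distrib_left using Y by (intro sum_mono) (auto simp: not_less)
    have 2: "(\<Sum>k<n. (fluct Y k)\<^sup>2) \<le> trG * y" using Y by (auto simp: not_less)
    \<comment> \<open>The mean has coefficients \<open>K \<alpha> \<alpha> / N\<close>; one factor K
      is bounded by \<open>T\<close>, the other summed to \<open>n\<close> by the trace identity. No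
      logarithm appears.\<close>
    have 3: "(\<Sum>k<n. (?mean k)\<^sup>2) \<le> s * (T * n / N\<^sup>2)"
    proof -
      have "(\<Sum>k<n. (?mean k)\<^sup>2) \<le> s * (\<Sum>\<alpha>\<in>I. w \<alpha> * (K \<alpha> \<alpha> / N)\<^sup>2)"
        by (rule combination_norm_le[OF spectral s_nonneg abs_v_le])
      also have "(\<Sum>\<alpha>\<in>I. w \<alpha> * (K \<alpha> \<alpha> / N)\<^sup>2) = (\<Sum>\<alpha>\<in>I. w \<alpha> * K \<alpha> \<alpha> ^ Suc 1) / N\<^sup>2"
        by (simp add: power_divide sum_divide_distrib power2_eq_square)
      also have "(\<Sum>\<alpha>\<in>I. w \<alpha> * K \<alpha> \<alpha> ^ Suc 1) \<le> (1 * T) ^ 1 * (\<Sum>\<alpha>\<in>I. w \<alpha> * K \<alpha> \<alpha>)"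
        by (rule sum_w_pow_le) (auto simp: K_nonneg)
      finally show ?thesis using s_nonneg by (simp add: sum_K_diag divide_right_mono mult_left_mono)
    qed
    have 4: "(\<Sum>k<n. (?z k)\<^sup>2) \<le>
        s * (\<theta> * (4 * t1 / N * n) * (232000 * (\<theta>\<^sup>2 * n) + 1744 * \<theta>))"
    proof -
      have "(\<Sum>k<n. (?z k)\<^sup>2) \<le> s * (\<Sum>\<alpha>\<in>I. w \<alpha> * (z \<alpha>)\<^sup>2)"
        by (rule combination_norm_le[OF spectral s_nonneg]) (simp add: w_nonneg)
      then show ?thesis using mult_left_mono[OF z s_nonneg] unfolding \<theta>_def by linarith
    qed
    have "(\<Sum>k<n. (x k)\<^sup>2) \<le>
        (\<Sum>k<n. 4 * ((newton Y k)\<^sup>2 + (fluct Y k)\<^sup>2 / 4 + (?mean k)\<^sup>2 / 4 + (?z k)\<^sup>2))"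
      using x' by (intro sum_mono) auto
    also have "\<dots> = 4 * ((\<Sum>k<n. (newton Y k)\<^sup>2) + (\<Sum>k<n. (fluct Y k)\<^sup>2) / 4 +
        (\<Sum>k<n. (?mean k)\<^sup>2) / 4 + (\<Sum>k<n. (?z k)\<^sup>2))"
      by (simp only: sum.distrib sum_distrib_left[symmetric] sum_divide_distrib[symmetric])
    also have "\<dots> \<le> 4 * (4 * t2 / N * trG + trG * y / 4 + s * (T * n / N\<^sup>2) / 4 +
        s * (\<theta> * (4 * t1 / N * n) * (232000 * (\<theta>\<^sup>2 * n) + 1744 * \<theta>)))"
      using 1 2 3 4 by (intro mult_left_mono add_mono divide_right_mono) auto
    finally show ?thesis using min by blast
  qed
  then have sub: "{Y. \<not> ?good Y} \<subseteq> (\<Union>\<alpha>\<in>I. ?B1 \<alpha>) \<union> (\<Union>k\<in>{..<n}. ?B2 k) \<union> ?B3" by blast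
  have "measure_pmf.prob ?M {Y. \<not> ?good Y} \<le>
      measure_pmf.prob ?M ((\<Union>\<alpha>\<in>I. ?B1 \<alpha>) \<union> (\<Union>k\<in>{..<n}. ?B2 k) \<union> ?B3)"
    by (rule measure_pmf.finite_measure_mono[OF sub]) simp
  also have "\<dots> \<le> measure_pmf.prob ?M (\<Union>\<alpha>\<in>I. ?B1 \<alpha>) + measure_pmf.prob ?M (\<Union>k\<in>{..<n}. ?B2 k) +
      measure_pmf.prob ?M ?B3"
    by (intro order_trans[OF measure_Un_le] add_right_mono measure_Un_le) auto
  also have "\<dots> \<le> card I * (2 * exp (- t1)) + n * (2 * exp (- t2)) + 10 ^ 18 * (T / (N\<^sup>2 * y)) ^ 3"
  proof (intro add_mono fluct_tail y)
    have "measure_pmf.prob ?M (\<Union>\<alpha>\<in>I. ?B1 \<alpha>) \<le> (\<Sum>\<alpha>\<in>I. measure_pmf.prob ?M (?B1 \<alpha>))"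
      using fin by (intro measure_UNION_le) auto
    also have "\<dots> \<le> (\<Sum>\<alpha>\<in>I. 2 * exp (- t1))" by (intro sum_mono newton_dot_tail t1)
    finally show "measure_pmf.prob ?M (\<Union>\<alpha>\<in>I. ?B1 \<alpha>) \<le> card I * (2 * exp (- t1))" by simp
    have "measure_pmf.prob ?M (\<Union>k\<in>{..<n}. ?B2 k) \<le> (\<Sum>k<n. measure_pmf.prob ?M (?B2 k))"
      by (intro measure_UNION_le) auto
    also have "\<dots> \<le> (\<Sum>k<n. 2 * exp (- t2))" by (intro sum_mono newton_coord_tail t2) auto
    finally show "measure_pmf.prob ?M (\<Union>k\<in>{..<n}. ?B2 k) \<le> n * (2 * exp (- t2))" by simp
  qed
  finally show ?thesis .
qed

end

section \<open>Matrices\<close>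

lemma scalar_prod_eq_dot:
  assumes "y \<in> carrier_vec n"
  shows "x \<bullet> y = dot n (vec_index x) (vec_index y)"
  using assms by (simp add: scalar_prod_def dot_def atLeast0LessThan)

lemma pos_def_inverse:
  assumes M: "pos_def M" "M \<in> carrier_mat n n"
  shows "mat_inv M \<in> carrier_mat n n" "M * mat_inv M = 1\<^sub>m n" "mat_inv M * M = 1\<^sub>m n"
    "transpose_mat (mat_inv M) = mat_inv M"
proof -
  have "det M \<noteq> 0"
  proof
    assume "det M = 0"
    then obtain x where x: "x \<in> carrier_vec n" "x \<noteq> 0\<^sub>v n" "M *\<^sub>v x = 0\<^sub>v n"
      using det_0_iff_vec_prod_zero_field[OF M(2)] by blast
    have "0 < x \<bullet> (M *\<^sub>v x)" using M x(1,2) unfolding pos_def_def by auto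
    then show False using x by simp
  qed
  then have "M \<in> Units (ring_mat TYPE(real) n ())" by (rule det_non_zero_imp_unit[OF M(2)])
  then obtain X where X: "mat_inverse M = Some X"
    using mat_inverse(1)[OF M(2), where b = "()"] by (cases "mat_inverse M") auto
  have inv: "mat_inv M = X" by (simp add: mat_inv_def X)
  note * = mat_inverse(2)[OF M(2) X]
  then show 1: "mat_inv M \<in> carrier_mat n n" "M * mat_inv M = 1\<^sub>m n" "mat_inv M * M = 1\<^sub>m n"
    unfolding inv by auto
  have M_sym: "transpose_mat M = M" using M by (simp add: pos_def_def)
  have "transpose_mat (M * X) = transpose_mat X * transpose_mat M"
    using * M(2) by (intro transpose_mult) auto
  then have "transpose_mat X * M = transpose_mat (M * X)" unfolding M_sym ..
  moreover have "M * X = 1\<^sub>m n" using * by simp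
  ultimately have XM: "transpose_mat X * M = 1\<^sub>m n" by (simp only: transpose_one)
  have XT: "transpose_mat X \<in> carrier_mat n n" using * by auto
  have "transpose_mat X = transpose_mat X * (M * X)" using * right_mult_one_mat[OF XT] by simp
  also have "\<dots> = transpose_mat X * M * X"
    using * M(2) by (intro assoc_mult_mat[symmetric]) auto
  also have "\<dots> = X" unfolding XM using * by (intro left_mult_one_mat) auto
  finally show "transpose_mat (mat_inv M) = mat_inv M" unfolding inv .
qed

text \<open>The common shape of the design matrix and the Hessian, so that inverses of both are
  treated by the same locale.\<close>

definition weighted_gram :: "nat \<Rightarrow> 'a set \<Rightarrow> ('a \<Rightarrow> real) \<Rightarrow> ('a \<Rightarrow> nat \<Rightarrow> real) \<Rightarrow> real mat" where
  "weighted_gram n I c f = mat n n (\<lambda>(k, j). \<Sum>\<alpha>\<in>I. c \<alpha> * (f \<alpha> k * f \<alpha> j))"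

lemma weighted_gram_carrier [simp]: "weighted_gram n I c f \<in> carrier_mat n n"
  by (simp add: weighted_gram_def)

lemma weighted_gram_mult_index:
  assumes "x \<in> carrier_vec n" "k < n"
  shows "(weighted_gram n I c f *\<^sub>v x) $ k = (\<Sum>\<alpha>\<in>I. c \<alpha> * dot n (f \<alpha>) (vec_index x) * f \<alpha> k)"
proof -
  have "(weighted_gram n I c f *\<^sub>v x) $ k = (\<Sum>j<n. (\<Sum>\<alpha>\<in>I. c \<alpha> * (f \<alpha> k * f \<alpha> j)) * x $ j)"
    using assms by (simp add: weighted_gram_def scalar_prod_def atLeast0LessThan)
  also have "\<dots> = (\<Sum>\<alpha>\<in>I. \<Sum>j<n. c \<alpha> * (f \<alpha> k * f \<alpha> j) * x $ j)"
    unfolding sum_distrib_right by (rule sum.swap)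
  also have "\<dots> = (\<Sum>\<alpha>\<in>I. c \<alpha> * dot n (f \<alpha>) (vec_index x) * f \<alpha> k)"
    by (simp add: dot_def sum_distrib_left sum_distrib_right mult_ac)
  finally show ?thesis .
qed

lemma weighted_gram_quadratic:
  assumes "x \<in> carrier_vec n"
  shows "x \<bullet> (weighted_gram n I c f *\<^sub>v x) = (\<Sum>\<alpha>\<in>I. c \<alpha> * (dot n (f \<alpha>) (vec_index x))\<^sup>2)"
proof -
  have "dim_row (weighted_gram n I c f) = n" by (simp add: weighted_gram_def)
  then have "x \<bullet> (weighted_gram n I c f *\<^sub>v x) = (\<Sum>k<n. x $ k * (weighted_gram n I c f *\<^sub>v x) $ k)"
    by (simp add: scalar_prod_def atLeast0LessThan del: index_mult_mat_vec)
  also have "\<dots> = (\<Sum>k<n. x $ k * (\<Sum>\<alpha>\<in>I. c \<alpha> * dot n (f \<alpha>) (vec_index x) * f \<alpha> k))"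
    by (intro sum.cong refl) (simp only: weighted_gram_mult_index[OF assms] lessThan_iff)
  also have "\<dots> = (\<Sum>\<alpha>\<in>I. \<Sum>k<n. x $ k * (c \<alpha> * dot n (f \<alpha>) (vec_index x) * f \<alpha> k))"
    unfolding sum_distrib_left by (rule sum.swap)
  also have "\<dots> = (\<Sum>\<alpha>\<in>I. c \<alpha> * dot n (f \<alpha>) (vec_index x) * dot n (f \<alpha>) (vec_index x))"
  proof (intro sum.cong refl)
    fix \<alpha>
    have "(\<Sum>k<n. x $ k * (c' * f \<alpha> k)) = c' * dot n (f \<alpha>) (vec_index x)" for c' :: real
      by (simp add: dot_def sum_distrib_left mult_ac)
    then show "(\<Sum>k<n. x $ k * (c \<alpha> * dot n (f \<alpha>) (vec_index x) * f \<alpha> k)) =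
      c \<alpha> * dot n (f \<alpha>) (vec_index x) * dot n (f \<alpha>) (vec_index x)" .
  qed
  finally show ?thesis by (simp add: power2_eq_square mult_ac)
qed

lemma mult_mat_vec_gmul:
  assumes "X \<in> carrier_mat n n" "k < n" "x \<in> carrier_vec n"
  shows "(X *\<^sub>v x) $ k = gmul n (\<lambda>i j. X $$ (i, j)) (vec_index x) k"
  using assms by (simp add: gmul_def scalar_prod_def atLeast0LessThan)

text \<open>Only the left inverse identity, applied to an arbitrary vector and written out over the
  queries, is behind \<open>repro\<close>; symmetry comes from the symmetry of the inverse.\<close>

lemma gram_of_inverse:
  assumes fin: "finite I" and c: "\<And>\<alpha>. \<alpha> \<in> I \<Longrightarrow> 0 \<le> c \<alpha>"
    and pd: "pos_def (weighted_gram n I c f)"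
  shows "gram n I c f (\<lambda>i j. mat_inv (weighted_gram n I c f) $$ (i, j))"
proof
  let ?M = "weighted_gram n I c f"
  let ?X = "mat_inv ?M"
  note X = pos_def_inverse[OF pd weighted_gram_carrier]
  show "finite I" by (rule fin)
  show "0 \<le> c \<alpha>" if "\<alpha> \<in> I" for \<alpha> using that by (rule c)
  show "?X $$ (i, j) = ?X $$ (j, i)" if "i < n" "j < n" for i j
    using X(1,4) that by (metis carrier_matD index_transpose_mat(1))
  show "x i = (\<Sum>\<alpha>\<in>I. c \<alpha> * dot n (f \<alpha>) x * gmul n (\<lambda>i j. ?X $$ (i, j)) (f \<alpha>) i)"
    if i: "i < n" for x i
  proof -
    have cv: "vec n x \<in> carrier_vec n" by simp
    have d: "dot n (f \<alpha>) (vec_index (vec n x)) = dot n (f \<alpha>) x" for \<alpha> by (simp add: dot_def)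
    have "vec n x = (?X * ?M) *\<^sub>v vec n x" unfolding X(3) by simp
    also have "\<dots> = ?X *\<^sub>v (?M *\<^sub>v vec n x)"
      by (rule assoc_mult_mat_vec[OF X(1) weighted_gram_carrier cv])
    finally have "x i = (?X *\<^sub>v (?M *\<^sub>v vec n x)) $ i" using i by (metis index_vec)
    also have "\<dots> = (\<Sum>j<n. ?X $$ (i, j) * (?M *\<^sub>v vec n x) $ j)"
      using mult_mat_vec_gmul[OF X(1) i, of "?M *\<^sub>v vec n x"]
      by (simp add: gmul_def mult_mat_vec_carrier[OF weighted_gram_carrier cv])
    also have "\<dots> = (\<Sum>j<n. \<Sum>\<alpha>\<in>I. c \<alpha> * dot n (f \<alpha>) x * (?X $$ (i, j) * f \<alpha> j))"
    proof (intro sum.cong refl)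
      fix j assume "j \<in> {..<n}"
      then show "?X $$ (i, j) * (?M *\<^sub>v vec n x) $ j =
          (\<Sum>\<alpha>\<in>I. c \<alpha> * dot n (f \<alpha>) x * (?X $$ (i, j) * f \<alpha> j))"
        using weighted_gram_mult_index[OF cv, of j I c f] unfolding d
        by (simp add: sum_distrib_left mult_ac)
    qed
    also have "\<dots> = (\<Sum>\<alpha>\<in>I. \<Sum>j<n. c \<alpha> * dot n (f \<alpha>) x * (?X $$ (i, j) * f \<alpha> j))" by (rule sum.swap)
    finally show ?thesis by (simp add: gmul_def sum_distrib_left)
  qed
qed

lemma l2norm_eq: "x \<in> carrier_vec n \<Longrightarrow> l2norm x = sqrt (\<Sum>k<n. (x $ k)\<^sup>2)"
  by (simp add: l2norm_def scalar_prod_def atLeast0LessThan power2_eq_square)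

lemma spectral_norm_bound:
  assumes X: "X \<in> carrier_mat n n"
  shows "0 \<le> spectral_norm X"
    and "(\<Sum>k<n. (gmul n (\<lambda>i j. X $$ (i, j)) x k)\<^sup>2) \<le> (spectral_norm X)\<^sup>2 * (\<Sum>k<n. (x k)\<^sup>2)"
proof -
  let ?A = "{l2norm (X *\<^sub>v x) | x. x \<in> carrier_vec n \<and> l2norm x \<le> 1}"
  let ?G = "\<lambda>i j. X $$ (i, j)"
  have sn: "spectral_norm X = Sup ?A" using X by (simp add: spectral_norm_def)
  have nrm: "l2norm (X *\<^sub>v x) = sqrt (\<Sum>k<n. (gmul n ?G (vec_index x) k)\<^sup>2)" if "x \<in> carrier_vec n" for x
    using that X by (simp add: l2norm_eq[of _ n] mult_mat_vec_gmul del: index_mult_mat_vec)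
  \<comment> \<open>The supremum gives upper bounds only once the set is bounded; on the unit ball
    every coordinate is at most 1, so row sums of absolute entries suffice.\<close>
  have bdd: "bdd_above ?A"
  proof (rule bdd_aboveI)
    fix r assume "r \<in> ?A"
    then obtain x where x: "r = l2norm (X *\<^sub>v x)" "x \<in> carrier_vec n" "l2norm x \<le> 1" by blast
    have xj: "\<bar>x $ j\<bar> \<le> 1" if "j < n" for j
    proof -
      have "(x $ j)\<^sup>2 \<le> (\<Sum>k<n. (x $ k)\<^sup>2)" using that by (intro member_le_sum) auto
      also have "\<dots> \<le> 1" using x(3) by (simp add: l2norm_eq[OF x(2)])
      finally show ?thesis by (simp add: abs_square_le_1)
    qed
    have "\<bar>gmul n ?G (vec_index x) k\<bar> \<le> (\<Sum>j<n. \<bar>X $$ (k, j)\<bar>)" for k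
      unfolding gmul_def using xj
      by (intro order_trans[OF sum_abs] sum_mono) (auto simp: abs_mult intro: mult_left_le)
    then have "(gmul n ?G (vec_index x) k)\<^sup>2 \<le> (\<Sum>j<n. \<bar>X $$ (k, j)\<bar>)\<^sup>2" for k
      by (simp add: abs_le_square_iff[symmetric] order_trans[OF _ abs_ge_self])
    then show "r \<le> sqrt (\<Sum>k<n. (\<Sum>j<n. \<bar>X $$ (k, j)\<bar>)\<^sup>2)"
      unfolding x(1) nrm[OF x(2)] by (intro real_sqrt_le_mono sum_mono)
  qed
  have "l2norm (X *\<^sub>v 0\<^sub>v n) \<in> ?A" by (auto intro!: exI[of _ "0\<^sub>v n"] simp: l2norm_eq[of _ n])
  then have "l2norm (X *\<^sub>v 0\<^sub>v n) \<le> spectral_norm X" unfolding sn by (rule cSup_upper[OF _ bdd])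
  moreover have "0 \<le> l2norm (X *\<^sub>v 0\<^sub>v n)" by (simp add: nrm sum_nonneg)
  ultimately show s0: "0 \<le> spectral_norm X" by linarith
  define r where "r = sqrt (\<Sum>k<n. (x k)\<^sup>2)"
  have r0: "0 \<le> r" "r\<^sup>2 = (\<Sum>k<n. (x k)\<^sup>2)" by (auto simp: r_def sum_nonneg)
  show "(\<Sum>k<n. (gmul n ?G x k)\<^sup>2) \<le> (spectral_norm X)\<^sup>2 * (\<Sum>k<n. (x k)\<^sup>2)"
  proof (cases "r = 0")
    case True
    then have "\<forall>k<n. x k = 0" using r0(2) by (simp add: sum_nonneg_eq_0_iff)
    then show ?thesis by (simp add: gmul_def)
  next
    case False
    then have r: "0 < r" using r0 by simp
    define xv where "xv = vec n (\<lambda>k. x k / r)"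
    have xv: "xv \<in> carrier_vec n" by (simp add: xv_def)
    have "(\<Sum>k<n. (x k / r)\<^sup>2) = 1"
      using r by (simp add: power_divide sum_divide_distrib[symmetric] r0(2)[symmetric])
    then have "l2norm xv \<le> 1" unfolding l2norm_eq[OF xv] by (simp add: xv_def)
    then have "l2norm (X *\<^sub>v xv) \<in> ?A" using xv by blast
    then have le: "l2norm (X *\<^sub>v xv) \<le> spectral_norm X" unfolding sn by (rule cSup_upper[OF _ bdd])
    have "(l2norm (X *\<^sub>v xv))\<^sup>2 = (\<Sum>k<n. (gmul n ?G (vec_index xv) k)\<^sup>2)"
      by (simp add: nrm[OF xv] sum_nonneg)
    also have "\<dots> = (\<Sum>k<n. (gmul n ?G x k)\<^sup>2) / r\<^sup>2"
    proof -
      have "gmul n ?G (vec_index xv) k = gmul n ?G x k / r" for k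
        by (simp add: gmul_def xv_def sum_divide_distrib)
      then show ?thesis by (simp add: power_divide sum_divide_distrib)
    qed
    finally have "(\<Sum>k<n. (gmul n ?G x k)\<^sup>2) / r\<^sup>2 \<le> (spectral_norm X)\<^sup>2"
      using power_mono[OF le, of 2] by (simp add: nrm[OF xv] sum_nonneg)
    then show ?thesis using r by (simp add: r0(2)[symmetric] field_simps)
  qed
qed

text \<open>Without a spectral decomposition: with y = G x and A = |y|^2, Cauchy-Schwarz in the form
  of \<open>G\<close> gives A^2 \<le> (y^T G y) (x^T G x), and the norm bound gives y^T G y \<le> s
  A. One factor A cancels.\<close>

lemma (in gram) gmul_norm_le_quadratic:
  assumes s: "0 \<le> s" "\<And>x. (\<Sum>k<n. (gmul n G x k)\<^sup>2) \<le> s\<^sup>2 * (\<Sum>k<n. (x k)\<^sup>2)"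
  shows "(\<Sum>k<n. (gmul n G x k)\<^sup>2) \<le> s * dot n x (gmul n G x)"
proof -
  let ?g = "gmul n G"
  have quad: "dot n y (?g z) = (\<Sum>\<alpha>\<in>I. w \<alpha> * dot n (a \<alpha>) (?g y) * dot n (a \<alpha>) (?g z))" for y z
  proof -
    have "dot n y (b \<alpha>) = dot n (a \<alpha>) (?g y)" for \<alpha>
      unfolding b_def dot_gmul[of y] by (rule dot_commute)
    then show ?thesis using dot_repro[of y "?g z"] by (simp add: mult_ac)
  qed
  have self: "dot n y (?g y) = (\<Sum>\<alpha>\<in>I. w \<alpha> * (dot n (a \<alpha>) (?g y))\<^sup>2)" for y
    by (subst quad) (simp add: power2_eq_square mult_ac)
  have pos: "0 \<le> dot n y (?g y)" for y
    unfolding self by (intro sum_nonneg mult_nonneg_nonneg w_nonneg) auto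
  define y where "y = ?g x"
  define A where "A = (\<Sum>k<n. (y k)\<^sup>2)"
  have A0: "0 \<le> A" by (simp add: A_def sum_nonneg)
  have A: "A = dot n y (?g x)" by (simp add: A_def y_def dot_def power2_eq_square)
  have "(dot n y (?g y))\<^sup>2 \<le> A * (\<Sum>k<n. (?g y k)\<^sup>2)"
    unfolding A_def dot_def by (rule Cauchy_Schwarz_ineq_sum)
  also have "\<dots> \<le> A * (s\<^sup>2 * A)"
    unfolding A_def by (intro mult_left_mono s sum_nonneg) auto
  also have "\<dots> = (s * A)\<^sup>2" by (simp add: power2_eq_square mult_ac)
  finally have "(dot n y (?g y))\<^sup>2 \<le> (s * A)\<^sup>2" .
  then have yy: "dot n y (?g y) \<le> s * A"
    by (rule power2_le_imp_le) (intro mult_nonneg_nonneg s(1) A0)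
  have "(\<Sum>\<alpha>\<in>I. w \<alpha> * dot n (a \<alpha>) (?g y) * dot n (a \<alpha>) (?g x))\<^sup>2 \<le>
      (\<Sum>\<alpha>\<in>I. w \<alpha> * (dot n (a \<alpha>) (?g y))\<^sup>2) * (\<Sum>\<alpha>\<in>I. w \<alpha> * (dot n (a \<alpha>) (?g x))\<^sup>2)"
    by (rule weighted_cauchy_schwarz) (rule w_nonneg)
  then have "A\<^sup>2 \<le> dot n y (?g y) * dot n x (?g x)"
    by (simp only: A quad[of y x] self[of y] self[of x])
  also have "\<dots> \<le> s * A * dot n x (?g x)" by (intro mult_right_mono yy pos)
  finally have "A * A \<le> A * (s * dot n x (?g x))" by (simp add: power2_eq_square mult_ac)
  then have "A \<le> s * dot n x (?g x)"
    using A0 pos[of x] s(1) by (cases "A = 0") auto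
  then show ?thesis by (simp add: A_def y_def)
qed

text \<open>H times the Newton step is the negative score. This ties the encoding of the responses
  in \<open>obj\<close> to the residuals.\<close>

lemma (in logistic_design) score_eq:
  "(\<Sum>\<alpha>\<in>I. w \<alpha> * dot n (a \<alpha>) (newton Y) * dot n (a \<alpha>) z) =
    (\<Sum>i\<in>J. e i (Y i) / N * dot n (a (fst i)) z)"
proof -
  have "(\<Sum>\<alpha>\<in>I. w \<alpha> * dot n (a \<alpha>) (newton Y) * dot n (a \<alpha>) z) =
      (\<Sum>\<alpha>\<in>I. \<Sum>i\<in>J. e i (Y i) / N * (w \<alpha> * dot n (a \<alpha>) z * K \<alpha> (fst i)))"
    unfolding dot_newton sum_distrib_left sum_distrib_right by (simp add: mult_ac)
  also have "\<dots> = (\<Sum>i\<in>J. \<Sum>\<alpha>\<in>I. e i (Y i) / N * (w \<alpha> * dot n (a \<alpha>) z * K \<alpha> (fst i)))" by (rule sum.swap)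
  also have "\<dots> = (\<Sum>i\<in>J. e i (Y i) / N * dot n (a (fst i)) z)"
  proof (intro sum.cong refl)
    fix i :: "'a \<times> nat"
    have "dot n (a (fst i)) z = (\<Sum>\<alpha>\<in>I. w \<alpha> * dot n (a \<alpha>) z * K (fst i) \<alpha>)"
      unfolding K_def by (rule dot_repro)
    also have "\<dots> = (\<Sum>\<alpha>\<in>I. w \<alpha> * dot n (a \<alpha>) z * K \<alpha> (fst i))"
      by (intro sum.cong refl arg_cong2[of _ _ _ _ "(*)"] K_sym)
    finally show "(\<Sum>\<alpha>\<in>I. e i (Y i) / N * (w \<alpha> * dot n (a \<alpha>) z * K \<alpha> (fst i))) =
        e i (Y i) / N * dot n (a (fst i)) z" by (simp add: sum_distrib_left)
  qed
  finally show ?thesis .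
qed

section \<open>Arithmetic of the sample-size conditions\<close>

text \<open>\<open>L\<close> is log d, the levels are \<open>t1 = 4 * L\<close>,
  \<open>t2 = 5 * l\<close>, \<open>y = l / N\<close>, and \<open>\<theta>\<close> is the resulting
  uniform bound on the squared forms. \<open>c1\<close> controls the smallness conditions and tails,
  \<open>c4\<close> the two terms that carry the spectral norm.\<close>

lemma numeric_bounds:
  fixes T N L l s tr \<theta> :: real and n :: nat
  defines "\<theta> \<equiv> 4 * (4 * L) / N * T"
  assumes n: "2 \<le> n" and l: "l = ln n" and L: "2 / 3 \<le> L" and T: "0 < T" and tr: "0 < tr" and s: "0 \<le> s"
    and c1: "10 ^ 7 * (T * sqrt n * L ^ 3) \<le> N" and c4: "10 ^ 7 * (T * n * s) \<le> N * (tr * l)"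
  shows "T \<le> N" "T * (4 * L) \<le> N" "T * (5 * l) \<le> N" "\<theta>\<^sup>2 * n \<le> 1 / 360 ^ 2"
    "4 * (4 * (5 * l) / N * tr + tr * (l / N) / 4 + s * (T * n / N\<^sup>2) / 4 +
        s * (\<theta> * (4 * (4 * L) / N * n) * (232000 * (\<theta>\<^sup>2 * n) + 1744 * \<theta>))) \<le> 200 * (tr * l / N)"
    "10 ^ 18 * (T / (N\<^sup>2 * (l / N))) ^ 3 \<le> 1 / 2 * n powr (- (3 / 2))"
proof -
  define S where "S = sqrt n"
  have S: "1 \<le> S" "S\<^sup>2 = n" using n by (auto simp: S_def)
  have l_ge: "2 / 3 \<le> l"
  proof -
    have "ln 2 \<le> l" unfolding l using n by simp
    then show ?thesis using ln2_ge_two_thirds by linarith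
  qed
  have l_le: "l \<le> 2 * S"
  proof -
    have "l = 2 * ln S" unfolding l S_def using n by (simp add: ln_sqrt)
    then show ?thesis using ln_le_minus_one[of S] S by linarith
  qed
  have L3: "8 / 27 \<le> L ^ 3" using power_mono[OF L, of 3] by (simp add: power3_eq_cube)
  have L2: "4 / 9 \<le> L\<^sup>2" using power_mono[OF L, of 2] by (simp add: power2_eq_square)
  have L0: "0 < L" using L by linarith
  have L23: "L ^ 3 = L * L\<^sup>2" by (simp add: power2_eq_square power3_eq_cube)
  have c1': "10 ^ 7 * (T * S * L ^ 3) \<le> N" using c1 by (simp add: S_def)
  have TS: "T \<le> T * S" using T S by simp
  have TS0: "0 < T * S" using T S by simp
  have "T * S * (8 / 27) \<le> T * S * L ^ 3" using TS0 L3 by (intro mult_left_mono) auto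
  then have N1: "10 ^ 6 * (T * S) \<le> N" using c1' TS0 by simp
  then have N: "0 < N" using TS0 by simp
  show "T \<le> N" using N1 TS TS0 by simp
  have N2: "10 ^ 6 * (T * S * L) \<le> N"
  proof -
    define p where "p = T * S * L"
    have p: "0 < p" unfolding p_def by (rule mult_pos_pos[OF TS0 L0])
    have "p * (4 / 9) \<le> p * L\<^sup>2" using p L2 by (intro mult_left_mono) auto
    moreover have "10000000 * (p * L\<^sup>2) \<le> N" using c1' by (simp add: p_def L23 mult.assoc)
    ultimately have "1000000 * p \<le> N" using p by linarith
    then show ?thesis by (simp add: p_def)
  qed
  have "T * L \<le> T * S * L" using TS L0 by (intro mult_right_mono) auto
  moreover have "1000000 * (T * S * L) \<le> N" using N2 by simp
  ultimately have "4 * (T * L) \<le> N" using mult_pos_pos[OF TS0 L0] by linarith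
  then show "T * (4 * L) \<le> N" by (simp add: mult_ac)
  have "T * l \<le> T * (2 * S)" using T l_le by (intro mult_left_mono) auto
  then show "T * (5 * l) \<le> N" using N1 TS0 by simp
  \<comment> \<open>All smallness is expressed by x = \<theta> sqrt n. The bound on
    \<open>x * L^2\<close> is where the cube of log d in \<open>c1\<close> is spent: one logarithm
    sits in \<theta>, two compensate the remainder below.\<close>
  define x where "x = \<theta> * S"
  have th0: "0 < \<theta>" using L0 N T by (simp add: \<theta>_def)
  have x0: "0 < x" using th0 S by (simp add: x_def)
  have thx: "\<theta> \<le> x" using th0 S by (simp add: x_def)
  have xx: "\<theta>\<^sup>2 * n = x\<^sup>2" by (simp add: x_def power_mult_distrib S)
  have xL2: "x * L\<^sup>2 \<le> 16 / 10 ^ 7"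
  proof -
    have "x * L\<^sup>2 = 16 * (T * S * L ^ 3) / N" by (simp add: x_def \<theta>_def L23)
    also have "\<dots> \<le> 16 / 10 ^ 7" using c1' N by (simp add: field_simps)
    finally show ?thesis .
  qed
  have x_le: "x \<le> 36 / 10 ^ 7"
  proof -
    have "x * (4 / 9) \<le> x * L\<^sup>2" using x0 L2 by (intro mult_left_mono) auto
    then show ?thesis using xL2 by simp
  qed
  have "x\<^sup>2 \<le> (1 / 360)\<^sup>2" using x_le x0 by (intro power_mono) auto
  then show "\<theta>\<^sup>2 * n \<le> 1 / 360 ^ 2" unfolding xx by (simp add: power_divide)
  define U where "U = s * (T * n / N\<^sup>2)"
  define V where "V = tr * l / N"
  have V0: "0 < V" using tr l_ge N by (simp add: V_def)
  have U0: "0 \<le> U" using s T by (simp add: U_def)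
  have U: "10 ^ 7 * U \<le> V"
  proof -
    have "10 ^ 7 * U = 10 ^ 7 * (T * n * s) / N\<^sup>2" by (simp add: U_def)
    also have "\<dots> \<le> N * (tr * l) / N\<^sup>2" using c4 by (intro divide_right_mono) auto
    also have "\<dots> = V" using N by (simp add: V_def power2_eq_square)
    finally show ?thesis .
  qed
  \<comment> \<open>The uniform bounds bring a factor L^2 relative to the mean term
    \<open>U\<close>; the extra smallness of the remainder cancels it.\<close>
  have last: "s * (\<theta> * (4 * (4 * L) / N * n) * (232000 * (\<theta>\<^sup>2 * n) + 1744 * \<theta>)) \<le> 256 * U"
  proof -
    have "s * (\<theta> * (4 * (4 * L) / N * n) * (232000 * (\<theta>\<^sup>2 * n) + 1744 * \<theta>)) =
        256 * U * (L\<^sup>2 * (232000 * x\<^sup>2 + 1744 * \<theta>))"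
      unfolding xx by (simp add: U_def \<theta>_def power2_eq_square)
    also have "\<dots> \<le> 256 * U * 1"
    proof (intro mult_left_mono)
      have "L\<^sup>2 * (232000 * x\<^sup>2 + 1744 * \<theta>) \<le> L\<^sup>2 * (232000 * (x * 1) + 1744 * x)"
        unfolding power2_eq_square[of x] using x0 x_le thx
        by (intro mult_left_mono add_mono) auto
      also have "\<dots> = 233744 * (x * L\<^sup>2)" by (simp add: algebra_simps)
      also have "\<dots> \<le> 1" using xL2 by simp
      finally show "L\<^sup>2 * (232000 * x\<^sup>2 + 1744 * \<theta>) \<le> 1" .
    qed (use U0 in auto)
    finally show ?thesis by simp
  qed
  have e1: "4 * (5 * l) / N * tr = 20 * V" "tr * (l / N) / 4 = V / 4" by (simp_all add: V_def)
  show "4 * (4 * (5 * l) / N * tr + tr * (l / N) / 4 + s * (T * n / N\<^sup>2) / 4 +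
        s * (\<theta> * (4 * (4 * L) / N * n) * (232000 * (\<theta>\<^sup>2 * n) + 1744 * \<theta>))) \<le> 200 * (tr * l / N)"
  proof -
    have "4 * (20 * V + V / 4 + U / 4 + Z) \<le> 200 * V" if "Z \<le> 256 * U" for Z
    proof -
      have "1100 * U \<le> 10 ^ 7 * U" using U0 by (intro mult_right_mono) auto
      also note U
      finally show ?thesis using that V0 by (simp add: algebra_simps)
    qed
    from this[OF last] show ?thesis unfolding e1 U_def[symmetric] V_def[symmetric] .
  qed
  \<comment> \<open>The ratio is of order 1 / sqrt n, and its cube is the power -3/2 of the
    dimension.\<close>
  have "T / (N\<^sup>2 * (l / N)) = T / (N * l)" using N by (simp add: power2_eq_square)
  also have "\<dots> \<le> (81 / 16) / (10 ^ 7 * S)"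
  proof -
    have "16 / 81 \<le> L ^ 3 * l" using mult_mono[OF L3 l_ge] L0 by simp
    then have "10 ^ 7 * (T * S) * (16 / 81) \<le> 10 ^ 7 * (T * S) * (L ^ 3 * l)"
      using TS0 by (intro mult_left_mono) auto
    also have "\<dots> = 10 ^ 7 * (T * S * L ^ 3) * l" by simp
    also have "\<dots> \<le> N * l" using c1' l_ge by (intro mult_right_mono) auto
    finally have "10 ^ 7 * (T * S) * (16 / 81) \<le> N * l" .
    then show ?thesis using N l_ge S by (simp add: field_simps)
  qed
  finally have "(T / (N\<^sup>2 * (l / N))) ^ 3 \<le> ((81 / 16) / (10 ^ 7 * S)) ^ 3"
    using T N l_ge by (intro power_mono) auto
  then have "10 ^ 18 * (T / (N\<^sup>2 * (l / N))) ^ 3 \<le> 10 ^ 18 * ((81 / 16) / (10 ^ 7 * S)) ^ 3"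
    by (intro mult_left_mono) auto
  also have "\<dots> = (531441 / 4096000) * (1 / S ^ 3)"
    by (simp add: power_divide power_mult_distrib)
  also have "\<dots> \<le> 1 / 2 * (1 / S ^ 3)" using S by (intro mult_right_mono) auto
  also have "1 / S ^ 3 = n powr (- (3 / 2))"
  proof -
    have "S ^ 3 = S powr 3" using S by (simp add: powr_numeral)
    also have "\<dots> = n powr (3 / 2)" using n by (simp add: S_def powr_half_sqrt[symmetric] powr_powr)
    finally show ?thesis by (simp add: powr_minus_divide)
  qed
  finally show "10 ^ 18 * (T / (N\<^sup>2 * (l / N))) ^ 3 \<le> 1 / 2 * n powr (- (3 / 2))" .
qed

section \<open>The estimator\<close>

lemma dot_cong: "(\<And>k. k < n \<Longrightarrow> x k = x' k) \<Longrightarrow> (\<And>k. k < n \<Longrightarrow> y k = y' k) \<Longrightarrow> dot n x y = dot n x' y'"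
  unfolding dot_def by (intro sum.cong) auto

locale btl_instance =
  fixes P :: btl and B :: real and \<theta>s :: "real vec"
  assumes setting: "btl_setting P" and B: "1 < B" and dim2: "2 \<le> d_theta P"
    and \<theta>s: "\<theta>s \<in> carrier_vec (d_theta P)"
    and eta_le: "Max ((\<lambda>\<alpha>. \<bar>eta P \<alpha> \<theta>s\<bar>) ` queries P) \<le> ln B"
    and design: "pos_def (design_mat P)"
begin

abbreviation "n \<equiv> d_theta P"
abbreviation "I \<equiv> queries P"
definition N :: real where "N = real (n_total P)"
definition q :: "nat \<times> nat \<Rightarrow> nat \<Rightarrow> real" where "q \<alpha> = vec_index (q_vec P \<alpha>)"
definition a :: "nat \<times> nat \<Rightarrow> nat \<Rightarrow> real" where "a \<alpha> k = q \<alpha> k / util_scale P"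
definition \<eta> :: "nat \<times> nat \<Rightarrow> real" where "\<eta> \<alpha> = eta P \<alpha> \<theta>s"
definition m :: "nat \<times> nat \<Rightarrow> real" where "m \<alpha> = reps P \<alpha> / N"
definition w :: "nat \<times> nat \<Rightarrow> real" where "w \<alpha> = m \<alpha> * d2psi (\<eta> \<alpha>)"
definition G :: "nat \<Rightarrow> nat \<Rightarrow> real" where "G i j = mat_inv (hess P \<theta>s) $$ (i, j)"
definition T :: real where "T = 4 * B * mu_Q P * n"
definition s :: real where "s = spectral_norm (mat_inv (hess P \<theta>s))"

lemma finite_I: "finite I" and card_I: "card I \<le> (n_items P)\<^sup>2"
proof -
  have sub: "I \<subseteq> {..<n_items P} \<times> {..<n_items P}"
    using setting by (auto simp: btl_setting_def)
  then show "finite I" by (rule finite_subset) simp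
  show "card I \<le> (n_items P)\<^sup>2"
    using card_mono[OF _ sub] by (simp add: card_cartesian_product power2_eq_square)
qed

lemma reps_ge_1: "\<alpha> \<in> I \<Longrightarrow> 1 \<le> reps P \<alpha>"
  and I_nonempty: "I \<noteq> {}" and scale_pos: "0 < util_scale P" and items_ge_2: "2 \<le> n_items P"
  using setting by (auto simp: btl_setting_def)

lemma N_eq: "N = (\<Sum>\<alpha>\<in>I. real (reps P \<alpha>))"
  by (simp add: N_def n_total_def)

lemma N_ge_1: "1 \<le> N"
proof -
  obtain \<alpha> where \<alpha>: "\<alpha> \<in> I" using I_nonempty by blast
  have "1 \<le> real (reps P \<alpha>)" using reps_ge_1[OF \<alpha>] by simp
  also have "\<dots> \<le> N" unfolding N_eq using \<alpha> finite_I by (intro member_le_sum) auto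
  finally show ?thesis .
qed

lemma m_pos: "\<alpha> \<in> I \<Longrightarrow> 0 < m \<alpha>"
  using reps_ge_1[of \<alpha>] N_ge_1 by (simp add: m_def)

lemma w_pos: "\<alpha> \<in> I \<Longrightarrow> 0 < w \<alpha>"
  using m_pos d2psi_gt_0 by (simp add: w_def)

lemma design_eq: "design_mat P = weighted_gram n I m q"
  unfolding design_mat_def weighted_gram_def m_def N_def q_def
  by (intro cong_mat refl) (simp add: sum_distrib_left mult_ac)

lemma hess_eq: "hess P \<theta>s = weighted_gram n I w a"
  unfolding hess_def weighted_gram_def w_def m_def N_def a_def q_def \<eta>_def deriv_deriv_psi_eq
  by (intro cong_mat refl) (simp add: sum_distrib_left power2_eq_square mult_ac)

lemma dot_a: "dot n (a \<alpha>) x = dot n (q \<alpha>) x / util_scale P"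
  by (simp add: dot_def a_def sum_divide_distrib)

lemma pos_def_hess: "pos_def (weighted_gram n I w a)"
  unfolding pos_def_def
proof (intro conjI ballI impI)
  show "square_mat (weighted_gram n I w a)" by (simp add: weighted_gram_def)
  show "transpose_mat (weighted_gram n I w a) = weighted_gram n I w a"
    by (rule eq_matI) (auto simp: weighted_gram_def mult_ac)
  fix x :: "real vec"
  assume "x \<in> carrier_vec (dim_row (weighted_gram n I w a))"
    and x0: "x \<noteq> 0\<^sub>v (dim_row (weighted_gram n I w a))"
  then have x: "x \<in> carrier_vec n" "x \<noteq> 0\<^sub>v n" by (auto simp: weighted_gram_def)
  have "0 < x \<bullet> (weighted_gram n I m q *\<^sub>v x)"
    using design x unfolding design_eq pos_def_def by (auto simp: weighted_gram_def)
  then have "0 < (\<Sum>\<alpha>\<in>I. m \<alpha> * (dot n (q \<alpha>) (vec_index x))\<^sup>2)"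
    by (simp add: weighted_gram_quadratic[OF x(1)])
  then obtain \<alpha> where \<alpha>: "\<alpha> \<in> I" "dot n (q \<alpha>) (vec_index x) \<noteq> 0"
    by (metis (no_types, lifting) less_irrefl mult_zero_right sum.neutral zero_power2)
  have "0 < (\<Sum>\<alpha>\<in>I. w \<alpha> * (dot n (a \<alpha>) (vec_index x))\<^sup>2)"
  proof (rule sum_pos2[OF finite_I \<alpha>(1)])
    show "0 < w \<alpha> * (dot n (a \<alpha>) (vec_index x))\<^sup>2"
      using \<alpha> w_pos scale_pos by (simp add: dot_a)
    show "0 \<le> w \<beta> * (dot n (a \<beta>) (vec_index x))\<^sup>2" if "\<beta> \<in> I" for \<beta>
      using w_pos[OF that] by simp
  qed
  then show "0 < x \<bullet> (weighted_gram n I w a *\<^sub>v x)"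
    by (simp add: weighted_gram_quadratic[OF x(1)])
qed

sublocale H: gram n I w a G
  unfolding G_def[abs_def] hess_eq
  by (rule gram_of_inverse[OF finite_I less_imp_le[OF w_pos] pos_def_hess])

sublocale W: gram n I m q "\<lambda>i j. mat_inv (design_mat P) $$ (i, j)"
  unfolding design_eq
  by (rule gram_of_inverse[OF finite_I less_imp_le[OF m_pos] design[unfolded design_eq]])

lemma W_K_le:
  assumes "\<alpha> \<in> I"
  shows "W.K \<alpha> \<alpha> \<le> mu_Q P * n"
proof -
  have qc: "q_vec P \<alpha> \<in> carrier_vec n" by (rule q_vec_carrier[OF setting])
  have X: "mat_inv (design_mat P) \<in> carrier_mat n n"
    using pos_def_inverse(1)[OF design] by (simp add: design_eq)
  have "q_vec P \<alpha> \<bullet> (mat_inv (design_mat P) *\<^sub>v q_vec P \<alpha>) = W.K \<alpha> \<alpha>"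
    unfolding scalar_prod_eq_dot[OF mult_mat_vec_carrier[OF X qc]] W.K_def W.b_def
    by (intro dot_cong) (simp_all only: q_def mult_mat_vec_gmul[OF X _ qc])
  then have "1 / real n * W.K \<alpha> \<alpha> \<le> mu_Q P"
    unfolding mu_Q_def using assms finite_I by (intro Max_ge) (auto intro!: image_eqI[of _ _ \<alpha>])
  then show ?thesis using dim2 by (simp add: field_simps)
qed

text \<open>Since \<Psi>'' \<ge> 1 / (4 B), the Hessian dominates W / (4 B \<sigma>^2), so leverages
  grow by at most 4 B. Instead of monotonicity of inversion, Cauchy-Schwarz for the kernel of W is
  applied to z = G a_\<alpha>, which bounds the square of \<kappa> by \<kappa> T.\<close>

lemma H_K_le:
  assumes \<alpha>: "\<alpha> \<in> I"
  shows "H.K \<alpha> \<alpha> \<le> T"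
proof -
  let ?z = "H.b \<alpha>" and ?\<sigma> = "util_scale P"
  define \<kappa> where "\<kappa> = H.K \<alpha> \<alpha>"
  have \<kappa>0: "0 \<le> \<kappa>" unfolding \<kappa>_def by (rule H.K_nonneg)
  have mu0: "0 \<le> mu_Q P * n" using W_K_le[OF \<alpha>] W.K_nonneg[of \<alpha>] by linarith
  have "dot n (q \<alpha>) ?z = ?\<sigma> * \<kappa>"
    using scale_pos unfolding \<kappa>_def H.K_def dot_a by simp
  then have "(?\<sigma> * \<kappa>)\<^sup>2 \<le> W.K \<alpha> \<alpha> * (\<Sum>\<beta>\<in>I. m \<beta> * (dot n (q \<beta>) ?z)\<^sup>2)"
    using W.dot_a_sq_le[of \<alpha> ?z] by simp
  also have "\<dots> \<le> (mu_Q P * n) * (4 * B * ?\<sigma>\<^sup>2 * \<kappa>)"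
  proof (intro mult_mono W_K_le \<alpha> mu0)
    have "(\<Sum>\<beta>\<in>I. m \<beta> * (dot n (q \<beta>) ?z)\<^sup>2) \<le> (\<Sum>\<beta>\<in>I. 4 * B * ?\<sigma>\<^sup>2 * (w \<beta> * (H.K \<alpha> \<beta>)\<^sup>2))"
    proof (intro sum_mono)
      fix \<beta> assume \<beta>: "\<beta> \<in> I"
      have "\<bar>\<eta> \<beta>\<bar> \<in> (\<lambda>\<alpha>. \<bar>eta P \<alpha> \<theta>s\<bar>) ` I" unfolding \<eta>_def using \<beta> by (rule imageI)
      then have "\<bar>\<eta> \<beta>\<bar> \<le> ln B"
        by (rule order_trans[OF Max_ge eta_le, rotated]) (simp add: finite_I)
      then have "1 / (4 * B) \<le> d2psi (\<eta> \<beta>)" by (rule d2psi_ge[OF B])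
      then have "1 \<le> 4 * B * d2psi (\<eta> \<beta>)" using B by (simp add: field_simps)
      then have "m \<beta> * 1 \<le> m \<beta> * (4 * B * d2psi (\<eta> \<beta>))"
        using m_pos[OF \<beta>] by (intro mult_left_mono) auto
      then have mw: "m \<beta> \<le> 4 * B * w \<beta>" by (simp add: w_def mult_ac)
      have "dot n (q \<beta>) ?z = ?\<sigma> * H.K \<beta> \<alpha>"
        using scale_pos unfolding H.K_def dot_a by simp
      also have "H.K \<beta> \<alpha> = H.K \<alpha> \<beta>" by (rule H.K_sym)
      finally have "dot n (q \<beta>) ?z = ?\<sigma> * H.K \<alpha> \<beta>" .
      then have "m \<beta> * (dot n (q \<beta>) ?z)\<^sup>2 = m \<beta> * (?\<sigma> * H.K \<alpha> \<beta>)\<^sup>2" by simp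
      also have "\<dots> \<le> 4 * B * w \<beta> * (?\<sigma> * H.K \<alpha> \<beta>)\<^sup>2" by (intro mult_right_mono mw) auto
      finally show "m \<beta> * (dot n (q \<beta>) ?z)\<^sup>2 \<le> 4 * B * ?\<sigma>\<^sup>2 * (w \<beta> * (H.K \<alpha> \<beta>)\<^sup>2)"
        by (simp add: power_mult_distrib mult_ac)
    qed
    also have "\<dots> = 4 * B * ?\<sigma>\<^sup>2 * \<kappa>" by (simp add: \<kappa>_def H.K_diag sum_distrib_left)
    finally show "(\<Sum>\<beta>\<in>I. m \<beta> * (dot n (q \<beta>) ?z)\<^sup>2) \<le> 4 * B * ?\<sigma>\<^sup>2 * \<kappa>" .
    show "0 \<le> (\<Sum>\<beta>\<in>I. m \<beta> * (dot n (q \<beta>) ?z)\<^sup>2)"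
      using m_pos by (intro sum_nonneg mult_nonneg_nonneg) (auto intro: less_imp_le)
  qed
  finally have "(?\<sigma>\<^sup>2 * \<kappa>) * \<kappa> \<le> (?\<sigma>\<^sup>2 * \<kappa>) * T"
    by (simp add: T_def power2_eq_square mult_ac)
  moreover have "0 \<le> T" using mu0 B by (simp add: T_def mult.assoc)
  ultimately show ?thesis
    using scale_pos \<kappa>0 unfolding \<kappa>_def[symmetric] by (cases "\<kappa> = 0") auto
qed

text \<open>The weighted leverages sum to the dimension, so a common upper bound for them cannot be
  nonpositive.\<close>

lemma T_pos: "0 < T"
proof (rule ccontr)
  assume "\<not> ?thesis"
  then have "(\<Sum>\<alpha>\<in>I. w \<alpha> * H.K \<alpha> \<alpha>) \<le> (\<Sum>\<alpha>\<in>I. 0)"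
    using H_K_le w_pos by (intro sum_mono mult_nonneg_nonpos) (force intro: less_imp_le)+
  then show False using H.sum_K_diag dim2 by simp
qed

lemma s_nonneg: "0 \<le> s"
  and spectral: "(\<Sum>k<n. (gmul n G x k)\<^sup>2) \<le> s * dot n x (gmul n G x)"
proof -
  have X: "mat_inv (hess P \<theta>s) \<in> carrier_mat n n"
    using pos_def_inverse(1)[OF pos_def_hess] by (simp add: hess_eq)
  show s0: "0 \<le> s" unfolding s_def by (rule spectral_norm_bound(1)[OF X])
  show "(\<Sum>k<n. (gmul n G x k)\<^sup>2) \<le> s * dot n x (gmul n G x)"
    using spectral_norm_bound(2)[OF X] by (intro H.gmul_norm_le_quadratic s0) (simp add: s_def G_def[abs_def])
qed

context
  assumes T_le_N: "T \<le> N"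
begin

interpretation D: logistic_design n I w a G m \<eta> T "reps P" N s
proof unfold_locales
  show "gram.K n a G \<alpha> \<alpha> \<le> T" if "\<alpha> \<in> I" for \<alpha> using H_K_le[OF that] .
qed (use m_pos w_def T_pos dim2 N_eq N_ge_1 m_def T_le_N s_nonneg spectral in auto)

lemma response_dist_eq: "response_dist P \<theta>s = Pi_pmf D.J False D.D"
proof -
  have "(\<lambda>(\<alpha>, t). bernoulli_pmf (1 / (1 + exp (- eta P \<alpha> \<theta>s)))) = D.D"
    by (auto simp: fun_eq_iff D.D_def \<eta>_def dpsi_eq_logistic)
  then show ?thesis by (simp add: response_dist_def D.J_def)
qed

lemma trG_eq: "D.trG = mat_trace (mat_inv (hess P \<theta>s))"
proof -
  have "mat_inv (hess P \<theta>s) \<in> carrier_mat n n"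
    using pos_def_inverse(1)[OF pos_def_hess] by (simp add: hess_eq)
  then show ?thesis by (simp add: D.trG_def mat_trace_def G_def)
qed

lemma trace_pos: "0 < mat_trace (mat_inv (hess P \<theta>s))"
  unfolding trG_eq[symmetric] by (rule D.trG_pos)

lemma s_pos: "0 < s"
proof (rule ccontr)
  assume "\<not> ?thesis"
  then have s0: "s = 0" using s_nonneg by simp
  \<comment> \<open>If the norm of \<open>G\<close> were 0, its first column would vanish, against
    the positive diagonal.\<close>
  let ?x = "\<lambda>j::nat. if j = 0 then 1 else 0 :: real"
  have "(gmul n G ?x 0)\<^sup>2 \<le> (\<Sum>k<n. (gmul n G ?x k)\<^sup>2)"
    using dim2 by (intro member_le_sum) auto
  also have "\<dots> \<le> 0" using spectral[of ?x] s0 by simp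
  finally have "gmul n G ?x 0 = 0" by simp
  moreover have "gmul n G ?x 0 = G 0 0"
    using dim2 by (simp add: gmul_def if_distrib sum.delta cong: if_cong)
  ultimately show False using D.G_pos[of 0] dim2 by simp
qed

text \<open>The subtracted sum does not depend on \<open>\<theta>\<close>, so strict minimisers of
  \<open>D.obj\<close> are exactly shifts of the estimator. The linear terms match because
  \<open>D.score_eq\<close> rewrites the Newton step as observed minus expected counts.\<close>

lemma neg_log_lik_eq:
  assumes "\<theta> \<in> carrier_vec n"
  shows "neg_log_lik P Y \<theta> = D.obj (D.newton Y) (\<lambda>k. \<theta> $ k - \<theta>s $ k) -
    (\<Sum>\<alpha>\<in>I. y_sum P Y \<alpha> / N * \<eta> \<alpha>)"
proof -
  let ?z = "\<lambda>k. \<theta> $ k - \<theta>s $ k"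
  have eta: "eta P \<alpha> \<theta> = \<eta> \<alpha> + dot n (a \<alpha>) ?z" for \<alpha>
    unfolding \<eta>_def eta_def dot_diff_right dot_a q_def scalar_prod_eq_dot[OF assms] scalar_prod_eq_dot[OF \<theta>s]
    by (simp add: add_divide_distrib)
  have score: "(\<Sum>\<alpha>\<in>I. w \<alpha> * dot n (a \<alpha>) (D.newton Y) * dot n (a \<alpha>) ?z) =
      (\<Sum>\<alpha>\<in>I. (y_sum P Y \<alpha> / N - m \<alpha> * dpsi (\<eta> \<alpha>)) * dot n (a \<alpha>) ?z)"
  proof -
    have "(\<Sum>\<alpha>\<in>I. w \<alpha> * dot n (a \<alpha>) (D.newton Y) * dot n (a \<alpha>) ?z) =
        (\<Sum>\<alpha>\<in>I. \<Sum>t\<in>{1..reps P \<alpha>}. (of_bool (Y (\<alpha>, t)) - dpsi (\<eta> \<alpha>)) / N * dot n (a \<alpha>) ?z)"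
      unfolding D.score_eq D.J_def D.e_def using finite_I
      by (subst sum.Sigma) (auto simp: case_prod_beta)
    also have "\<dots> = (\<Sum>\<alpha>\<in>I. (y_sum P Y \<alpha> / N - m \<alpha> * dpsi (\<eta> \<alpha>)) * dot n (a \<alpha>) ?z)"
    proof (intro sum.cong refl)
      fix \<alpha>
      have "(\<Sum>t\<in>{1..reps P \<alpha>}. (of_bool (Y (\<alpha>, t)) - dpsi (\<eta> \<alpha>)) / N * dot n (a \<alpha>) ?z) =
          (\<Sum>t\<in>{1..reps P \<alpha>}. of_bool (Y (\<alpha>, t)) - dpsi (\<eta> \<alpha>)) / N * dot n (a \<alpha>) ?z"
        by (simp only: sum_distrib_right sum_divide_distrib)
      also have "(\<Sum>t\<in>{1..reps P \<alpha>}. of_bool (Y (\<alpha>, t)) - dpsi (\<eta> \<alpha>)) =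
          y_sum P Y \<alpha> - reps P \<alpha> * dpsi (\<eta> \<alpha>)"
        by (simp add: sum_subtractf y_sum_def)
      finally show "(\<Sum>t\<in>{1..reps P \<alpha>}. (of_bool (Y (\<alpha>, t)) - dpsi (\<eta> \<alpha>)) / N * dot n (a \<alpha>) ?z) =
          (y_sum P Y \<alpha> / N - m \<alpha> * dpsi (\<eta> \<alpha>)) * dot n (a \<alpha>) ?z"
        by (simp add: m_def diff_divide_distrib)
    qed
    finally show ?thesis .
  qed
  have "D.obj (D.newton Y) ?z = (\<Sum>\<alpha>\<in>I. m \<alpha> * psi (\<eta> \<alpha> + dot n (a \<alpha>) ?z)) -
      (\<Sum>\<alpha>\<in>I. m \<alpha> * dpsi (\<eta> \<alpha>) * dot n (a \<alpha>) ?z) -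
      (\<Sum>\<alpha>\<in>I. w \<alpha> * dot n (a \<alpha>) (D.newton Y) * dot n (a \<alpha>) ?z)"
    unfolding D.obj_def by (simp add: sum_subtractf sum.distrib distrib_right)
  also have "\<dots> = (\<Sum>\<alpha>\<in>I. m \<alpha> * psi (\<eta> \<alpha> + dot n (a \<alpha>) ?z) - y_sum P Y \<alpha> / N * dot n (a \<alpha>) ?z)"
    unfolding score sum_subtractf[symmetric] by (intro sum.cong refl) (simp add: algebra_simps)
  finally have "D.obj (D.newton Y) ?z - (\<Sum>\<alpha>\<in>I. y_sum P Y \<alpha> / N * \<eta> \<alpha>) =
      (\<Sum>\<alpha>\<in>I. m \<alpha> * psi (\<eta> \<alpha> + dot n (a \<alpha>) ?z) - y_sum P Y \<alpha> / N * dot n (a \<alpha>) ?z -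
        y_sum P Y \<alpha> / N * \<eta> \<alpha>)"
    by (simp only: sum_subtractf)
  also have "\<dots> = neg_log_lik P Y \<theta>"
    unfolding neg_log_lik_def sum_distrib_left eta N_def[symmetric]
    by (intro sum.cong refl) (simp add: m_def algebra_simps add_divide_distrib diff_divide_distrib)
  finally show ?thesis by simp
qed

lemma mle_error_tail:
  assumes t1: "0 < t1" "T * t1 \<le> N" and t2: "0 < t2" "T * t2 \<le> N" and y: "0 < y"
    and small: "(4 * t1 / N * T)\<^sup>2 * n \<le> 1 / 360 ^ 2"
    and bound: "4 * (4 * t2 / N * mat_trace (mat_inv (hess P \<theta>s)) +
        mat_trace (mat_inv (hess P \<theta>s)) * y / 4 + s * (T * n / N\<^sup>2) / 4 +
        s * (4 * t1 / N * T * (4 * t1 / N * n) * (232000 * ((4 * t1 / N * T)\<^sup>2 * n) + 1744 * (4 * t1 / N * T)))) \<le> R"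
  shows "1 - (card I * (2 * exp (- t1)) + n * (2 * exp (- t2)) + 10 ^ 18 * (T / (N\<^sup>2 * y)) ^ 3)
    \<le> measure_pmf.prob (response_dist P \<theta>s)
        {Y. \<exists>\<theta>h. is_mle P Y \<theta>h \<and> (l2norm (\<theta>h - \<theta>s))\<^sup>2 \<le> R}"
proof -
  define R' where "R' = 4 * (4 * t2 / N * D.trG + D.trG * y / 4 + s * (T * n / N\<^sup>2) / 4 +
      s * (4 * t1 / N * T * (4 * t1 / N * n) * (232000 * ((4 * t1 / N * T)\<^sup>2 * n) + 1744 * (4 * t1 / N * T))))"
  have R': "R' \<le> R" unfolding R'_def trG_eq by (rule bound)
  let ?good = "\<lambda>Y. \<exists>x. (\<forall>z k. k < n \<longrightarrow> x k \<noteq> z k \<longrightarrow> D.obj (D.newton Y) x < D.obj (D.newton Y) z) \<and>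
      (\<Sum>k<n. (x k)\<^sup>2) \<le> R'"
  let ?mle = "{Y. \<exists>\<theta>h. is_mle P Y \<theta>h \<and> (l2norm (\<theta>h - \<theta>s))\<^sup>2 \<le> R}"
  have "Y \<in> ?mle" if good: "?good Y" for Y
  proof -
    obtain x where min: "\<And>z k. k < n \<Longrightarrow> x k \<noteq> z k \<Longrightarrow> D.obj (D.newton Y) x < D.obj (D.newton Y) z"
      and xR': "(\<Sum>k<n. (x k)\<^sup>2) \<le> R'"
      using good by blast
    have x: "(\<Sum>k<n. (x k)\<^sup>2) \<le> R" by (rule order_trans[OF xR' R'])
    define \<theta>h where "\<theta>h = vec n (\<lambda>k. \<theta>s $ k + x k)"
    have \<theta>h: "\<theta>h \<in> carrier_vec n" by (simp add: \<theta>h_def)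
    \<comment> \<open>The minimiser is a function on all naturals, while \<open>\<theta>h\<close>
      keeps only its coordinates below \<open>n\<close>.\<close>
    have obj_cong: "D.obj d z = D.obj d z'" if "\<And>k. k < n \<Longrightarrow> z k = z' k" for d z z'
      unfolding D.obj_def using that by (simp cong: dot_cong)
    have "is_mle P Y \<theta>h"
      unfolding is_mle_def
    proof (intro conjI ballI impI \<theta>h)
      fix \<theta>' assume \<theta>': "\<theta>' \<in> carrier_vec n" "\<theta>' \<noteq> \<theta>h"
      then obtain k where k: "k < n" "\<theta>' $ k \<noteq> \<theta>h $ k" using \<theta>h by (metis carrier_vecD eq_vecI)
      then have "x k \<noteq> \<theta>' $ k - \<theta>s $ k" by (auto simp: \<theta>h_def)
      from min[OF k(1), of "\<lambda>k. \<theta>' $ k - \<theta>s $ k", OF this]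
      have "D.obj (D.newton Y) x < D.obj (D.newton Y) (\<lambda>k. \<theta>' $ k - \<theta>s $ k)" .
      moreover have "D.obj (D.newton Y) (\<lambda>k. \<theta>h $ k - \<theta>s $ k) = D.obj (D.newton Y) x"
        by (intro obj_cong) (simp add: \<theta>h_def)
      ultimately show "neg_log_lik P Y \<theta>h < neg_log_lik P Y \<theta>'"
        by (simp add: neg_log_lik_eq \<theta>h \<theta>'(1))
    qed
    moreover have "(l2norm (\<theta>h - \<theta>s))\<^sup>2 = (\<Sum>k<n. (x k)\<^sup>2)"
    proof -
      have c: "\<theta>h - \<theta>s \<in> carrier_vec n" using \<theta>h \<theta>s by simp
      show ?thesis unfolding l2norm_eq[OF c] using \<theta>s by (simp add: sum_nonneg \<theta>h_def)
    qed
    ultimately show ?thesis using x by auto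
  qed
  then have sub: "UNIV - ?mle \<subseteq> {Y. \<not> ?good Y}" by blast
  have "measure_pmf.prob (response_dist P \<theta>s) (UNIV - ?mle) \<le>
      measure_pmf.prob (response_dist P \<theta>s) {Y. \<not> ?good Y}"
    by (rule measure_pmf.finite_measure_mono[OF sub]) simp
  also have "\<dots> \<le> card I * (2 * exp (- t1)) + n * (2 * exp (- t2)) + 10 ^ 18 * (T / (N\<^sup>2 * y)) ^ 3"
    unfolding response_dist_eq R'_def by (rule D.minimizer_error_tail[OF t1 t2 y small])
  finally show ?thesis
    using measure_pmf.prob_compl[of ?mle "response_dist P \<theta>s"] by simp
qed

end

end

theorem corollary4p2:
  shows "\<exists>C0 C1 c :: real. C0 > 0 \<and> C1 > 0 \<and> c > 1 \<and>
    (\<forall>(P :: btl) (B :: real) (\<theta>s :: real vec).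
       btl_setting P \<longrightarrow>
       B > 1 \<longrightarrow>
       d_theta P \<ge> 2 \<longrightarrow>
       \<theta>s \<in> carrier_vec (d_theta P) \<longrightarrow>
       Max ((\<lambda>\<alpha>. \<bar>eta P \<alpha> \<theta>s\<bar>) ` queries P) \<le> ln B \<longrightarrow>
       pos_def (design_mat P) \<longrightarrow>
       real (n_total P) \<ge> C0 * Max {
         B ^ 3 * mu_Q P * real (d_theta P) powr (3 / 2) * ln (real (n_items P)) ^ 3,
         B ^ 4 * mu_Q P * real (d_theta P) * ln (real (n_items P)),
         B * mu_Q P * real (d_theta P) * ln (real (d_theta P)) / r_eff P \<theta>s,
         B * mu_Q P * real (d_theta P) ^ 2 / (r_eff P \<theta>s * ln (real (d_theta P)))} \<longrightarrow>
       measure_pmf.prob (response_dist P \<theta>s)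
         {Y. \<exists>\<theta>h. is_mle P Y \<theta>h \<and>
              (l2norm (\<theta>h - \<theta>s))\<^sup>2 \<le>
                C1 * (mat_trace (mat_inv (hess P \<theta>s)) * ln (real (d_theta P)) / real (n_total P))}
         \<ge> 1 - 2 * real (n_items P) powr (- c) - real (d_theta P) powr (- c))"
\<comment> \<open>The 4 in the first constant is the 4 of \<open>T = 4 * B * mu_Q P * n\<close>; the
  10^7 and the 200 are those of \<open>numeric_bounds\<close>, and 3/2 is the exponent reached by
  the sixth moment.\<close>
proof (rule exI[of _ "4 * 10 ^ 7"], rule exI[of _ 200], rule exI[of _ "3 / 2"], intro conjI allI impI)
  fix P :: btl and B :: real and \<theta>s :: "real vec"
  assume "btl_setting P" "B > 1" "d_theta P \<ge> 2" "\<theta>s \<in> carrier_vec (d_theta P)"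
    "Max ((\<lambda>\<alpha>. \<bar>eta P \<alpha> \<theta>s\<bar>) ` queries P) \<le> ln B" "pos_def (design_mat P)"
  then interpret btl_instance P B \<theta>s by unfold_locales
  let ?d = "real (n_items P)"
  let ?M = "Max {
         B ^ 3 * mu_Q P * real n powr (3 / 2) * ln ?d ^ 3,
         B ^ 4 * mu_Q P * real n * ln ?d,
         B * mu_Q P * real n * ln (real n) / r_eff P \<theta>s,
         B * mu_Q P * real n ^ 2 / (r_eff P \<theta>s * ln (real n))}"
  assume size: "real (n_total P) \<ge> 4 * 10 ^ 7 * ?M"
  define L l where "L = ln ?d" and "l = ln (real n)"
  define tr where "tr = mat_trace (mat_inv (hess P \<theta>s))"
  have L: "2 / 3 \<le> L"
  proof -
    have "ln 2 \<le> L" unfolding L_def using items_ge_2 by simp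
    then show ?thesis using ln2_ge_two_thirds by linarith
  qed
  have l: "0 < l" using dim2 by (simp add: l_def)
  have mu: "0 < mu_Q P" using T_pos B dim2 by (simp add: T_def zero_less_mult_iff)
  have "B ^ 3 * mu_Q P * real n powr (3 / 2) * ln ?d ^ 3 \<le> ?M" by (intro Max_ge) auto
  then have "4 * 10 ^ 7 * (B ^ 3 * mu_Q P * real n powr (3 / 2) * L ^ 3) \<le> N"
    using size by (simp add: N_def L_def)
  \<comment> \<open>\<open>T\<close> contains only one power of \<open>B\<close>, so B \<le> B^3
    passes to the condition in terms of \<open>T\<close>.\<close>
  moreover have "B * (mu_Q P * n * sqrt n * L ^ 3) \<le> B ^ 3 * (mu_Q P * n * sqrt n * L ^ 3)"
    using B mu L self_le_power[of B 3] by (intro mult_right_mono mult_nonneg_nonneg) auto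
  moreover have "real n powr (3 / 2) = n * sqrt n"
  proof -
    have "real n powr (3 / 2) = real n powr (1 + 1 / 2)" by simp
    also have "\<dots> = n * sqrt n" using dim2 by (subst powr_add) (simp add: powr_half_sqrt)
    finally show ?thesis .
  qed
  ultimately have c1: "10 ^ 7 * (T * sqrt n * L ^ 3) \<le> N" by (simp add: T_def mult_ac)
  have TN: "T \<le> N"
  proof -
    have "1 \<le> sqrt n" using dim2 by simp
    moreover have "8 / 27 \<le> L ^ 3" using power_mono[OF L, of 3] by (simp add: power3_eq_cube)
    ultimately have "1 * (8 / 27) \<le> sqrt n * L ^ 3" by (intro mult_mono) auto
    then have "T * 1 \<le> T * (10 ^ 7 * (sqrt n * L ^ 3))" using T_pos by (intro mult_left_mono) auto
    then show ?thesis using c1 by (simp add: mult_ac)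
  qed
  have tr: "0 < tr" unfolding tr_def by (rule trace_pos[OF TN])
  have s: "0 < s" by (rule s_pos[OF TN])
  have r: "r_eff P \<theta>s = tr / s" by (simp add: r_eff_def tr_def s_def)
  have "B * mu_Q P * real n ^ 2 / (r_eff P \<theta>s * ln (real n)) \<le> ?M" by (intro Max_ge) auto
  then have "4 * 10 ^ 7 * (B * mu_Q P * real n ^ 2 / (tr / s * l)) \<le> N"
    using size by (simp add: N_def l_def r)
  then have c4: "10 ^ 7 * (T * n * s) \<le> N * (tr * l)"
    using s tr l by (simp add: T_def field_simps power2_eq_square)
  note nb = numeric_bounds[OF dim2 l_def L T_pos tr less_imp_le[OF s] c1 c4]
  have N: "0 < N" using N_ge_1 by simp
  \<comment> \<open>The level 4 log d beats the at most d^2 queries; 5 log d_theta beats the d_theta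
    coordinates.\<close>
  have "1 - (card I * (2 * exp (- (4 * L))) + n * (2 * exp (- (5 * l))) +
      10 ^ 18 * (T / (N\<^sup>2 * (l / N))) ^ 3) \<le> measure_pmf.prob (response_dist P \<theta>s)
        {Y. \<exists>\<theta>h. is_mle P Y \<theta>h \<and> (l2norm (\<theta>h - \<theta>s))\<^sup>2 \<le> 200 * (tr * l / N)}"
    using L l N nb by (intro mle_error_tail[OF TN]) (auto simp: tr_def)
  moreover have "card I * (2 * exp (- (4 * L))) \<le> 2 * ?d powr (- (3 / 2))"
  proof -
    have d: "2 \<le> ?d" using items_ge_2 by simp
    have "card I \<le> ?d powr 2"
      using card_I d by (simp add: powr_numeral flip: of_nat_power)
    then have "card I * (2 * exp (- (4 * L))) \<le> ?d powr 2 * (2 * ?d powr (- 4))"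
      using d by (intro mult_mono) (auto simp: powr_def L_def)
    also have "\<dots> = 2 * (?d powr 2 * ?d powr (- 4))" by (rule mult.left_commute)
    also have "?d powr 2 * ?d powr (- 4) = ?d powr (- 2)" unfolding powr_add[symmetric] by simp
    also have "2 * ?d powr (- 2) \<le> 2 * ?d powr (- (3 / 2))" using d by (intro mult_left_mono powr_mono) auto
    finally show ?thesis .
  qed
  \<comment> \<open>The budget \<open>n powr (- (3 / 2))\<close> is shared equally: one half for the
    coordinate tails, the other for the fluctuation.\<close>
  moreover have "n * (2 * exp (- (5 * l))) \<le> 1 / 2 * real n powr (- (3 / 2))"
  proof -
    have "n * (2 * exp (- (5 * l))) = 2 * (real n powr 1 * real n powr (- 5))"
      using dim2 by (simp add: powr_def l_def)
    also have "real n powr 1 * real n powr (- 5) = real n powr (- (5 / 2)) * real n powr (- (3 / 2))"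
      unfolding powr_add[symmetric] by simp
    also have "2 * (real n powr (- (5 / 2)) * real n powr (- (3 / 2))) \<le>
        2 * (1 / 4 * real n powr (- (3 / 2)))"
    proof (intro mult_left_mono mult_right_mono)
      have "real n powr (- (5 / 2)) \<le> real n powr (- 2)" using dim2 by (intro powr_mono) auto
      also have "\<dots> \<le> 2 powr (- 2)" using dim2 by (intro powr_mono2') auto
      also have "\<dots> = 1 / 4" by (simp add: powr_minus_divide powr_numeral)
      finally show "real n powr (- (5 / 2)) \<le> 1 / 4" .
    qed auto
    finally show ?thesis by simp
  qed
  ultimately show "measure_pmf.prob (response_dist P \<theta>s)
         {Y. \<exists>\<theta>h. is_mle P Y \<theta>h \<and>
              (l2norm (\<theta>h - \<theta>s))\<^sup>2 \<le>
                200 * (mat_trace (mat_inv (hess P \<theta>s)) * ln (real n) / real (n_total P))}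
         \<ge> 1 - 2 * real (n_items P) powr (- (3 / 2)) - real n powr (- (3 / 2))"
    using nb(6) unfolding tr_def l_def N_def by linarith
qed auto

end
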